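(* Let $N\ge2$, $0<\theta<1$, let $\lambda_\theta$ be the lens map with parameter $\theta$, and let $\Phi\colon\mathbb{D}^N\to\mathbb{D}^N$ be $\Phi(z_1,\dots,z_N)=(\lambda_\theta(z_1),\lambda_\theta(z_1),\dots,\lambda_\theta(z_1))$. Then: (1) if $\theta>1/N$, $C_\Phi$ is not bounded on $H^2(\mathbb{D}^N)$; (2) if $\theta=1/N$, $C_\Phi$ is bounded but not compact on $H^2(\mathbb{D}^N)$; (3) if $\theta<1/N$, $C_\Phi$ is compact on $H^2(\mathbb{D}^N)$ and there are constants $d>0$ depending only on $\theta$ and $N$, and $K>0$, such that $a_n(C_\Phi)\le Ke^{-d\sqrt n}$ for all $n\ge1$.
   Context: The lens map of parameter $\theta\in(0,1)$ is $\lambda_\theta(z)=\dfrac{(1+z)^\theta-(1-z)^\theta}{(1+z)^\theta+(1-z)^\theta}$, $z\in\mathbb{D}$ (principal branches). $H^2(\mathbb{D}^N)$ is the Hardy space of the polydisk: analytic $f=\sum_\alpha a_\alpha z^\alpha$ with $\|f\|^2=\sum_\alpha|a_\alpha|^2<\infty$; $C_\Phi f=f\circ\Phi$. The approximation numbers are $a_n(T)=\inf\{\|T-R\|:\operatorname{rank}R<n\}$. *)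

theory Defs
  imports "HOL-Analysis.Analysis"
begin

text \<open>Points of the polydisk D^N are represented as functions nat => complex;
  only the coordinates 0..N-1 matter (coordinate z_1 of the paper is z 0).\<close>

definition lens :: "real \<Rightarrow> complex \<Rightarrow> complex" where
  "lens \<theta> z = ((1 + z) powr (of_real \<theta>) - (1 - z) powr (of_real \<theta>)) /
                ((1 + z) powr (of_real \<theta>) + (1 - z) powr (of_real \<theta>))"

definition polydisk :: "nat \<Rightarrow> (nat \<Rightarrow> complex) set" where
  "polydisk N = {z. \<forall>i<N. norm (z i) < 1}"

definition multi_idx :: "nat \<Rightarrow> (nat \<Rightarrow> nat) set" where
  "multi_idx N = {\<alpha>. \<forall>i\<ge>N. \<alpha> i = 0}"

definition monom :: "nat \<Rightarrow> (nat \<Rightarrow> complex) \<Rightarrow> (nat \<Rightarrow> nat) \<Rightarrow> complex" where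
  "monom N z \<alpha> = (\<Prod>i<N. z i ^ \<alpha> i)"

definition h2_coeffs :: "nat \<Rightarrow> ((nat \<Rightarrow> complex) \<Rightarrow> complex) \<Rightarrow> ((nat \<Rightarrow> nat) \<Rightarrow> complex) \<Rightarrow> bool" where
  "h2_coeffs N f a \<longleftrightarrow>
     (\<forall>\<alpha>. \<alpha> \<notin> multi_idx N \<longrightarrow> a \<alpha> = 0) \<and>
     (\<lambda>\<alpha>. (norm (a \<alpha>))\<^sup>2) summable_on multi_idx N \<and>
     (\<forall>z\<in>polydisk N. ((\<lambda>\<alpha>. a \<alpha> * monom N z \<alpha>) has_sum f z) (multi_idx N))"

definition H2 :: "nat \<Rightarrow> ((nat \<Rightarrow> complex) \<Rightarrow> complex) set" where
  "H2 N = {f. \<exists>a. h2_coeffs N f a}"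

definition h2_norm :: "nat \<Rightarrow> ((nat \<Rightarrow> complex) \<Rightarrow> complex) \<Rightarrow> real" where
  "h2_norm N f = sqrt (infsum (\<lambda>\<alpha>. (norm ((SOME a. h2_coeffs N f a) \<alpha>))\<^sup>2) (multi_idx N))"

definition comp_op ::
  "((nat \<Rightarrow> complex) \<Rightarrow> (nat \<Rightarrow> complex)) \<Rightarrow> ((nat \<Rightarrow> complex) \<Rightarrow> complex) \<Rightarrow> ((nat \<Rightarrow> complex) \<Rightarrow> complex)" where
  "comp_op \<Phi> f = f \<circ> \<Phi>"

type_synonym op = "((nat \<Rightarrow> complex) \<Rightarrow> complex) \<Rightarrow> ((nat \<Rightarrow> complex) \<Rightarrow> complex)"

definition bounded_on_H2 :: "nat \<Rightarrow> op \<Rightarrow> bool" where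
  "bounded_on_H2 N T \<longleftrightarrow> (\<forall>f\<in>H2 N. T f \<in> H2 N) \<and>
     (\<exists>C. \<forall>f\<in>H2 N. h2_norm N (T f) \<le> C * h2_norm N f)"

text \<open>Compact: maps H2 into H2 and the image of every bounded sequence (norm \<le> 1)
  has a Cauchy (hence convergent, H2 being complete) subsequence.\<close>
definition compact_on_H2 :: "nat \<Rightarrow> op \<Rightarrow> bool" where
  "compact_on_H2 N T \<longleftrightarrow> (\<forall>f\<in>H2 N. T f \<in> H2 N) \<and>
     (\<forall>u. (\<forall>k. u k \<in> H2 N \<and> h2_norm N (u k) \<le> 1) \<longrightarrow>
        (\<exists>r::nat\<Rightarrow>nat. strict_mono r \<and> (\<forall>e::real>0. \<exists>M::nat. \<forall>m\<ge>M. \<forall>n\<ge>M.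
            h2_norm N (\<lambda>z. T (u (r m)) z - T (u (r n)) z) < e)))"

definition op_norm :: "nat \<Rightarrow> op \<Rightarrow> real" where
  "op_norm N T = Sup ((\<lambda>f. h2_norm N (T f)) ` {f \<in> H2 N. h2_norm N f \<le> 1})"

definition linear_on_H2 :: "nat \<Rightarrow> op \<Rightarrow> bool" where
  "linear_on_H2 N R \<longleftrightarrow> (\<forall>f\<in>H2 N. R f \<in> H2 N) \<and>
     (\<forall>f\<in>H2 N. \<forall>g\<in>H2 N. \<forall>a b. \<forall>z\<in>polydisk N.
        R (\<lambda>w. a * f w + b * g w) z = a * R f z + b * R g z)"

definition rank_less :: "nat \<Rightarrow> op \<Rightarrow> nat \<Rightarrow> bool" where
  "rank_less N R n \<longleftrightarrow> (\<exists>m<n. \<exists>g :: nat \<Rightarrow> ((nat \<Rightarrow> complex) \<Rightarrow> complex).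
     (\<forall>k<m. g k \<in> H2 N) \<and>
     (\<forall>f\<in>H2 N. \<exists>c :: nat \<Rightarrow> complex. \<forall>z\<in>polydisk N. R f z = (\<Sum>k<m. c k * g k z)))"

definition approx_num :: "nat \<Rightarrow> op \<Rightarrow> nat \<Rightarrow> real" where
  "approx_num N T n = Inf {op_norm N (\<lambda>f z. T f z - R f z) | R.
      linear_on_H2 N R \<and> bounded_on_H2 N R \<and> rank_less N R n}"

definition lens_diag :: "real \<Rightarrow> (nat \<Rightarrow> complex) \<Rightarrow> (nat \<Rightarrow> complex)" where
  "lens_diag \<theta> z = (\<lambda>i. lens \<theta> (z 0))"

end

theory Submission
  imports Defs "HOL-Complex_Analysis.Complex_Analysis"
begin

text \<open>
  Restricting \<open>f \<in> H2 N\<close> to the diagonal gives a power series whose coefficients \<open>b d\<close> satisfy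
  \<open>\<Sum>d. |b d|\<^sup>2 / (d + 1)^(N - 1) \<le> \<parallel>f\<parallel>\<^sup>2\<close>, so everything reduces to the one-variable operator \<open>g \<mapsto> g \<circ> lens \<theta>\<close>
  into the Hardy space of the disk.

  Lower bounds: test on the normalised reproducing kernels at the points \<open>lens \<theta> s\<close>, \<open>s \<rightarrow> 1\<close>, and
  evaluate the image at \<open>s\<close>; the ratio is at least \<open>4^(-N) (1 - s\<^sup>2) powr (1 - N \<theta>)\<close>.

  Boundedness for \<open>\<theta> = 1 / N\<close>: Cauchy-Schwarz gives \<open>|g w|\<^sup>2 \<le> (\<Sum>d. |b d|\<^sup>2 |w|^d) / (1 - |w|)\<close>, while
  \<open>1 - |lens \<theta> z|\<^sup>2 \<ge> c s powr \<theta>\<close> when \<open>z\<close> has distance at least \<open>2 s\<close> from \<open>1\<close> and \<open>-1\<close>; the resulting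
  integrals over circles are at most \<open>C (d + 1)^(1 - N)\<close>.

  For \<open>\<theta> < 1 / N\<close> factor \<open>lens \<theta> = lens (1 / N) \<circ> lens (N \<theta>)\<close>: the first factor maps into the Hardy
  space, and there \<open>g = (finite rank part) + B h\<close> with \<open>\<parallel>h\<parallel> \<le> \<parallel>g\<parallel>\<close> for a finite Blaschke product \<open>B\<close>. Placing
  zeros of multiplicity \<open>p\<close> at \<open>2p + 1\<close> dyadic scales makes \<open>B \<circ> lens (N \<theta>)\<close> exponentially small in \<open>p\<close> except
  exponentially close to \<open>1\<close> and \<open>-1\<close>, where the size of \<open>h \<circ> lens (N \<theta>)\<close> is integrable; the rank is about \<open>2 p\<^sup>2\<close>.
\<close>

subsection \<open>Square-summable power series on the disk\<close>

text \<open>The threshold \<theta> = 1/N is an exponent count. On the diagonal, functions of norm 1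
  can be as large as (1 - |w|^2) powr (-N/2), and at distance s from 1 and -1 the defect of
  \<open>lens \<theta>\<close> is at least of order s powr \<theta>, so squared values integrate
  like s powr (-N \<theta>). At N \<theta> = 1 this diverges logarithmically, so each degree d is
  integrated separately: its integral gains the factor (d + 1)^(1 - N) that cancels the weight.
  Passing through \<open>lens (1/N)\<close> replaces the weighted space by an unweighted one. There
  division by a Blaschke factor is contractive; with weights (d + 1)^(1 - N) even division by w
  increases norms. In the half-plane coordinate \<open>cayley\<close> a lens map is a power, with
  image in a sector. On a sector the Blaschke factor of a point b > 0 gains a fixed amount only
  where |W| is comparable to b. Hence one point per dyadic scale, with a multiplicity that turns the
  fixed gain into an exponential one. Multiplicity p and p scales on either side of 1 balance this
  gain against the loss outside the covered range; rank of order p^2 against error exp(-c p) is the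
  origin of the square root of n.\<close>

lemma suminf_Cauchy_Schwarz:
  fixes f g :: "nat \<Rightarrow> real"
  assumes f: "summable (\<lambda>n. (f n)\<^sup>2)" and g: "summable (\<lambda>n. (g n)\<^sup>2)"
    and nonneg: "\<And>n. f n \<ge> 0" "\<And>n. g n \<ge> 0"
  shows "summable (\<lambda>n. f n * g n)"
    and "(\<Sum>n. f n * g n)\<^sup>2 \<le> (\<Sum>n. (f n)\<^sup>2) * (\<Sum>n. (g n)\<^sup>2)"
proof -
  show s: "summable (\<lambda>n. f n * g n)"
  proof (rule summable_comparison_test')
    show "summable (\<lambda>n. (f n)\<^sup>2 + (g n)\<^sup>2)"
      using f g by (rule summable_add)
    show "norm (f n * g n) \<le> (f n)\<^sup>2 + (g n)\<^sup>2" if "n \<ge> 0" for n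
      using sum_squares_bound[of "f n" "g n"] mult_nonneg_nonneg[OF nonneg(1)[of n] nonneg(2)[of n]]
      unfolding real_norm_def by linarith
  qed
  have "(\<lambda>n. (\<Sum>k<n. f k * g k)\<^sup>2) \<longlonglongrightarrow> (\<Sum>n. f n * g n)\<^sup>2"
    by (intro tendsto_power summable_LIMSEQ s)
  then show "(\<Sum>n. f n * g n)\<^sup>2 \<le> (\<Sum>n. (f n)\<^sup>2) * (\<Sum>n. (g n)\<^sup>2)"
  proof (rule LIMSEQ_le_const2, intro exI allI impI)
    fix n :: nat
    have "(\<Sum>k<n. f k * g k)\<^sup>2 \<le> (\<Sum>k<n. (f k)\<^sup>2) * (\<Sum>k<n. (g k)\<^sup>2)"
      by (rule Cauchy_Schwarz_ineq_sum)
    also have "\<dots> \<le> (\<Sum>n. (f n)\<^sup>2) * (\<Sum>n. (g n)\<^sup>2)"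
      by (intro mult_mono sum_le_suminf f g sum_nonneg suminf_nonneg) auto
    finally show "(\<Sum>k<n. f k * g k)\<^sup>2 \<le> (\<Sum>n. (f n)\<^sup>2) * (\<Sum>n. (g n)\<^sup>2)" .
  qed
qed

definition ev :: "(nat \<Rightarrow> complex) \<Rightarrow> complex \<Rightarrow> complex" where
  "ev c z = (\<Sum>n. c n * z ^ n)"

text \<open>Cauchy-Schwarz against a geometric sequence. The last claim is the bound for point
  evaluation in the Hardy space, with the Szego kernel 1 / (1 - |z|^2).\<close>

lemma ell2_power_series:
  assumes c: "summable (\<lambda>n. (cmod (c n))\<^sup>2)" and z: "cmod z < 1"
  shows "summable (\<lambda>n. cmod (c n * z ^ n))"
    and "(\<lambda>n. c n * z ^ n) sums ev c z"
    and "(cmod (ev c z))\<^sup>2 \<le> (\<Sum>n. (cmod (c n))\<^sup>2) / (1 - (cmod z)\<^sup>2)"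
proof -
  have z2: "norm ((cmod z)\<^sup>2) < 1"
    using z by (simp add: power_less_one_iff)
  have g: "(\<lambda>n. (cmod z ^ n)\<^sup>2) sums (1 / (1 - (cmod z)\<^sup>2))"
    using geometric_sums[OF z2] by (simp add: power_mult[symmetric] mult.commute)
  note cs = suminf_Cauchy_Schwarz[OF c sums_summable[OF g]]
  show s: "summable (\<lambda>n. cmod (c n * z ^ n))"
    using cs(1) by (simp add: norm_mult norm_power)
  then show "(\<lambda>n. c n * z ^ n) sums ev c z"
    unfolding ev_def by (rule summable_sums[OF summable_norm_cancel])
  have "(cmod (ev c z))\<^sup>2 \<le> (\<Sum>n. cmod (c n * z ^ n))\<^sup>2"
    unfolding ev_def by (intro power_mono summable_norm s) auto
  also have "\<dots> \<le> (\<Sum>n. (cmod (c n))\<^sup>2) * (1 / (1 - (cmod z)\<^sup>2))"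
    using cs(2) by (simp add: norm_mult norm_power sums_unique[OF g, symmetric])
  finally show "(cmod (ev c z))\<^sup>2 \<le> (\<Sum>n. (cmod (c n))\<^sup>2) / (1 - (cmod z)\<^sup>2)"
    by simp
qed

lemma ev_holomorphic:
  assumes c: "summable (\<lambda>n. (cmod (c n))\<^sup>2)"
  shows "ev c holomorphic_on ball 0 1"
  by (rule power_series_holomorphic[of 0 1 c]) (use ell2_power_series[OF c] in auto)

lemma power_series_unique_disk:
  fixes c d :: "nat \<Rightarrow> complex"
  assumes c: "\<And>z. cmod z < 1 \<Longrightarrow> (\<lambda>n. c n * z ^ n) sums h z"
    and d: "\<And>z. cmod z < 1 \<Longrightarrow> (\<lambda>n. d n * z ^ n) sums h z"
  shows "c = d"
proof (rule ext, rule ccontr)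
  fix m assume m: "c m \<noteq> d m"
  have s: "(\<lambda>n. (c n - d n) * (z - 0) ^ n) sums 0" if "norm (z - 0) < 1" for z
    using sums_diff[OF c[of z] d[of z]] that by (simp add: algebra_simps)
  \<comment> \<open>\<open>powser_0_nonzero\<close> wants a nonzero coefficient of positive index;
    index 0 is excluded by evaluating at 0.\<close>
  have "m > 0"
    using s[of 0] m by (cases m) auto
  obtain r where "0 < r" "\<And>z::complex. z \<in> cball 0 r - {0} \<Longrightarrow> (0::complex) \<noteq> 0"
    by (rule powser_0_nonzero[of 1 0 "\<lambda>n. c n - d n" "\<lambda>_. 0" m])
      (use s m \<open>m > 0\<close> in auto)
  from this(2)[of "of_real r"] this(1) show False by simp
qed

definition taylor :: "(complex \<Rightarrow> complex) \<Rightarrow> nat \<Rightarrow> complex" where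
  "taylor h n = (deriv ^^ n) h 0 / fact n"

lemma taylor_sums:
  assumes "h holomorphic_on ball 0 1" "cmod z < 1"
  shows "(\<lambda>n. taylor h n * z ^ n) sums h z"
  using holomorphic_power_series[OF assms(1), of z] assms(2) by (simp add: taylor_def)

lemma taylor_eqI:
  assumes "\<And>z. cmod z < 1 \<Longrightarrow> (\<lambda>n. c n * z ^ n) sums h z"
  shows "taylor h = c"
proof (rule power_series_unique_disk)
  have "h holomorphic_on ball 0 1"
    by (rule power_series_holomorphic[of 0 1 c]) (use assms in auto)
  then show "(\<lambda>n. taylor h n * z ^ n) sums h z" if "cmod z < 1" for z
    using that by (rule taylor_sums)
qed (fact assms)

lemma taylor_linear:
  assumes "f holomorphic_on ball 0 1" "g holomorphic_on ball 0 1"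
  shows "taylor (\<lambda>z. a * f z + b * g z) = (\<lambda>n. a * taylor f n + b * taylor g n)"
proof (rule taylor_eqI)
  fix z :: complex assume z: "cmod z < 1"
  show "(\<lambda>n. (a * taylor f n + b * taylor g n) * z ^ n) sums (a * f z + b * g z)"
    using sums_add[OF sums_mult[OF taylor_sums[OF assms(1) z], of a] sums_mult[OF taylor_sums[OF assms(2) z], of b]]
    by (simp add: algebra_simps)
qed

subsection \<open>Square means on circles\<close>

text \<open>Orthogonality of the exponentials after symmetrisation: odd k cancel between z and -z,
  nonzero even k have mean zero over {0..1/2}. The value 2 at k = 0 is four points times length
  1/2.\<close>

lemma has_integral_cos_quarter:
  fixes k :: int
  shows "((\<lambda>s. 2 * cos (of_int k * pi * s) * (if even k then 2 else 0))
    has_integral (if k = 0 then 2 else 0)) {0..1/2}"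
proof (cases "k = 0 \<or> odd k")
  case True
  then show ?thesis
    using has_integral_const_real[of "4::real" 0 "1/2"] by auto
next
  case False
  then obtain j where j: "k = 2 * j" "j \<noteq> 0" by auto
  have "((\<lambda>s. cos (of_int k * pi * s)) has_integral
      (sin (of_int k * pi * (1/2)) / (of_int k * pi) - sin (of_int k * pi * 0) / (of_int k * pi))) {0..1/2}"
    by (rule fundamental_theorem_of_calculus)
       (use False in \<open>auto intro!: derivative_eq_intros simp flip: has_real_derivative_iff_has_vector_derivative\<close>)
  moreover have "sin (of_int k * pi * (1/2)) = 0"
    using sin_int_times_real[of j] j by (simp add: field_simps sin_zero_iff_int2)
  ultimately have "((\<lambda>s. cos (of_int k * pi * s)) has_integral 0) {0..1/2}"
    by simp
  from has_integral_mult_right[OF this, of 4] show ?thesis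
    using j by (simp add: mult.commute)
qed

lemma cmod_square_power_sum:
  "complex_of_real ((cmod (\<Sum>n<K. c n * z ^ n))\<^sup>2) =
    (\<Sum>m<K. \<Sum>n<K. (c m * cnj (c n)) * (z ^ m * cnj z ^ n))"
  by (simp add: complex_norm_square sum_product cnj_sum mult_ac del: of_real_power)

text \<open>Conjugate points combine the phases into a cosine. Negation multiplies by (-1)^(m + n),
  and m + n has the parity of m - n.\<close>

lemma four_points_phase:
  fixes r x :: real
  defines "z \<equiv> of_real r * cis x"
  shows "z ^ m * cnj z ^ n + (- z) ^ m * cnj (- z) ^ n + cnj z ^ m * z ^ n + cnj (- z) ^ m * (- z) ^ n =
    of_real (r ^ (m + n) * (2 * cos (of_int (int m - int n) * x) * (if even (int m - int n) then 2 else 0)))"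
proof -
  have a: "z ^ m * cnj z ^ n = of_real (r ^ (m + n)) * cis (of_int (int m - int n) * x)" for m n
    by (simp add: z_def power_mult_distrib cis_cnj Complex.DeMoivre cis_mult power_add algebra_simps)
  have b: "(- z) ^ m * cnj (- z) ^ n = (- 1) ^ (m + n) * (z ^ m * cnj z ^ n)" for m n
    by (simp add: power_minus[of z] power_minus[of "cnj z"] power_add)
  have c: "(- 1 :: complex) ^ (m + n) = (if even (int m - int n) then 1 else - 1)"
    by auto
  have d: "cis (of_int (int m - int n) * x) + cis (of_int (int n - int m) * x)
      = of_real (2 * cos (of_int (int m - int n) * x))"
  proof -
    have "of_int (int n - int m) * x = - (of_int (int m - int n) * x)" by (simp add: algebra_simps)
    then show ?thesis by (simp add: complex_eq_iff)
  qed
  have "z ^ m * cnj z ^ n + (- z) ^ m * cnj (- z) ^ n + cnj z ^ m * z ^ n + cnj (- z) ^ m * (- z) ^ n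
    = (1 + (-1) ^ (m + n)) * (of_real (r ^ (m + n)) *
        (cis (of_int (int m - int n) * x) + cis (of_int (int n - int m) * x)))"
    using a[of m n] a[of n m] b[of m n] b[of n m]
    by (simp add: mult.commute[of "cnj z ^ m"] mult.commute[of "(- cnj z) ^ m"] add.commute[of n m] algebra_simps)
  also have "\<dots> = of_real (r ^ (m + n) * (2 * cos (of_int (int m - int n) * x) * (if even (int m - int n) then 2 else 0)))"
    unfolding d c by simp
  finally show ?thesis .
qed

text \<open>Averaging over the orbit of a point under the symmetries of the pair \<open>{1, -1}\<close> reduces circle means to
  integrals over \<open>{0..1/2}\<close> with a possible singularity only at \<open>0\<close>.\<close>

definition four_points :: "real \<Rightarrow> real \<Rightarrow> complex list" where
  "four_points r s = (let z = of_real r * cis (pi * s) in [z, - z, cnj z, cnj (- z)])"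

lemma four_points_norm: "z \<in> set (four_points r s) \<Longrightarrow> cmod z = \<bar>r\<bar>"
  by (auto simp: four_points_def Let_def norm_mult)

text \<open>Parseval for polynomials; the factor 2 is four points times the interval length
  1/2.\<close>

lemma four_points_mean_poly:
  "((\<lambda>s. \<Sum>z\<leftarrow>four_points r s. (cmod (\<Sum>n<K. c n * z ^ n))\<^sup>2)
    has_integral 2 * (\<Sum>n<K. (cmod (c n))\<^sup>2 * (r ^ n)\<^sup>2)) {0..1/2}"
proof -
  let ?k = "\<lambda>m n. int m - int n"
  define G where "G m n s = r ^ (m + n) * (2 * cos (of_int (?k m n) * pi * s) * (if even (?k m n) then 2 else 0))" for m n s
  have G: "(G m n has_integral r ^ (m + n) * (if m = n then 2 else 0)) {0..1/2}" for m n
    using has_integral_mult_right[OF has_integral_cos_quarter[of "?k m n"], of "r ^ (m + n)"]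
    by (simp add: G_def[abs_def] cong: if_cong)
  have eq: "(\<Sum>z\<leftarrow>four_points r s. (cmod (\<Sum>n<K. c n * z ^ n))\<^sup>2) =
      (\<Sum>m<K. \<Sum>n<K. Re (c m * cnj (c n)) * G m n s)" for s
  proof -
    have "complex_of_real (\<Sum>z\<leftarrow>four_points r s. (cmod (\<Sum>n<K. c n * z ^ n))\<^sup>2) =
      (\<Sum>m<K. \<Sum>n<K. (c m * cnj (c n)) * of_real (G m n s))"
      using four_points_phase[of r "pi * s"]
      by (simp add: four_points_def Let_def cmod_square_power_sum G_def mult.assoc
          sum.distrib[symmetric] distrib_left[symmetric] add.assoc del: of_real_power)
    from arg_cong[OF this, of Re] show ?thesis by simp
  qed
  have "((\<lambda>s. \<Sum>m<K. \<Sum>n<K. Re (c m * cnj (c n)) * G m n s) has_integral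
     (\<Sum>m<K. \<Sum>n<K. Re (c m * cnj (c n)) * (r ^ (m + n) * (if m = n then 2 else 0)))) {0..1/2}"
    by (intro has_integral_sum has_integral_mult_right G) auto
  also have "(\<Sum>m<K. \<Sum>n<K. Re (c m * cnj (c n)) * (r ^ (m + n) * (if m = n then 2 else 0))) =
     (\<Sum>m<K. Re (c m * cnj (c m)) * (r ^ (m + m) * 2))"
    by (rule sum.cong) (auto simp: if_distrib[of "\<lambda>x. _ * x"] cong: if_cong)
  also have "\<dots> = 2 * (\<Sum>n<K. (cmod (c n))\<^sup>2 * (r ^ n)\<^sup>2)"
    by (simp only: complex_norm_square[symmetric] Re_complex_of_real)
       (simp add: sum_distrib_left power_add power2_eq_square mult_ac)
  finally show ?thesis by (simp only: eq)
qed

text \<open>Jordan's inequality: by concavity the sine lies above its chord from 0 to pi/2.\<close>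

lemma sin_pi_mult_ge:
  assumes "0 \<le> s" "s \<le> 1/2"
  shows "2 * s \<le> sin (pi * s)"
proof -
  have "convex_on {0..pi/2} (\<lambda>x. - sin x)"
    by (rule f''_ge0_imp_convex[where f' = "\<lambda>x. - cos x" and f'' = sin])
       (auto intro!: derivative_eq_intros sin_ge_zero)
  from convex_onD_Icc[OF this, of "2 * s"] assms show ?thesis
    by (simp add: mult.commute)
qed

text \<open>\<open>sin (pi * s)\<close> is the distance of 1 and of -1 from the lines through 0 at
  angles pi s and -pi s, so the bound holds for every radius.\<close>

lemma four_points_dist:
  assumes z: "z \<in> set (four_points r s)" and s: "0 \<le> s" "s \<le> 1/2"
  shows "2 * s \<le> cmod (1 - z)" "2 * s \<le> cmod (1 + z)"
proof -
  define C S where "C = cos (pi * s)" and "S = sin (pi * s)"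
  have CS: "C\<^sup>2 + S\<^sup>2 = 1" by (simp add: C_def S_def)
  have "S \<le> cmod w" if "\<bar>Re w - 1\<bar> = \<bar>r * C\<bar>" "\<bar>Im w\<bar> = \<bar>r * S\<bar>" for w
  proof -
    define x where "x = Re w - 1"
    have x: "x\<^sup>2 = (r * C)\<^sup>2" and y: "(Im w)\<^sup>2 = (r * S)\<^sup>2"
      using that unfolding x_def by (metis power2_abs)+
    have "(cmod w)\<^sup>2 = (1 + x)\<^sup>2 + (r * S)\<^sup>2"
      by (simp add: cmod_power2 x_def y)
    also have "\<dots> = 1 + 2 * x + (r * C)\<^sup>2 + (r * S)\<^sup>2"
      using x by (simp add: power2_sum)
    also have "\<dots> = 1 + 2 * x + r\<^sup>2"
      using arg_cong[OF CS, of "\<lambda>t. r\<^sup>2 * t"] by (simp add: power_mult_distrib algebra_simps)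
    \<comment> \<open>The difference of the two sides is the square of r + C or of r - C.\<close>
    also have "\<dots> \<ge> S\<^sup>2"
    proof -
      have "x = r * C \<or> x = - (r * C)" using x by (simp add: power2_eq_iff)
      moreover have "0 \<le> (r + C)\<^sup>2" "0 \<le> (r - C)\<^sup>2" by simp_all
      ultimately show ?thesis using CS by (auto simp: power2_sum power2_diff)
    qed
    finally show ?thesis by (rule power2_le_imp_le) simp
  qed
  note * = this
  have "\<bar>Re z\<bar> = \<bar>r * C\<bar>" "\<bar>Im z\<bar> = \<bar>r * S\<bar>"
    using z by (auto simp: four_points_def Let_def C_def S_def)
  then have "S \<le> cmod (1 - z)" "S \<le> cmod (1 + z)"
    by (auto intro!: *)
  then show "2 * s \<le> cmod (1 - z)" "2 * s \<le> cmod (1 + z)"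
    using sin_pi_mult_ge[OF s] by (auto simp: S_def)
qed

text \<open>Only polynomials are integrated: the partial sums of h converge uniformly on the circle,
  and Parseval for them is compared with the majorant \<phi>. No integrability of |h|^2 has to be
  established.\<close>

lemma circle_mean_bound:
  assumes h: "\<And>z. cmod z < 1 \<Longrightarrow> (\<lambda>n. c n * z ^ n) sums h z"
    and r: "0 < r" "r < 1"
    and phi: "(\<phi> has_integral I) {0..1/2}"
    and bd: "\<And>z s. cmod z = r \<Longrightarrow> 0 < s \<Longrightarrow> s \<le> 1/2 \<Longrightarrow> 2 * s \<le> cmod (1 - z) \<Longrightarrow> 2 * s \<le> cmod (1 + z) \<Longrightarrow>
      (cmod (h z))\<^sup>2 \<le> \<phi> s"
  shows "(\<Sum>n<K. (cmod (c n))\<^sup>2 * (r ^ n)\<^sup>2) \<le> 2 * I"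
proof -
  define T where "T k = (\<Sum>n. cmod (c (n + k)) * r ^ (n + k))" for k
  \<comment> \<open>Convergence at a radius between r and 1 gives absolute convergence at r.\<close>
  have "summable (\<lambda>n. c n * of_real ((1 + r) / 2) ^ n)"
    using h[of "of_real ((1 + r) / 2)"] r by (auto simp: sums_iff simp del: of_real_divide of_real_add)
  from powser_insidea[OF this, of "of_real r"] r
  have sm: "summable (\<lambda>n. cmod (c n) * r ^ n)"
    by (simp add: norm_mult norm_power del: of_real_divide of_real_add)
  have smk: "summable (\<lambda>n. cmod (c (n + k)) * r ^ (n + k))" for k
    using sm by (subst summable_iff_shift[of "\<lambda>n. cmod (c n) * r ^ n" k])
  have T: "T \<longlonglongrightarrow> 0"
  proof -
    have "T k = (\<Sum>n. cmod (c n) * r ^ n) - (\<Sum>n<k. cmod (c n) * r ^ n)" for k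
      unfolding T_def using sm by (rule suminf_minus_initial_segment)
    moreover have "(\<lambda>k. (\<Sum>n. cmod (c n) * r ^ n) - (\<Sum>n<k. cmod (c n) * r ^ n)) \<longlonglongrightarrow>
        (\<Sum>n. cmod (c n) * r ^ n) - (\<Sum>n. cmod (c n) * r ^ n)"
      by (intro tendsto_diff tendsto_const summable_LIMSEQ sm)
    ultimately show ?thesis by (simp add: LIMSEQ_def)
  qed
  have T0: "T k \<ge> 0" for k
    unfolding T_def using r by (intro suminf_nonneg smk) auto
  have tail: "cmod (h z - (\<Sum>n<k. c n * z ^ n)) \<le> T k" if "cmod z = r" for z k
  proof -
    have "(\<lambda>n. c (n + k) * z ^ (n + k)) sums (h z - (\<Sum>n<k. c n * z ^ n))"
      using h[of z] that r by (intro sums_split_initial_segment) auto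
    then have "h z - (\<Sum>n<k. c n * z ^ n) = (\<Sum>n. c (n + k) * z ^ (n + k))"
      by (simp add: sums_iff)
    also have "cmod \<dots> \<le> T k"
      unfolding T_def using that by (intro norm_suminf_le smk) (simp add: norm_mult norm_power)
    finally show ?thesis .
  qed
  \<comment> \<open>\<open>T 0\<close> bounds |h| on the circle, the partial sum being empty; so
    \<open>E k\<close> controls what the expansion of (|h| + T k)^2 adds to |h|^2.\<close>
  define E where "E k = 2 * T 0 * T k + (T k)\<^sup>2" for k
  have poly: "(cmod (\<Sum>n<k. c n * z ^ n))\<^sup>2 \<le> \<phi> s + E k"
    if z: "z \<in> set (four_points r s)" and s: "0 < s" "s \<le> 1/2" for z s k
  proof -
    have zr: "cmod z = r" using four_points_norm[OF z] r by simp
    have "cmod (\<Sum>n<k. c n * z ^ n) \<le> cmod (h z) + T k"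
      using tail[OF zr, of k] norm_triangle_ineq4[of "h z" "h z - (\<Sum>n<k. c n * z ^ n)"] by simp
    then have "(cmod (\<Sum>n<k. c n * z ^ n))\<^sup>2 \<le> (cmod (h z) + T k)\<^sup>2"
      by (rule power_mono) simp
    also have "\<dots> = (cmod (h z))\<^sup>2 + (2 * cmod (h z) * T k + (T k)\<^sup>2)"
      by (simp add: power2_sum)
    also have "\<dots> \<le> \<phi> s + E k"
      unfolding E_def using four_points_dist[OF z] s tail[OF zr, of 0] T0
      by (intro add_mono bd mult_right_mono mult_left_mono zr) auto
    finally show ?thesis .
  qed
  have bound: "(\<Sum>n<k. (cmod (c n))\<^sup>2 * (r ^ n)\<^sup>2) \<le> 2 * I + E k" for k
  proof -
    \<comment> \<open>The majorant is only assumed for s > 0. At s = 0 a crude bound of the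
      polynomial takes its place, which leaves the integral unchanged.\<close>
    have "((\<lambda>s. if s = 0 then 4 * (\<Sum>n<k. cmod (c n) * r ^ n)\<^sup>2 else 4 * (\<phi> s + E k))
        has_integral (4 * (I + E k * (1/2)))) {0..1/2}"
      by (rule has_integral_spike_finite[of "{0}" _ _ "\<lambda>s. 4 * (\<phi> s + E k)"])
         (use has_integral_mult_right[OF has_integral_add[OF phi has_integral_const_real[of "E k" 0 "1/2"]], of 4]
           in \<open>auto simp: mult.commute\<close>)
    moreover have "(\<Sum>z\<leftarrow>four_points r s. (cmod (\<Sum>n<k. c n * z ^ n))\<^sup>2)
        \<le> (if s = 0 then 4 * (\<Sum>n<k. cmod (c n) * r ^ n)\<^sup>2 else 4 * (\<phi> s + E k))"
      (is "_ \<le> ?R") if "s \<in> {0..1/2}" for s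
    proof -
      have "(cmod (\<Sum>n<k. c n * z ^ n))\<^sup>2 \<le> ?R / 4" if z: "z \<in> set (four_points r s)" for z
      proof (cases "s = 0")
        case True
        have "cmod (\<Sum>n<k. c n * z ^ n) \<le> (\<Sum>n<k. cmod (c n) * r ^ n)"
          using four_points_norm[OF z] r by (intro sum_norm_le) (auto simp: norm_mult norm_power)
        then show ?thesis using True by (auto intro: power_mono)
      next
        case False
        then show ?thesis using poly[OF z, of k] that \<open>s \<in> {0..1/2}\<close> by auto
      qed
      note * = this
      show ?thesis
        using *[of "four_points r s ! 0"] *[of "four_points r s ! 1"]
          *[of "four_points r s ! 2"] *[of "four_points r s ! 3"]
        by (simp add: four_points_def Let_def)
    qed
    ultimately have "2 * (\<Sum>n<k. (cmod (c n))\<^sup>2 * (r ^ n)\<^sup>2) \<le> 4 * (I + E k * (1/2))"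
      by (rule has_integral_le[OF four_points_mean_poly])
    then show ?thesis by simp
  qed
  have "(\<lambda>k. 2 * I + E k) \<longlonglongrightarrow> 2 * I + (2 * T 0 * 0 + 0\<^sup>2)"
    unfolding E_def by (intro tendsto_intros T)
  then have "(\<lambda>k. 2 * I + E k) \<longlonglongrightarrow> 2 * I" by simp
  then show ?thesis
  proof (rule LIMSEQ_le_const, intro exI[of _ K] allI impI)
    fix k assume "K \<le> k"
    then have "(\<Sum>n<K. (cmod (c n))\<^sup>2 * (r ^ n)\<^sup>2) \<le> (\<Sum>n<k. (cmod (c n))\<^sup>2 * (r ^ n)\<^sup>2)"
      by (intro sum_mono2) auto
    with bound[of k] show "(\<Sum>n<K. (cmod (c n))\<^sup>2 * (r ^ n)\<^sup>2) \<le> 2 * I + E k" by linarith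
  qed
qed

lemma ell2_bound_from_circles:
  fixes c :: "nat \<Rightarrow> complex"
  assumes "\<And>r K. 0 < r \<Longrightarrow> r < 1 \<Longrightarrow> (\<Sum>n<K. (cmod (c n))\<^sup>2 * (r ^ n)\<^sup>2) \<le> A"
  shows "summable (\<lambda>n. (cmod (c n))\<^sup>2)" and "(\<Sum>n. (cmod (c n))\<^sup>2) \<le> A"
proof -
  have fin: "(\<Sum>n<K. (cmod (c n))\<^sup>2) \<le> A" for K
  proof -
    have "((\<lambda>r. \<Sum>n<K. (cmod (c n))\<^sup>2 * (r ^ n)\<^sup>2) \<longlongrightarrow> (\<Sum>n<K. (cmod (c n))\<^sup>2 * (1 ^ n)\<^sup>2)) (at_left (1::real))"
      by (intro tendsto_intros)
    moreover have "\<forall>\<^sub>F r in at_left (1::real). (\<Sum>n<K. (cmod (c n))\<^sup>2 * (r ^ n)\<^sup>2) \<le> A"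
      by (rule eventually_at_leftI[of 0]) (auto intro: assms)
    ultimately show ?thesis
      using tendsto_upperbound[of _ _ "at_left (1::real)" A] by fastforce
  qed
  show s: "summable (\<lambda>n. (cmod (c n))\<^sup>2)"
    by (rule bounded_imp_summable[of _ A])
      (use fin[of "Suc _"] in \<open>auto simp: lessThan_Suc_atMost\<close>)
  show "(\<Sum>n. (cmod (c n))\<^sup>2) \<le> A"
    by (rule suminf_le_const[OF s fin])
qed

text \<open>The majorant sees z only through its distances to 1 and -1, so one integral serves all
  circles of radius below 1.\<close>

lemma hardy_bound:
  assumes h: "h holomorphic_on ball 0 1"
    and phi: "(\<phi> has_integral I) {0..1/2}"
    and bd: "\<And>z s. cmod z < 1 \<Longrightarrow> 0 < s \<Longrightarrow> s \<le> 1/2 \<Longrightarrow> 2 * s \<le> cmod (1 - z) \<Longrightarrow> 2 * s \<le> cmod (1 + z) \<Longrightarrow>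
      (cmod (h z))\<^sup>2 \<le> \<phi> s"
  shows "summable (\<lambda>n. (cmod (taylor h n))\<^sup>2)" and "(\<Sum>n. (cmod (taylor h n))\<^sup>2) \<le> 2 * I"
proof -
  have "(\<Sum>n<K. (cmod (taylor h n))\<^sup>2 * (r ^ n)\<^sup>2) \<le> 2 * I" if "0 < r" "r < 1" for r K
    by (rule circle_mean_bound[OF taylor_sums[OF h] that phi]) (use that in \<open>auto intro: bd\<close>)
  note * = ell2_bound_from_circles[of "taylor h", OF this]
  show "summable (\<lambda>n. (cmod (taylor h n))\<^sup>2)" and "(\<Sum>n. (cmod (taylor h n))\<^sup>2) \<le> 2 * I"
    using * by auto
qed

subsection \<open>Blaschke division\<close>

text \<open>If \<open>c\<close> is the coefficient sequence of \<open>g\<close>, then \<open>blaschke_quot a c\<close> is that of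
  \<open>(g - g(a) (1 - a\<^sup>2) / (1 - a z)) / ((z - a) / (1 - a z))\<close>. Working with tail sums avoids the removable
  singularity, and contractivity becomes a telescoping identity.\<close>

definition tail_sum :: "real \<Rightarrow> (nat \<Rightarrow> complex) \<Rightarrow> nat \<Rightarrow> complex" where
  "tail_sum a c n = (\<Sum>j. c (n + j) * of_real a ^ j)"

definition blaschke_quot :: "real \<Rightarrow> (nat \<Rightarrow> complex) \<Rightarrow> nat \<Rightarrow> complex" where
  "blaschke_quot a c n = tail_sum a c (Suc n) - of_real a * tail_sum a c n"

context
  fixes a :: real and c :: "nat \<Rightarrow> complex"
  assumes a: "\<bar>a\<bar> < 1" and c: "summable (\<lambda>n. (cmod (c n))\<^sup>2)"
begin

lemma summable_shifted: "summable (\<lambda>j. (cmod (c (n + j)))\<^sup>2)"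
  using c summable_iff_shift[of "\<lambda>j. (cmod (c j))\<^sup>2" n] by (simp add: add.commute)

lemma tail_sum_sums: "(\<lambda>j. c (n + j) * of_real a ^ j) sums tail_sum a c n"
  using ell2_power_series(2)[OF summable_shifted, of "of_real a" n] a by (simp add: ev_def tail_sum_def)

lemma tail_sum_Suc: "c n = tail_sum a c n - of_real a * tail_sum a c (Suc n)"
proof -
  have "(\<lambda>j. of_real a * (c (Suc n + j) * of_real a ^ j)) sums (of_real a * tail_sum a c (Suc n))"
    by (intro sums_mult tail_sum_sums)
  then have "(\<lambda>j. c (n + Suc j) * of_real a ^ Suc j) sums (of_real a * tail_sum a c (Suc n))"
    by (simp add: mult_ac)
  then have "(\<lambda>j. c (n + j) * of_real a ^ j) sums (of_real a * tail_sum a c (Suc n) + c (n + 0) * of_real a ^ 0)"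
    by (rule sums_Suc)
  from sums_unique2[OF this tail_sum_sums] show ?thesis by (simp add: algebra_simps)
qed

lemma tail_sum_bound:
  "(cmod (tail_sum a c n))\<^sup>2 \<le> (\<Sum>j. (cmod (c (n + j)))\<^sup>2) / (1 - a\<^sup>2)"
  using ell2_power_series(3)[OF summable_shifted, of "of_real a" n] a by (simp add: ev_def tail_sum_def)

lemma tail_sum_tendsto: "tail_sum a c \<longlonglongrightarrow> 0"
proof -
  have "(\<lambda>n. (\<Sum>j. (cmod (c (n + j)))\<^sup>2)) \<longlonglongrightarrow> 0"
    using suminf_exist_split2[OF c] by (simp add: add.commute)
  then have "(\<lambda>n. (\<Sum>j. (cmod (c (n + j)))\<^sup>2) / (1 - a\<^sup>2)) \<longlonglongrightarrow> 0 / (1 - a\<^sup>2)"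
    by (intro tendsto_divide tendsto_const) (use a in \<open>auto simp: abs_square_eq_1\<close>)
  then have lim: "(\<lambda>n. (\<Sum>j. (cmod (c (n + j)))\<^sup>2) / (1 - a\<^sup>2)) \<longlonglongrightarrow> 0"
    by simp
  have "(\<lambda>n. (cmod (tail_sum a c n))\<^sup>2) \<longlonglongrightarrow> 0"
    by (rule tendsto_sandwich[OF _ _ tendsto_const lim]) (simp_all add: tail_sum_bound)
  then show ?thesis
    by (simp add: tendsto_norm_zero_iff)
qed

text \<open>For consecutive tail sums x and y, the coefficient of \<open>c\<close> is x - a y and
  that of the quotient is y - a x; their squared moduli differ by (1 - a^2) (|y|^2 - |x|^2).\<close>

lemma blaschke_quot_telescope:
  "(\<Sum>n<M. (cmod (blaschke_quot a c n))\<^sup>2) = (\<Sum>n<M. (cmod (c n))\<^sup>2)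
    + (1 - a\<^sup>2) * ((cmod (tail_sum a c M))\<^sup>2 - (cmod (tail_sum a c 0))\<^sup>2)"
proof (induction M)
  case (Suc M)
  have "(cmod (y - of_real a * x))\<^sup>2 - (cmod (x - of_real a * y))\<^sup>2 = (1 - a\<^sup>2) * ((cmod y)\<^sup>2 - (cmod x)\<^sup>2)" for x y
    unfolding cmod_power2 by (simp add: power2_eq_square algebra_simps)
  from this[of "tail_sum a c (Suc M)" "tail_sum a c M"]
  have "(cmod (blaschke_quot a c M))\<^sup>2 - (cmod (c M))\<^sup>2 =
     (1 - a\<^sup>2) * ((cmod (tail_sum a c (Suc M)))\<^sup>2 - (cmod (tail_sum a c M))\<^sup>2)"
    by (simp add: blaschke_quot_def flip: tail_sum_Suc)
  with Suc show ?case by (simp add: algebra_simps)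
qed simp

text \<open>In the limit the telescoped identity is Pythagoras: \<open>tail_sum a c 0\<close> is
  g(a), and the squared norm drops by (1 - a^2) |g(a)|^2, the share of the kernel at a.\<close>

lemma blaschke_quot_ell2:
  shows "summable (\<lambda>n. (cmod (blaschke_quot a c n))\<^sup>2)"
    and "(\<Sum>n. (cmod (blaschke_quot a c n))\<^sup>2) \<le> (\<Sum>n. (cmod (c n))\<^sup>2)"
proof -
  have "(\<lambda>M. \<Sum>n<M. (cmod (blaschke_quot a c n))\<^sup>2) \<longlonglongrightarrow>
    (\<Sum>n. (cmod (c n))\<^sup>2) + (1 - a\<^sup>2) * ((cmod 0)\<^sup>2 - (cmod (tail_sum a c 0))\<^sup>2)"
    unfolding blaschke_quot_telescope
    by (intro tendsto_intros summable_LIMSEQ c tail_sum_tendsto)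
  then have s: "(\<lambda>n. (cmod (blaschke_quot a c n))\<^sup>2) sums
      ((\<Sum>n. (cmod (c n))\<^sup>2) - (1 - a\<^sup>2) * (cmod (tail_sum a c 0))\<^sup>2)"
    by (simp add: sums_def)
  then show "summable (\<lambda>n. (cmod (blaschke_quot a c n))\<^sup>2)"
    by (rule sums_summable)
  have "(1 - a\<^sup>2) * (cmod (tail_sum a c 0))\<^sup>2 \<ge> 0"
    using a by (intro mult_nonneg_nonneg) (auto simp: abs_square_le_1)
  with s show "(\<Sum>n. (cmod (blaschke_quot a c n))\<^sup>2) \<le> (\<Sum>n. (cmod (c n))\<^sup>2)"
    by (simp add: sums_iff)
qed

text \<open>The series \<open>S\<close> below is the difference quotient of g between w and a, in a
  form that also makes sense at w = a. Both g(w) and the value of the quotient are linear in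
  \<open>S\<close> and \<open>tail_sum a c 0\<close>, which leaves a polynomial identity.\<close>

lemma ev_blaschke_quot:
  assumes w: "cmod w < 1"
  shows "ev c w = ((1 - of_real a ^ 2) * tail_sum a c 0) / (1 - of_real a * w)
    + (w - of_real a) / (1 - of_real a * w) * ev (blaschke_quot a c) w"
proof -
  let ?E = "tail_sum a c" and ?a = "complex_of_real a"
  have aw: "1 - ?a * w \<noteq> 0"
  proof
    assume "1 - ?a * w = 0"
    then have "cmod (?a * w) = 1" by simp
    moreover have "cmod (?a * w) < 1"
      using a w mult_left_mono[of "cmod w" 1 "\<bar>a\<bar>"] by (simp add: norm_mult)
    ultimately show False by simp
  qed
  obtain B where B: "\<And>n. cmod (?E n) \<le> B"
    using convergent_imp_Bseq[OF convergentI[OF tail_sum_tendsto]] unfolding Bseq_def by blast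
  have "summable (\<lambda>n. ?E (Suc n) * w ^ n)"
  proof (rule summable_comparison_test')
    show "summable (\<lambda>n. B * cmod w ^ n)"
      using w by (intro summable_mult summable_geometric) auto
    show "norm (?E (Suc n) * w ^ n) \<le> B * cmod w ^ n" if "n \<ge> 0" for n
      using B by (simp add: norm_mult norm_power mult_right_mono)
  qed
  then obtain S where S: "(\<lambda>n. ?E (Suc n) * w ^ n) sums S"
    by (auto simp: summable_def)
  have "(\<lambda>n. w * (?E (Suc n) * w ^ n)) sums (w * S)"
    by (rule sums_mult[OF S])
  then have "(\<lambda>n. ?E (Suc n) * w ^ Suc n) sums (w * S)"
    by (simp add: mult_ac)
  then have E: "(\<lambda>n. ?E n * w ^ n) sums (w * S + ?E 0)"
    using sums_Suc[of "\<lambda>n. ?E n * w ^ n"] by simp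
  have 1: "ev c w = w * S + ?E 0 - ?a * S"
  proof -
    have "(\<lambda>n. ?E n * w ^ n - ?a * (?E (Suc n) * w ^ n)) sums (w * S + ?E 0 - ?a * S)"
      by (intro sums_diff sums_mult E S)
    also have "(\<lambda>n. ?E n * w ^ n - ?a * (?E (Suc n) * w ^ n)) = (\<lambda>n. c n * w ^ n)"
      by (subst tail_sum_Suc) (simp add: algebra_simps)
    finally show ?thesis by (simp add: ev_def sums_iff)
  qed
  have 2: "ev (blaschke_quot a c) w = S - ?a * (w * S + ?E 0)"
  proof -
    have "(\<lambda>n. ?E (Suc n) * w ^ n - ?a * (?E n * w ^ n)) sums (S - ?a * (w * S + ?E 0))"
      by (intro sums_diff sums_mult E S)
    then show ?thesis
      by (simp add: ev_def sums_iff blaschke_quot_def algebra_simps)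
  qed
  show ?thesis
  proof -
    have "(1 - ?a ^ 2) * ?E 0 + (w - ?a) * (S - ?a * (w * S + ?E 0)) = (w * S + ?E 0 - ?a * S) * (1 - ?a * w)"
      by (simp add: power2_eq_square algebra_simps)
    then show ?thesis
      unfolding 1 2 using aw by (simp add: eq_divide_eq add_divide_distrib[symmetric])
  qed
qed

end

subsection \<open>The lens map\<close>

text \<open>A half-plane coordinate: it carries the disk to the right half-plane with -1 going to 0
  and 1 to infinity, and turns \<open>lens \<theta>\<close> into the principal power with exponent
  \<theta>.\<close>

definition cayley :: "complex \<Rightarrow> complex" where
  "cayley z = (1 + z) / (1 - z)"

lemma disk_Re_pos:
  assumes "cmod z < 1"
  shows "0 < Re (1 + z)" "0 < Re (1 - z)"
  using abs_Re_le_cmod[of z] assms by auto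

lemma cayley_Re_pos:
  assumes z: "cmod z < 1"
  shows "0 < Re (cayley z)"
proof -
  have ne: "1 - z \<noteq> 0" using z by auto
  have "cayley z = (1 + z) * cnj (1 - z) / of_real ((cmod (1 - z))\<^sup>2)"
    using ne by (simp add: cayley_def complex_norm_square del: of_real_power)
  then have "Re (cayley z) = Re ((1 + z) * cnj (1 - z)) / (cmod (1 - z))\<^sup>2"
    by (simp only: Re_divide_of_real)
  also have "Re ((1 + z) * cnj (1 - z)) = 1 - (cmod z)\<^sup>2"
    unfolding cmod_power2 by (simp add: power2_eq_square algebra_simps)
  finally show ?thesis
    using z ne by (simp add: power_less_one_iff abs_square_less_1)
qed

lemma inverse_cayley:
  assumes "W \<noteq> - 1"
  shows "cayley ((W - 1) / (W + 1)) = W"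
proof -
  have "W + 1 \<noteq> 0" using assms by (simp add: add_eq_0_iff2)
  then have "1 + (W - 1) / (W + 1) = 2 * W / (W + 1)" "1 - (W - 1) / (W + 1) = 2 / (W + 1)"
    by (simp_all add: field_simps)
  with \<open>W + 1 \<noteq> 0\<close> show ?thesis by (simp add: cayley_def)
qed

lemma cayley_inverse_defect:
  assumes "0 < Re W"
  shows "1 - (cmod ((W - 1) / (W + 1)))\<^sup>2 = 4 * Re W / (cmod (W + 1))\<^sup>2"
proof -
  have "W + 1 \<noteq> 0"
  proof
    assume "W + 1 = 0"
    then have "Re (W + 1) = 0" by (simp only: zero_complex.sel)
    with assms show False by simp
  qed
  then have "1 - (cmod ((W - 1) / (W + 1)))\<^sup>2 = ((cmod (W + 1))\<^sup>2 - (cmod (W - 1))\<^sup>2) / (cmod (W + 1))\<^sup>2"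
    unfolding norm_divide power_divide by (simp add: divide_simps)
  also have "(cmod (W + 1))\<^sup>2 - (cmod (W - 1))\<^sup>2 = 4 * Re W"
    unfolding cmod_power2 by (simp add: power2_eq_square algebra_simps)
  finally show ?thesis .
qed

context
  fixes Z :: complex and \<theta> :: real
  assumes Z: "0 < Re Z" and \<theta>: "0 < \<theta>" "\<theta> < 1"
begin

lemma Z_nz: "Z \<noteq> 0"
  using Z by auto

lemma sector_Im_Ln: "\<bar>Im (Ln Z)\<bar> < pi / 2"
  using Z Z_nz Re_Ln_pos_lt by blast

lemma sector_powr_norm: "cmod (Z powr of_real \<theta>) = cmod Z powr \<theta>"
  using Z_nz by (simp add: powr_def norm_exp_eq_Re)

text \<open>The argument of Z is below pi/2 in modulus, so that of its power is below pi \<theta> /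
  2: the powers stay in a sector on which real part and modulus are comparable.\<close>

lemma sector_powr_Re: "cos (pi * \<theta> / 2) * cmod Z powr \<theta> \<le> Re (Z powr of_real \<theta>)"
proof -
  have "Re (Z powr of_real \<theta>) = cmod Z powr \<theta> * cos (\<theta> * Im (Ln Z))"
    using Z_nz by (simp add: powr_def Re_exp)
  moreover have "cos (pi * \<theta> / 2) \<le> cos \<bar>\<theta> * Im (Ln Z)\<bar>"
  proof (rule cos_monotone_0_pi_le)
    show "\<bar>\<theta> * Im (Ln Z)\<bar> \<le> pi * \<theta> / 2"
      using sector_Im_Ln \<theta> by (simp add: abs_mult field_simps)
    show "pi * \<theta> / 2 \<le> pi"
      using \<theta> by (simp add: field_simps)
  qed simp
  ultimately show ?thesis
    by (simp add: mult.commute mult_left_mono)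
qed

lemma cos_half_pos: "0 < cos (pi * \<theta> / 2)"
  using \<theta> by (intro cos_gt_zero_pi) (auto simp: field_simps intro: order.strict_trans[of _ 0])

lemma sector_powr_Re_pos: "0 < Re (Z powr of_real \<theta>)"
  by (rule less_le_trans[OF _ sector_powr_Re]) (use cos_half_pos Z_nz in simp)

text \<open>As \<theta> < 1, the number \<theta> Ln Z stays in the strip where \<open>Ln\<close>
  inverts \<open>exp\<close>; this is why iterated principal powers multiply their
  exponents.\<close>

lemma sector_powr_powr:
  "(Z powr of_real \<theta>) powr of_real \<eta> = Z powr of_real (\<theta> * \<eta>)"
proof -
  have "\<bar>\<theta> * Im (Ln Z)\<bar> \<le> \<bar>Im (Ln Z)\<bar>"
    using \<theta> by (simp add: abs_mult mult_left_le_one_le)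
  then have "Ln (exp (of_real \<theta> * Ln Z)) = of_real \<theta> * Ln Z"
    using sector_Im_Ln pi_gt_zero by (intro Ln_exp) auto
  then show ?thesis
    using Z_nz by (simp add: powr_def mult_ac)
qed

end

text \<open>The principal power is multiplicative on \<open>cayley z * (1 - z)\<close>: both
  arguments are below pi/2 in modulus, so their sum stays in the principal range.\<close>

lemma lens_cayley:
  assumes z: "cmod z < 1"
  shows "lens \<theta> z = (cayley z powr of_real \<theta> - 1) / (cayley z powr of_real \<theta> + 1)"
proof -
  have nz: "1 + z \<noteq> 0" "1 - z \<noteq> 0" "cayley z \<noteq> 0"
    using disk_Re_pos[OF z] cayley_Re_pos[OF z] by (auto simp: complex_eq_iff)
  have "\<bar>Im (Ln (cayley z))\<bar> < pi / 2" "\<bar>Im (Ln (1 - z))\<bar> < pi / 2"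
    using nz disk_Re_pos[OF z] cayley_Re_pos[OF z] Re_Ln_pos_lt by blast+
  then have "Ln (cayley z * (1 - z)) = Ln (cayley z) + Ln (1 - z)"
    using nz by (intro Ln_times_simple) auto
  moreover have "cayley z * (1 - z) = 1 + z"
    using nz by (simp add: cayley_def)
  ultimately have eq: "(1 + z) powr of_real \<theta> = cayley z powr of_real \<theta> * (1 - z) powr of_real \<theta>"
    using nz by (simp add: powr_def exp_add[symmetric] distrib_left)
  have "lens \<theta> z = ((cayley z powr of_real \<theta> - 1) * (1 - z) powr of_real \<theta>) / ((cayley z powr of_real \<theta> + 1) * (1 - z) powr of_real \<theta>)"
    unfolding lens_def eq by (simp add: algebra_simps)
  then show ?thesis
    using nz by simp
qed

context
  fixes \<theta> :: real
  assumes \<theta>: "0 < \<theta>" "\<theta> < 1"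
begin

lemma lens_defect:
  assumes z: "cmod z < 1"
  shows "1 - (cmod (lens \<theta> z))\<^sup>2 = 4 * Re (cayley z powr of_real \<theta>) / (cmod (cayley z powr of_real \<theta> + 1))\<^sup>2"
  unfolding lens_cayley[OF z] by (rule cayley_inverse_defect sector_powr_Re_pos cayley_Re_pos z \<theta>)+

lemma cayley_powr_ne: 
  assumes z: "cmod z < 1"
  shows "cayley z powr of_real \<theta> \<noteq> - 1"
  using sector_powr_Re_pos[OF cayley_Re_pos[OF z] \<theta>] by auto

lemma lens_in_disk:
  assumes z: "cmod z < 1"
  shows "cmod (lens \<theta> z) < 1"
proof -
  have "0 < 1 - (cmod (lens \<theta> z))\<^sup>2"
    unfolding lens_defect[OF z]
    using sector_powr_Re_pos[OF cayley_Re_pos[OF z] \<theta>] cayley_powr_ne[OF z]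
    by (auto simp: add_eq_0_iff2)
  then show ?thesis
    by (simp add: abs_square_less_1)
qed

lemma cayley_lens:
  assumes z: "cmod z < 1"
  shows "cayley (lens \<theta> z) = cayley z powr of_real \<theta>"
  unfolding lens_cayley[OF z] by (rule inverse_cayley cayley_powr_ne z)+

lemma lens_lens:
  assumes z: "cmod z < 1"
  shows "lens \<eta> (lens \<theta> z) = lens (\<theta> * \<eta>) z"
  unfolding lens_cayley[OF lens_in_disk[OF z]] cayley_lens[OF z]
    sector_powr_powr[OF cayley_Re_pos[OF z] \<theta>] by (rule lens_cayley[OF z, symmetric])

lemma lens_holomorphic: "lens \<theta> holomorphic_on ball 0 1"
proof -
  have "(\<lambda>z. (cayley z powr of_real \<theta> - 1) / (cayley z powr of_real \<theta> + 1)) holomorphic_on ball 0 1"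
  proof (intro holomorphic_intros)
    show "cayley holomorphic_on ball 0 1" "cayley holomorphic_on ball 0 1"
      unfolding cayley_def[abs_def] by (intro holomorphic_intros; auto)+
    show "cayley z \<notin> \<real>\<^sub>\<le>\<^sub>0" if "z \<in> ball 0 1" for z
      using cayley_Re_pos[of z] that by (auto simp: complex_nonpos_Reals_iff)
    then show "cayley z \<notin> \<real>\<^sub>\<le>\<^sub>0" if "z \<in> ball 0 1" for z
      using that .
    show "cayley z powr of_real \<theta> + 1 \<noteq> 0" if "z \<in> ball 0 1" for z
      using cayley_powr_ne[of z] that by (auto simp: add_eq_0_iff2)
  qed
  then show ?thesis
    by (rule holomorphic_transform) (simp add: lens_cayley)
qed

lemma cayley_norm_bounds:
  assumes z: "cmod z < 1" and s: "0 < s" "2 * s \<le> cmod (1 - z)" "2 * s \<le> cmod (1 + z)"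
  shows "s \<le> cmod (cayley z)" "s \<le> 1 / cmod (cayley z)"
proof -
  have "cmod (1 - z) \<le> 2" "cmod (1 + z) \<le> 2"
    using z norm_triangle_ineq4[of 1 z] norm_triangle_ineq[of 1 z] by auto
  moreover have "0 < cmod (1 - z)" "0 < cmod (1 + z)"
    using s by linarith+
  moreover from calculation have "s * cmod (1 - z) \<le> cmod (1 + z)" "s * cmod (1 + z) \<le> cmod (1 - z)"
    using s mult_left_mono[of "cmod (1 - z)" 2 s] mult_left_mono[of "cmod (1 + z)" 2 s] by linarith+
  ultimately show "s \<le> cmod (cayley z)" "s \<le> 1 / cmod (cayley z)"
    by (auto simp: cayley_def norm_divide pos_le_divide_eq)
qed

text \<open>With u = |W| the defect is at least 4 k u / (1 + u)^2, which dominates k min(u, 1/u).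
  Both u and 1/u are at least s powr \<theta>, because z keeps away from the points where
  \<open>cayley\<close> becomes 0 or infinite.\<close>

lemma lens_defect_lower:
  assumes z: "cmod z < 1" and s: "0 < s" "2 * s \<le> cmod (1 - z)" "2 * s \<le> cmod (1 + z)"
  shows "cos (pi * \<theta> / 2) * s powr \<theta> \<le> 1 - (cmod (lens \<theta> z))\<^sup>2"
proof -
  define W where "W = cayley z powr of_real \<theta>"
  define u where "u = cmod W"
  define k where "k = cos (pi * \<theta> / 2)"
  have k: "k > 0" unfolding k_def by (rule cos_half_pos[OF cayley_Re_pos[OF z] \<theta>])
  have u: "u = cmod (cayley z) powr \<theta>"
    unfolding u_def W_def by (rule sector_powr_norm[OF cayley_Re_pos[OF z] \<theta>])
  have cpos: "0 < cmod (cayley z)"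
    using cayley_norm_bounds[OF z s] s by linarith
  have su: "s powr \<theta> \<le> u" "s powr \<theta> \<le> 1 / u"
  proof -
    show "s powr \<theta> \<le> u" unfolding u using cayley_norm_bounds[OF z s] s \<theta> by (intro powr_mono2) auto
    have "s powr \<theta> \<le> (1 / cmod (cayley z)) powr \<theta>"
      using cayley_norm_bounds[OF z s] s \<theta> by (intro powr_mono2) auto
    then show "s powr \<theta> \<le> 1 / u" using cpos by (simp add: u powr_divide)
  qed
  have u0: "u > 0" using su(1) s by (smt (verit) powr_gt_zero)
  have "s powr \<theta> * (1 + u)\<^sup>2 \<le> 4 * u"
  proof (cases "u \<le> 1")
    case True
    then have "(1 + u)\<^sup>2 \<le> 2\<^sup>2" using u0 by (intro power_mono) auto
    then have "s powr \<theta> * (1 + u)\<^sup>2 \<le> u * 4" using su u0 by (intro mult_mono) auto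
    then show ?thesis by simp
  next
    case False
    then have "(1 + u)\<^sup>2 \<le> (2 * u)\<^sup>2" using u0 by (intro power_mono) auto
    then have "s powr \<theta> * (1 + u)\<^sup>2 \<le> (1 / u) * (2 * u)\<^sup>2" using su u0 by (intro mult_mono) auto
    then show ?thesis using u0 by (simp add: power2_eq_square)
  qed
  then have "s powr \<theta> \<le> 4 * u / (1 + u)\<^sup>2"
    using u0 by (simp add: pos_le_divide_eq)
  then have "k * s powr \<theta> \<le> 4 * (k * u) / (1 + u)\<^sup>2"
    using mult_left_mono[of "s powr \<theta>" "4 * u / (1 + u)\<^sup>2" k] k by (simp add: mult_ac)
  also have "\<dots> \<le> 4 * Re W / (cmod (W + 1))\<^sup>2"
  proof (rule frac_le)
    show "4 * (k * u) \<le> 4 * Re W"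
      using sector_powr_Re[OF cayley_Re_pos[OF z] \<theta>] by (simp add: k_def u W_def)
    then show "0 \<le> 4 * Re W" using k u0 by (smt (verit) mult_pos_pos)
    show "(cmod (W + 1))\<^sup>2 \<le> (1 + u)\<^sup>2"
      using norm_triangle_ineq[of W 1] by (intro power_mono) (auto simp: u_def)
    show "0 < (cmod (W + 1))\<^sup>2"
      using cayley_powr_ne[OF z] by (auto simp: W_def add_eq_0_iff2)
  qed
  finally show ?thesis
    unfolding lens_defect[OF z] by (simp add: k_def W_def)
qed

text \<open>An estimate opposite to \<open>lens_defect_lower\<close>, along the radius towards 1.
  Its constant 4 is the source of the powers 4^N in the lower bounds for the operator.\<close>

lemma lens_of_real:
  assumes s: "0 \<le> s" "s < 1"
  obtains r where "lens \<theta> (of_real s) = of_real r" "0 \<le> r" "r < 1"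
    "1 - r\<^sup>2 \<le> 4 * (1 - s\<^sup>2) powr \<theta>"
proof -
  define x where "x = (1 + s) / (1 - s)"
  have x: "x \<ge> 1" using s by (simp add: x_def)
  define u where "u = x powr \<theta>"
  have u: "u \<ge> 1" using x \<theta> by (simp add: u_def ge_one_powr_ge_zero)
  define r where "r = (u - 1) / (u + 1)"
  have "cayley (of_real s) = of_real x"
    by (simp add: cayley_def x_def)
  then have "cayley (of_real s) powr of_real \<theta> = of_real u"
    using x by (simp add: u_def powr_of_real)
  then have 1: "lens \<theta> (of_real s) = of_real r"
    using s by (simp add: lens_cayley r_def)
  have 2: "0 \<le> r" "r < 1" using u by (auto simp: r_def)
  have "1 - r\<^sup>2 = 4 * u / (u + 1)\<^sup>2"
    using u by (simp add: r_def power_divide divide_simps) (simp add: power2_eq_square algebra_simps)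
  also have "\<dots> \<le> 4 * u / u\<^sup>2"
    using u by (intro divide_left_mono power_mono mult_pos_pos) auto
  also have "\<dots> = 4 * (1 / x) powr \<theta>"
    using u x by (simp add: u_def power2_eq_square powr_divide)
  also have "\<dots> \<le> 4 * (1 - s\<^sup>2) powr \<theta>"
  proof -
    have "1 * (1 - s) \<le> (1 + s) * (1 + s) * (1 - s)"
      using s by (intro mult_right_mono) (auto simp: algebra_simps)
    then have "1 - s \<le> (1 - s\<^sup>2) * (1 + s)"
      by (simp add: power2_eq_square algebra_simps)
    then have "1 / x \<le> 1 - s\<^sup>2"
      using s by (simp add: x_def pos_divide_le_eq)
    then show ?thesis using x \<theta> by (intro mult_left_mono powr_mono2) auto
  qed
  finally show ?thesis using 1 2 that by blast
qed

end

section \<open>Blaschke factors in the disk and in the half-plane coordinate\<close>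

lemma blaschke_factor_le_1:
  assumes a: "\<bar>a\<bar> < 1" and w: "cmod w < 1"
  shows "cmod ((w - of_real a) / (1 - of_real a * w)) \<le> 1"
proof -
  have "(cmod (1 - of_real a * w))\<^sup>2 - (cmod (w - of_real a))\<^sup>2 = (1 - a\<^sup>2) * (1 - (cmod w)\<^sup>2)"
    unfolding cmod_power2 by (simp add: power2_eq_square algebra_simps)
  moreover have "0 \<le> (1 - a\<^sup>2) * (1 - (cmod w)\<^sup>2)"
    using a w by (intro mult_nonneg_nonneg) (auto simp: abs_square_le_1)
  ultimately have "(cmod (w - of_real a))\<^sup>2 \<le> (cmod (1 - of_real a * w))\<^sup>2" by linarith
  then have "cmod (w - of_real a) \<le> cmod (1 - of_real a * w)"
    by (rule power2_le_imp_le) simp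
  then show ?thesis
    by (simp add: norm_divide divide_le_eq_1)
qed

text \<open>(b - 1) / (b + 1) is the disk point with Cayley coordinate b, so its Blaschke factor is
  the pullback of the half-plane factor vanishing at b.\<close>

lemma blaschke_factor_cayley:
  assumes b: "b > 0" and w: "cmod w < 1"
  shows "(w - of_real ((b - 1) / (b + 1))) / (1 - of_real ((b - 1) / (b + 1)) * w)
    = (cayley w - of_real b) / (cayley w + of_real b)"
proof -
  let ?b = "complex_of_real b"
  have "?b + 1 = of_real (b + 1)" by simp
  then have "?b + 1 \<noteq> 0"
    using b by (simp only: of_real_eq_0_iff)
  moreover have "1 - w \<noteq> 0"
    using w by auto
  ultimately have nz: "1 - w \<noteq> 0" "?b + 1 \<noteq> 0" by auto
  have "(w - of_real ((b - 1) / (b + 1))) / (1 - of_real ((b - 1) / (b + 1)) * w)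
     = ((w - (?b - 1) / (?b + 1)) * (?b + 1)) / ((1 - (?b - 1) / (?b + 1) * w) * (?b + 1))"
    using nz(2) by simp
  also have "\<dots> = ((1 + w) - ?b * (1 - w)) / ((1 + w) + ?b * (1 - w))"
    using nz by (intro arg_cong2[of _ _ _ _ "(/)"]) (simp_all add: field_simps)
  also have "\<dots> = (((1 + w) - ?b * (1 - w)) / (1 - w)) / (((1 + w) + ?b * (1 - w)) / (1 - w))"
    using nz by simp
  also have "\<dots> = (cayley w - ?b) / (cayley w + ?b)"
    using nz by (simp add: cayley_def diff_divide_distrib add_divide_distrib)
  finally show ?thesis .
qed

text \<open>One minus the left side is 4 b Re W / |W + b|^2. In a sector, with |W| comparable to b,
  this is bounded below uniformly in b.\<close>

lemma sector_blaschke_bound: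
  assumes b: "b > 0" "b \<le> cmod W" "cmod W \<le> 2 * b" and k: "0 < k" "k * cmod W \<le> Re W"
  shows "(cmod ((W - of_real b) / (W + of_real b)))\<^sup>2 \<le> 1 - 8 / 9 * k"
proof -
  define u where "u = cmod W"
  define D where "D = (cmod (W + of_real b))\<^sup>2"
  have "0 < Re (W + of_real b)" using k b by (smt (verit) mult_pos_pos Re_complex_of_real plus_complex.sel(1))
  then have D: "D > 0" unfolding D_def by (auto simp: complex_eq_iff)
  have diff: "D - (cmod (W - of_real b))\<^sup>2 = 4 * b * Re W"
    unfolding cmod_power2 D_def by (simp add: power2_eq_square algebra_simps)
  have "D \<le> (u + b)\<^sup>2"
    using norm_triangle_ineq[of W "of_real b"] b unfolding D_def by (intro power_mono) (auto simp: u_def)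
  \<comment> \<open>For u between b/2 and 2b one has 2 u^2 - 5 u b + 2 b^2 <= 0, that is (u + b)^2
    <= (9/2) b u; and 4 divided by 9/2 is 8/9.\<close>
  moreover have "8 * (u + b)\<^sup>2 \<le> 36 * (b * u)"
  proof -
    have "0 \<le> (2 * u - b) * (2 * b - u)" using b by (intro mult_nonneg_nonneg) (auto simp: u_def)
    then show ?thesis by (simp add: power2_eq_square algebra_simps)
  qed
  ultimately have "8 * D \<le> 36 * (b * u)" by linarith
  then have "k * (8 * D) \<le> k * (36 * (b * u))" using k by (intro mult_left_mono) auto
  also have "\<dots> \<le> 36 * (b * Re W)" using k b by (simp add: u_def mult.left_commute)
  finally have "8 / 9 * k * D \<le> D - (cmod (W - of_real b))\<^sup>2"
    unfolding diff by simp
  then have "(cmod (W - of_real b))\<^sup>2 \<le> (1 - 8 / 9 * k) * D" by (simp add: algebra_simps)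
  then show ?thesis
    using D by (simp add: norm_divide power_divide pos_divide_le_eq D_def)
qed

subsection \<open>Multi-indices and uniqueness of the coefficients\<close>

lemma multi_idx_Suc_bij:
  "bij_betw (\<lambda>(n, \<alpha>). \<alpha>(N := n)) (UNIV \<times> multi_idx N) (multi_idx (Suc N))"
  by (rule bij_betw_byWitness[where f' = "\<lambda>\<alpha>. (\<alpha> N, \<alpha>(N := 0))"])
     (auto simp: multi_idx_def fun_eq_iff)

lemma multi_idx_0: "multi_idx 0 = {\<lambda>_. 0}"
  by (auto simp: multi_idx_def)

lemma monom_Suc: "monom (Suc N) (z(N := w)) (\<alpha>(N := n)) = w ^ n * monom N z \<alpha>"
  by (simp add: monom_def)

text \<open>Induction on the number of variables: grouping by the exponent of the last variable w
  gives a power series in w with coefficients \<open>B n\<close>, which vanish by uniqueness in one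
  variable.\<close>

lemma multi_power_series_zero:
  assumes "\<And>z. z \<in> polydisk N \<Longrightarrow> ((\<lambda>\<alpha>. a \<alpha> * monom N z \<alpha>) has_sum 0) (multi_idx N)"
    and "\<alpha> \<in> multi_idx N"
  shows "a \<alpha> = 0"
  using assms
proof (induction N arbitrary: a \<alpha>)
  case 0
  then show ?case
    using "0"(1)[of undefined]
    by (simp add: multi_idx_0 polydisk_def Defs.monom_def has_sum_finite_iff)
next
  case (Suc N)
  define A where "A n \<alpha> = a (\<alpha>(N := n))" for n \<alpha>
  have "A n \<alpha> = 0" if \<alpha>: "\<alpha> \<in> multi_idx N" for n \<alpha>
  proof (rule Suc.IH[OF _ \<alpha>])
    fix z assume z: "z \<in> polydisk N"
    have hs: "((\<lambda>(n, \<alpha>). A n \<alpha> * (w ^ n * monom N z \<alpha>)) has_sum 0) (UNIV \<times> multi_idx N)"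
      if w: "cmod w < 1" for w
    proof -
      have "z(N := w) \<in> polydisk (Suc N)"
        using z w by (auto simp: polydisk_def less_Suc_eq)
      from Suc.prems(1)[OF this] show ?thesis
        unfolding has_sum_reindex_bij_betw[OF multi_idx_Suc_bij[of N], symmetric]
        by (simp add: case_prod_beta' monom_Suc A_def)
    qed
    define B where "B n = infsum (\<lambda>\<alpha>. A n \<alpha> * monom N z \<alpha>) (multi_idx N)" for n
    have B: "((\<lambda>\<alpha>. A n \<alpha> * monom N z \<alpha>) has_sum B n) (multi_idx N)" for n
    proof -
      \<comment> \<open>Summability of a slice is read off at w = 1/2; w must be nonzero because w^n
        is then divided out.\<close>
      have "(\<lambda>\<alpha>. A n \<alpha> * ((1/2) ^ n * monom N z \<alpha>)) summable_on multi_idx N"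
        using summable_on_SigmaD1[OF has_sum_imp_summable[OF hs[of "1/2"]], of n] by simp
      then have "(\<lambda>\<alpha>. 2 ^ n * (A n \<alpha> * ((1/2) ^ n * monom N z \<alpha>))) summable_on multi_idx N"
        by (rule summable_on_cmult_right)
      then have "(\<lambda>\<alpha>. A n \<alpha> * monom N z \<alpha>) summable_on multi_idx N"
        by (simp add: power_divide field_simps)
      then show ?thesis
        unfolding B_def by (rule has_sum_infsum)
    qed
    have "(\<lambda>n. B n * w ^ n) sums 0" if w: "cmod w < 1" for w
    proof (rule has_sum_imp_sums, rule has_sum_Sigma'[OF hs[OF w]])
      fix n
      from has_sum_cmult_right[OF B[of n], of "w ^ n"]
      show "((\<lambda>y. case (n, y) of (n, \<alpha>) \<Rightarrow> A n \<alpha> * (w ^ n * monom N z \<alpha>)) has_sum B n * w ^ n) (multi_idx N)"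
        by (simp add: mult_ac)
    qed
    then have "B = (\<lambda>_. 0)"
      by (intro power_series_unique_disk[of B "\<lambda>_. 0"]) auto
    with B show "((\<lambda>\<alpha>. A n \<alpha> * monom N z \<alpha>) has_sum 0) (multi_idx N)"
      by metis
  qed
  from this[of "\<alpha>(N := 0)" "\<alpha> N"] Suc.prems(2) show ?case
    by (simp add: A_def multi_idx_def)
qed

text \<open>This pins down the \<open>SOME\<close> in \<open>h2_norm\<close>: the norm may be
  computed from any coefficient family.\<close>

lemma h2_coeffs_unique:
  assumes a: "h2_coeffs N f a" and b: "h2_coeffs N f b"
  shows "a = b"
proof
  fix \<alpha>
  show "a \<alpha> = b \<alpha>"
  proof (cases "\<alpha> \<in> multi_idx N")
    case True
    have "((\<lambda>\<alpha>. (a \<alpha> - b \<alpha>) * monom N z \<alpha>) has_sum 0) (multi_idx N)" if "z \<in> polydisk N" for z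
      using has_sum_add[of "\<lambda>\<alpha>. a \<alpha> * monom N z \<alpha>" _ "f z" "\<lambda>\<alpha>. - (b \<alpha> * monom N z \<alpha>)" "- f z"] a b that
      by (simp add: h2_coeffs_def algebra_simps has_sum_uminus)
    from multi_power_series_zero[OF this True] show ?thesis by simp
  next
    case False
    then show ?thesis using a b by (simp add: h2_coeffs_def)
  qed
qed

lemma h2_norm_nonneg: "0 \<le> h2_norm N f"
  by (simp add: h2_norm_def infsum_nonneg)

lemma h2_norm_sq:
  assumes "h2_coeffs N f a"
  shows "(h2_norm N f)\<^sup>2 = infsum (\<lambda>\<alpha>. (norm (a \<alpha>))\<^sup>2) (multi_idx N)"
proof -
  have "(SOME a. h2_coeffs N f a) = a"
    using assms h2_coeffs_unique by blast
  then show ?thesis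
    by (simp add: h2_norm_def infsum_nonneg)
qed

text \<open>The norm bound rests on (x + y)^2 <= 2 x^2 + 2 y^2, a crude substitute for the triangle
  inequality that suffices for all later estimates.\<close>

lemma h2_linear_combination:
  assumes f: "f \<in> H2 N" and g: "g \<in> H2 N"
  shows "(\<lambda>z. x * f z + y * g z) \<in> H2 N"
    and "(h2_norm N (\<lambda>z. x * f z + y * g z))\<^sup>2
      \<le> 2 * (cmod x)\<^sup>2 * (h2_norm N f)\<^sup>2 + 2 * (cmod y)\<^sup>2 * (h2_norm N g)\<^sup>2"
proof -
  obtain a b where a: "h2_coeffs N f a" and b: "h2_coeffs N g b"
    using f g by (auto simp: H2_def)
  let ?c = "\<lambda>\<alpha>. x * a \<alpha> + y * b \<alpha>"
  let ?d = "\<lambda>\<alpha>. 2 * (cmod x)\<^sup>2 * (cmod (a \<alpha>))\<^sup>2 + 2 * (cmod y)\<^sup>2 * (cmod (b \<alpha>))\<^sup>2"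
  have le: "(cmod (?c \<alpha>))\<^sup>2 \<le> ?d \<alpha>" for \<alpha>
  proof -
    have "(cmod (?c \<alpha>))\<^sup>2 \<le> (cmod (x * a \<alpha>) + cmod (y * b \<alpha>))\<^sup>2"
      by (intro power_mono norm_triangle_ineq) auto
    also have "\<dots> \<le> 2 * (cmod (x * a \<alpha>))\<^sup>2 + 2 * (cmod (y * b \<alpha>))\<^sup>2"
      using sum_squares_bound[of "cmod (x * a \<alpha>)" "cmod (y * b \<alpha>)"] by (simp add: power2_sum)
    finally show ?thesis by (simp add: norm_mult power_mult_distrib)
  qed
  have "((\<lambda>\<alpha>. (cmod (a \<alpha>))\<^sup>2) has_sum (h2_norm N f)\<^sup>2) (multi_idx N)"
    "((\<lambda>\<alpha>. (cmod (b \<alpha>))\<^sup>2) has_sum (h2_norm N g)\<^sup>2) (multi_idx N)"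
    unfolding h2_norm_sq[OF a] h2_norm_sq[OF b] using a b by (auto simp: h2_coeffs_def)
  then have d: "(?d has_sum (2 * (cmod x)\<^sup>2 * (h2_norm N f)\<^sup>2 + 2 * (cmod y)\<^sup>2 * (h2_norm N g)\<^sup>2)) (multi_idx N)"
    by (intro has_sum_add has_sum_cmult_right)
  have s: "(\<lambda>\<alpha>. (cmod (?c \<alpha>))\<^sup>2) summable_on multi_idx N"
    by (rule summable_on_comparison_test[OF has_sum_imp_summable[OF d]]) (use le in auto)
  have c: "h2_coeffs N (\<lambda>z. x * f z + y * g z) ?c"
    unfolding h2_coeffs_def
  proof (intro conjI ballI s)
    fix z assume z: "z \<in> polydisk N"
    have "((\<lambda>\<alpha>. x * (a \<alpha> * monom N z \<alpha>) + y * (b \<alpha> * monom N z \<alpha>)) has_sum (x * f z + y * g z)) (multi_idx N)"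
      using a b z by (intro has_sum_add has_sum_cmult_right) (auto simp: h2_coeffs_def)
    then show "((\<lambda>\<alpha>. ?c \<alpha> * monom N z \<alpha>) has_sum (x * f z + y * g z)) (multi_idx N)"
      by (simp add: algebra_simps)
  qed (use a b in \<open>auto simp: h2_coeffs_def\<close>)
  then show "(\<lambda>z. x * f z + y * g z) \<in> H2 N"
    by (auto simp: H2_def)
  show "(h2_norm N (\<lambda>z. x * f z + y * g z))\<^sup>2
      \<le> 2 * (cmod x)\<^sup>2 * (h2_norm N f)\<^sup>2 + 2 * (cmod y)\<^sup>2 * (h2_norm N g)\<^sup>2"
    unfolding h2_norm_sq[OF c] using s d le
    by (intro has_sum_mono[OF has_sum_infsum d]) auto
qed

lemma h2_diff:
  assumes f: "f \<in> H2 N" and g: "g \<in> H2 N"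
  shows "(\<lambda>z. f z - g z) \<in> H2 N"
    and "(h2_norm N (\<lambda>z. f z - g z))\<^sup>2 \<le> 2 * (h2_norm N f)\<^sup>2 + 2 * (h2_norm N g)\<^sup>2"
  using h2_linear_combination[OF assms, of 1 "-1"] by simp_all

subsection \<open>Functions of one variable in the polydisk Hardy space\<close>

definition axis_idx :: "nat \<Rightarrow> nat \<Rightarrow> nat" where
  "axis_idx n = (\<lambda>i. if i = 0 then n else 0)"

lemma inj_axis_idx: "inj axis_idx"
  by (auto simp: inj_def axis_idx_def fun_eq_iff)

context
  fixes N :: nat
  assumes N: "N \<ge> 1"
begin

lemma axis_idx_multi_idx: "axis_idx n \<in> multi_idx N"
  using N by (auto simp: axis_idx_def multi_idx_def)

lemma monom_axis: "monom N z (axis_idx n) = z 0 ^ n"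
proof -
  have "monom N z (axis_idx n) = (\<Prod>i<N. if i = 0 then z 0 ^ n else 1)"
    unfolding monom_def axis_idx_def by (rule prod.cong) auto
  then show ?thesis using N by (simp add: prod.delta)
qed

lemma monom_off_axis:
  assumes "\<alpha> \<in> multi_idx N" "\<alpha> \<notin> range axis_idx" and z: "\<And>i. i > 0 \<Longrightarrow> z i = 0"
  shows "monom N z \<alpha> = 0"
proof -
  have "\<alpha> \<noteq> axis_idx (\<alpha> 0)" using assms(2) by auto
  then obtain i where i: "\<alpha> i \<noteq> axis_idx (\<alpha> 0) i" by (auto simp: fun_eq_iff)
  then have "i > 0" "\<alpha> i > 0" by (auto simp: axis_idx_def split: if_splits)
  moreover have "i < N"
    using assms(1) \<open>\<alpha> i > 0\<close> by (metis (mono_tags, lifting) multi_idx_def mem_Collect_eq not_le less_irrefl)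
  ultimately show ?thesis
    unfolding monom_def using z[of i] by (intro prod_zero) (auto intro!: bexI[of _ i])
qed

lemma has_sum_axis:
  assumes "\<And>\<alpha>. \<alpha> \<in> multi_idx N \<Longrightarrow> \<alpha> \<notin> range axis_idx \<Longrightarrow> f \<alpha> = 0"
  shows "(f has_sum S) (multi_idx N) \<longleftrightarrow> ((\<lambda>n. f (axis_idx n)) has_sum S) UNIV"
proof -
  have "(f has_sum S) (multi_idx N) \<longleftrightarrow> (f has_sum S) (range axis_idx)"
    by (rule has_sum_cong_neutral) (use assms axis_idx_multi_idx in auto)
  also have "\<dots> \<longleftrightarrow> ((\<lambda>n. f (axis_idx n)) has_sum S) UNIV"
    using has_sum_reindex[OF inj_axis_idx, of f S] by (simp add: comp_def)
  finally show ?thesis .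
qed

text \<open>The coefficients are those of h on the axis indices and 0 elsewhere. Agreement of F with
  h is asked on the polydisk only, since functions are total and the coefficients see nothing
  outside.\<close>

lemma h2_one_variable:
  assumes h: "h holomorphic_on ball 0 1" and s: "summable (\<lambda>n. (cmod (taylor h n))\<^sup>2)"
    and F: "\<And>z. z \<in> polydisk N \<Longrightarrow> F z = h (z 0)"
  shows "F \<in> H2 N" and "(h2_norm N F)\<^sup>2 = (\<Sum>n. (cmod (taylor h n))\<^sup>2)"
proof -
  define a where "a \<alpha> = (if \<alpha> \<in> range axis_idx then taylor h (\<alpha> 0) else 0)" for \<alpha>
  have ax: "a (axis_idx n) = taylor h n" for n
    by (simp add: a_def) (simp add: axis_idx_def)
  have "((\<lambda>n. (cmod (taylor h n))\<^sup>2) has_sum (\<Sum>n. (cmod (taylor h n))\<^sup>2)) UNIV"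
    using s by (intro sums_nonneg_imp_has_sum) auto
  then have sq: "((\<lambda>\<alpha>. (cmod (a \<alpha>))\<^sup>2) has_sum (\<Sum>n. (cmod (taylor h n))\<^sup>2)) (multi_idx N)"
    by (subst has_sum_axis) (auto simp: ax, simp add: a_def)
  have c: "h2_coeffs N F a"
    unfolding h2_coeffs_def
  proof (intro conjI ballI allI impI)
    show "a \<alpha> = 0" if "\<alpha> \<notin> multi_idx N" for \<alpha>
      using that axis_idx_multi_idx by (auto simp: a_def)
    show "(\<lambda>\<alpha>. (cmod (a \<alpha>))\<^sup>2) summable_on multi_idx N"
      using sq by (rule has_sum_imp_summable)
    fix z assume z: "z \<in> polydisk N"
    then have z0: "cmod (z 0) < 1" using N by (auto simp: polydisk_def)
    have "((\<lambda>n. taylor h n * z 0 ^ n) has_sum h (z 0)) UNIV"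
      using ell2_power_series(1)[OF s z0] taylor_sums[OF h z0] by (rule norm_summable_imp_has_sum)
    then show "((\<lambda>\<alpha>. a \<alpha> * monom N z \<alpha>) has_sum F z) (multi_idx N)"
      by (subst has_sum_axis) (auto simp: ax monom_axis F[OF z], simp add: a_def)
  qed
  then show "F \<in> H2 N" by (auto simp: H2_def)
  show "(h2_norm N F)\<^sup>2 = (\<Sum>n. (cmod (taylor h n))\<^sup>2)"
    unfolding h2_norm_sq[OF c] using sq by (rule infsumI)
qed

text \<open>At (x, 0, ..., 0) only axis coefficients contribute, so evaluation costs the first power
  of 1 / (1 - |x|^2). Diagonal kernels have the N-th power in their squared norm; this mismatch
  drives the lower bounds.\<close>

lemma h2_eval_axis:
  assumes F: "F \<in> H2 N" and x: "cmod x < 1"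
  shows "(cmod (F (\<lambda>i. if i = 0 then x else 0)))\<^sup>2 \<le> (h2_norm N F)\<^sup>2 / (1 - (cmod x)\<^sup>2)"
proof -
  obtain a where a: "h2_coeffs N F a" using F by (auto simp: H2_def)
  let ?z = "\<lambda>i::nat. if i = 0 then x else 0"
  let ?c = "\<lambda>n. a (axis_idx n)"
  have sq: "((\<lambda>\<alpha>. (cmod (a \<alpha>))\<^sup>2) has_sum (h2_norm N F)\<^sup>2) (multi_idx N)"
    unfolding h2_norm_sq[OF a] using a by (auto simp: h2_coeffs_def)
  have sub: "(\<lambda>\<alpha>. (cmod (a \<alpha>))\<^sup>2) summable_on range axis_idx"
    by (rule summable_on_subset_banach[OF has_sum_imp_summable[OF sq]]) (use axis_idx_multi_idx in auto)
  then have hs: "((\<lambda>n. (cmod (?c n))\<^sup>2) has_sum infsum (\<lambda>\<alpha>. (cmod (a \<alpha>))\<^sup>2) (range axis_idx)) UNIV"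
    using has_sum_reindex[OF inj_axis_idx, of "\<lambda>\<alpha>. (cmod (a \<alpha>))\<^sup>2"] has_sum_infsum[OF sub]
    by (simp add: comp_def)
  have le: "infsum (\<lambda>\<alpha>. (cmod (a \<alpha>))\<^sup>2) (range axis_idx) \<le> (h2_norm N F)\<^sup>2"
    by (rule has_sum_mono_neutral[OF has_sum_infsum[OF sub] sq]) (use axis_idx_multi_idx in auto)
  note sums = has_sum_imp_sums[OF hs]
  have "?z \<in> polydisk N" using x by (auto simp: polydisk_def)
  then have "((\<lambda>\<alpha>. a \<alpha> * monom N ?z \<alpha>) has_sum F ?z) (multi_idx N)"
    using a by (auto simp: h2_coeffs_def)
  then have "((\<lambda>n. ?c n * x ^ n) has_sum F ?z) UNIV"
    by (subst (asm) has_sum_axis) (auto simp: monom_axis monom_off_axis)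
  then have "F ?z = ev ?c x"
    using has_sum_imp_sums sums_unique unfolding ev_def by blast
  then have "(cmod (F ?z))\<^sup>2 \<le> (\<Sum>n. (cmod (?c n))\<^sup>2) / (1 - (cmod x)\<^sup>2)"
    using ell2_power_series(3)[OF sums_summable[OF sums] x] by simp
  also have "\<dots> \<le> (h2_norm N F)\<^sup>2 / (1 - (cmod x)\<^sup>2)"
    using le sums x by (intro divide_right_mono) (auto simp: sums_iff abs_square_le_1)
  finally show ?thesis .
qed

end

subsection \<open>Restriction to the diagonal\<close>

definition level :: "nat \<Rightarrow> nat \<Rightarrow> (nat \<Rightarrow> nat) set" where
  "level N d = {\<alpha> \<in> multi_idx N. (\<Sum>i<N. \<alpha> i) = d}"

text \<open>The last entry of a multi-index is determined by its degree and the other entries, each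
  of which is at most d.\<close>

lemma level_bound:
  assumes N: "N \<ge> 1"
  shows "finite (level N d)" and "card (level N d) \<le> (d + 1) ^ (N - 1)"
proof -
  obtain M where M: "N = Suc M" using N by (cases N) auto
  let ?P = "PiE {..<M} (\<lambda>_. {..d})" and ?r = "\<lambda>\<alpha>. restrict \<alpha> {..<M}"
  have inj: "inj_on ?r (level N d)"
  proof (rule inj_onI)
    fix \<alpha> \<beta> assume \<alpha>: "\<alpha> \<in> level N d" and \<beta>: "\<beta> \<in> level N d" and eq: "?r \<alpha> = ?r \<beta>"
    have lt: "\<alpha> i = \<beta> i" if "i < M" for i
      using fun_cong[OF eq, of i] that by simp
    then have "(\<Sum>i<M. \<alpha> i) = (\<Sum>i<M. \<beta> i)" by (intro sum.cong) auto
    then have "\<alpha> M = \<beta> M" using \<alpha> \<beta> by (auto simp: level_def M)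
    moreover have "\<alpha> i = \<beta> i" if "i > M" for i
      using that \<alpha> \<beta> by (auto simp: level_def multi_idx_def M)
    ultimately show "\<alpha> = \<beta>" using lt by (metis ext linorder_neqE_nat)
  qed
  have sub: "?r ` level N d \<subseteq> ?P"
  proof (intro image_subsetI restrict_PiE_iff[THEN iffD2] ballI)
    fix \<alpha> i assume "\<alpha> \<in> level N d" "i \<in> {..<M}"
    then show "\<alpha> i \<in> {..d}"
      using member_le_sum[of i "{..<N}" \<alpha>] by (auto simp: level_def M)
  qed
  have fin: "finite ?P" by (intro finite_PiE) auto
  show "finite (level N d)"
    by (rule inj_on_finite[OF inj sub fin])
  have "card (level N d) \<le> card ?P"
    by (rule card_inj_on_le[OF inj sub fin])
  then show "card (level N d) \<le> (d + 1) ^ (N - 1)"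
    by (simp add: card_PiE M)
qed

lemma has_sum_levels:
  fixes f :: "(nat \<Rightarrow> nat) \<Rightarrow> 'a :: banach"
  assumes N: "N \<ge> 1" and f: "(f has_sum S) (multi_idx N)"
  shows "(\<lambda>d. \<Sum>\<alpha>\<in>level N d. f \<alpha>) sums S"
proof (rule has_sum_imp_sums, rule has_sum_SigmaD)
  have "bij_betw snd (Sigma UNIV (level N)) (multi_idx N)"
    by (rule bij_betw_byWitness[where f' = "\<lambda>\<alpha>. (\<Sum>i<N. \<alpha> i, \<alpha>)"]) (auto simp: level_def)
  from has_sum_reindex_bij_betw[OF this, of f S] f
  show "((\<lambda>x. f (snd x)) has_sum S) (Sigma UNIV (level N))" by simp
  show "((\<lambda>y. f (snd (d, y))) has_sum (\<Sum>\<alpha>\<in>level N d. f \<alpha>)) (level N d)" for d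
    using level_bound(1)[OF N] by (simp add: has_sum_finite)
qed

lemma monom_diag: "\<alpha> \<in> level N d \<Longrightarrow> monom N (\<lambda>_. w) \<alpha> = w ^ d"
  by (auto simp: monom_def level_def power_sum)

text \<open>\<open>b d\<close> collects all coefficients of degree d, \<open>A d\<close> is their
  square mass. Cauchy-Schwarz over the level costs its cardinality, which is where the weight comes
  from.\<close>

lemma diagonal_coefficients:
  assumes N: "N \<ge> 1" and f: "f \<in> H2 N"
  obtains b :: "nat \<Rightarrow> complex" and A :: "nat \<Rightarrow> real" where
    "\<And>w. cmod w < 1 \<Longrightarrow> (\<lambda>d. b d * w ^ d) sums f (\<lambda>_. w)"
    "\<And>d. (cmod (b d))\<^sup>2 \<le> real (d + 1) ^ (N - 1) * A d"
    "A sums (h2_norm N f)\<^sup>2" "\<And>d. A d \<ge> 0"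
proof -
  obtain a where a: "h2_coeffs N f a" using f by (auto simp: H2_def)
  define b where "b d = (\<Sum>\<alpha>\<in>level N d. a \<alpha>)" for d
  define A where "A d = (\<Sum>\<alpha>\<in>level N d. (cmod (a \<alpha>))\<^sup>2)" for d
  have "(\<lambda>d. b d * w ^ d) sums f (\<lambda>_. w)" if w: "cmod w < 1" for w
  proof -
    have "(\<lambda>_. w) \<in> polydisk N" using w by (auto simp: polydisk_def)
    then have "((\<lambda>\<alpha>. a \<alpha> * monom N (\<lambda>_. w) \<alpha>) has_sum f (\<lambda>_. w)) (multi_idx N)"
      using a by (auto simp: h2_coeffs_def)
    from has_sum_levels[OF N this] show ?thesis
      by (simp add: b_def sum_distrib_right monom_diag)
  qed
  moreover have "(cmod (b d))\<^sup>2 \<le> real (d + 1) ^ (N - 1) * A d" for d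
  proof -
    have "cmod (b d) \<le> (\<Sum>\<alpha>\<in>level N d. 1 * cmod (a \<alpha>))"
      unfolding b_def using norm_sum by simp
    then have "(cmod (b d))\<^sup>2 \<le> (\<Sum>\<alpha>\<in>level N d. 1 * cmod (a \<alpha>))\<^sup>2"
      by (rule power_mono) simp
    also have "\<dots> \<le> (\<Sum>\<alpha>\<in>level N d. 1\<^sup>2) * (\<Sum>\<alpha>\<in>level N d. (cmod (a \<alpha>))\<^sup>2)"
      by (rule Cauchy_Schwarz_ineq_sum)
    also have "\<dots> \<le> real ((d + 1) ^ (N - 1)) * A d"
      unfolding A_def using of_nat_mono[OF level_bound(2)[OF N, of d], where 'a = real]
      by (intro mult_right_mono sum_nonneg) auto
    finally show ?thesis by simp
  qed
  moreover have "A sums (h2_norm N f)\<^sup>2"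
    unfolding h2_norm_sq[OF a] A_def using a by (intro has_sum_levels[OF N]) (auto simp: h2_coeffs_def)
  moreover have "A d \<ge> 0" for d by (auto simp: A_def intro: sum_nonneg)
  ultimately show ?thesis using that by blast
qed

subsection \<open>Reproducing kernels at real diagonal points\<close>

text \<open>Absolute summability is carried through the induction because summing over a product of
  index sets needs it.\<close>

lemma has_sum_prod_multi_idx:
  fixes g :: "nat \<Rightarrow> nat \<Rightarrow> 'a :: {real_normed_field, banach}"
  assumes g: "\<And>i. i < N \<Longrightarrow> (g i has_sum S i) UNIV" "\<And>i. i < N \<Longrightarrow> g i abs_summable_on UNIV"
  shows "((\<lambda>\<alpha>. \<Prod>i<N. g i (\<alpha> i)) has_sum (\<Prod>i<N. S i)) (multi_idx N) \<and>
    (\<lambda>\<alpha>. \<Prod>i<N. g i (\<alpha> i)) abs_summable_on multi_idx N"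
  using assms
proof (induction N)
  case 0
  then show ?case by (simp add: multi_idx_0 has_sum_finite_iff)
next
  case (Suc N)
  let ?G = "\<lambda>\<alpha>. \<Prod>i<N. g i (\<alpha> i)"
  have IH: "(?G has_sum (\<Prod>i<N. S i)) (multi_idx N)" "?G abs_summable_on multi_idx N"
    using Suc by auto
  have eq: "(\<lambda>x. \<Prod>i<Suc N. g i ((case x of (n, \<alpha>) \<Rightarrow> \<alpha>(N := n)) i)) = (\<lambda>(n, \<alpha>). g N n * ?G \<alpha>)"
    by (auto simp: fun_eq_iff)
  have abs: "(\<lambda>(n, \<alpha>). g N n * ?G \<alpha>) abs_summable_on (UNIV \<times> multi_idx N)"
  proof (rule summable_on_SigmaI)
    show "((\<lambda>\<alpha>. norm (case (n, \<alpha>) of (n, \<alpha>) \<Rightarrow> g N n * ?G \<alpha>)) has_sum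
        norm (g N n) * infsum (\<lambda>\<alpha>. norm (?G \<alpha>)) (multi_idx N)) (multi_idx N)" for n
      using has_sum_cmult_right[OF has_sum_infsum[OF IH(2)], of "norm (g N n)"] by (simp add: norm_mult)
    show "(\<lambda>n. norm (g N n) * infsum (\<lambda>\<alpha>. norm (?G \<alpha>)) (multi_idx N)) summable_on UNIV"
      by (intro summable_on_cmult_left Suc.prems) auto
  qed auto
  have "((\<lambda>(n, \<alpha>). g N n * ?G \<alpha>) has_sum (S N * (\<Prod>i<N. S i))) (UNIV \<times> multi_idx N)"
  proof (rule has_sum_SigmaI)
    show "((\<lambda>y. case (n, y) of (n, \<alpha>) \<Rightarrow> g N n * ?G \<alpha>) has_sum g N n * (\<Prod>i<N. S i)) (multi_idx N)" for n
      using has_sum_cmult_right[OF IH(1)] by simp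
    show "((\<lambda>n. g N n * (\<Prod>i<N. S i)) has_sum (S N * (\<Prod>i<N. S i))) UNIV"
      by (intro has_sum_cmult_left Suc.prems) auto
  qed (rule abs_summable_summable[OF abs])
  moreover have "(\<lambda>\<alpha>. \<Prod>i<Suc N. g i (\<alpha> i)) abs_summable_on multi_idx (Suc N)"
    using summable_on_reindex_bij_betw[OF multi_idx_Suc_bij[of N], of "\<lambda>\<alpha>. norm (\<Prod>i<Suc N. g i (\<alpha> i))"] abs
    by (simp add: case_prod_beta' mult.commute)
  ultimately show ?case
    using has_sum_reindex_bij_betw[OF multi_idx_Suc_bij[of N], of "\<lambda>\<alpha>. \<Prod>i<Suc N. g i (\<alpha> i)"]
    unfolding eq by (simp add: mult.commute)
qed

text \<open>The Szego kernel of the polydisk at (r, ..., r); r is real, so no conjugate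
  appears.\<close>

definition diag_kernel :: "nat \<Rightarrow> real \<Rightarrow> (nat \<Rightarrow> complex) \<Rightarrow> complex" where
  "diag_kernel N r z = (\<Prod>i<N. 1 / (1 - of_real r * z i))"

lemma diag_kernel_h2:
  assumes r: "0 \<le> r" "r < 1"
  shows "diag_kernel N r \<in> H2 N" and "(h2_norm N (diag_kernel N r))\<^sup>2 = (1 / (1 - r\<^sup>2)) ^ N"
proof -
  define a where "a \<alpha> = (if \<alpha> \<in> multi_idx N then \<Prod>i<N. of_real r ^ \<alpha> i else (0::complex))" for \<alpha>
  have geo: "((\<lambda>n. x ^ n) has_sum 1 / (1 - x)) UNIV" "(\<lambda>n. x ^ n) abs_summable_on UNIV"
    if "norm x < 1" for x :: "'a :: {real_normed_field, banach}"
  proof -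
    have "summable (\<lambda>n. norm (x ^ n))" using that by (simp add: norm_power)
    then show "((\<lambda>n. x ^ n) has_sum 1 / (1 - x)) UNIV" "(\<lambda>n. x ^ n) abs_summable_on UNIV"
      using geometric_sums[OF that] by (auto intro: norm_summable_imp_has_sum norm_summable_imp_summable_on)
  qed
  have sq: "((\<lambda>\<alpha>. (cmod (a \<alpha>))\<^sup>2) has_sum (1 / (1 - r\<^sup>2)) ^ N) (multi_idx N)"
  proof -
    have "norm (r\<^sup>2) < 1" using r by (simp add: power_less_one_iff)
    then have "((\<lambda>\<alpha>. \<Prod>i<N. (r\<^sup>2) ^ \<alpha> i) has_sum (\<Prod>i<N. 1 / (1 - r\<^sup>2))) (multi_idx N)"
      using has_sum_prod_multi_idx[of N "\<lambda>_ n. (r\<^sup>2) ^ n" "\<lambda>_. 1 / (1 - r\<^sup>2)"] geo[of "r\<^sup>2"] by blast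
    then have "((\<lambda>\<alpha>. \<Prod>i<N. (r\<^sup>2) ^ \<alpha> i) has_sum (1 / (1 - r\<^sup>2)) ^ N) (multi_idx N)"
      by simp
    moreover have "(cmod (a \<alpha>))\<^sup>2 = (\<Prod>i<N. (r\<^sup>2) ^ \<alpha> i)" if "\<alpha> \<in> multi_idx N" for \<alpha>
      using that r by (simp add: a_def norm_power prod_power_distrib power_mult[symmetric] mult.commute flip: prod_norm)
    ultimately show ?thesis by (simp cong: has_sum_cong)
  qed
  have c: "h2_coeffs N (diag_kernel N r) a"
    unfolding h2_coeffs_def
  proof (intro conjI ballI)
    show "(\<lambda>\<alpha>. (cmod (a \<alpha>))\<^sup>2) summable_on multi_idx N"
      using sq by (rule has_sum_imp_summable)
    fix z assume z: "z \<in> polydisk N"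
    have "cmod (of_real r * z i) < 1" if "i < N" for i
      using z that r mult_left_mono[of "cmod (z i)" 1 r] by (auto simp: polydisk_def norm_mult intro: order.strict_trans1)
    then have "((\<lambda>\<alpha>. \<Prod>i<N. (of_real r * z i) ^ \<alpha> i) has_sum (\<Prod>i<N. 1 / (1 - of_real r * z i))) (multi_idx N)"
      using has_sum_prod_multi_idx[of N "\<lambda>i n. (of_real r * z i) ^ n" "\<lambda>i. 1 / (1 - of_real r * z i)"] geo by blast
    then show "((\<lambda>\<alpha>. a \<alpha> * monom N z \<alpha>) has_sum diag_kernel N r z) (multi_idx N)"
      unfolding diag_kernel_def
      by (simp add: a_def monom_def power_mult_distrib prod.distrib cong: has_sum_cong)
  qed (simp add: a_def)
  then show "diag_kernel N r \<in> H2 N" by (auto simp: H2_def)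
  show "(h2_norm N (diag_kernel N r))\<^sup>2 = (1 / (1 - r\<^sup>2)) ^ N"
    unfolding h2_norm_sq[OF c] using sq by (rule infsumI)
qed

subsection \<open>Boundedness at the critical parameter\<close>

text \<open>With u = s powr (1/N) and v = u / (1 + a u), the integrand is the derivative of N / (N -
  1) v^(N - 1); moreover v <= 1/a and N / (N - 1) <= 2.\<close>

lemma integral_critical:
  fixes a :: real
  assumes N: "N \<ge> 2" and a: "a > 0"
  obtains J where "((\<lambda>s. s powr (- 1 / real N) / (1 + a * s powr (1 / real N)) ^ N) has_integral J) {0..1/2}"
    and "J \<le> 2 / a ^ (N - 1)"
proof -
  define u where "u s = s powr (1 / real N)" for s
  define v where "v s = u s / (1 + a * u s)" for s
  define P where "P s = real N / real (N - 1) * v s ^ (N - 1)" for s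
  have u0: "u s \<ge> 0" for s by (simp add: u_def)
  have pos: "0 < 1 + a * u s" for s using a u0[of s] by (smt (verit) mult_nonneg_nonneg)
  have "continuous_on {0..1/2} u"
    unfolding u_def[abs_def] using N by (intro continuous_on_powr' continuous_on_id continuous_on_const) auto
  then have cont: "continuous_on {0..1/2} P"
    unfolding P_def[abs_def] v_def
    by (intro continuous_intros) (use pos in \<open>auto simp: less_imp_neq[THEN not_sym]\<close>)
  have der: "(P has_vector_derivative (s powr (- 1 / real N) / (1 + a * s powr (1 / real N)) ^ N)) (at s)"
    if s: "s \<in> {0<..<1/2}" for s
  proof -
    have us: "u s > 0" using s by (simp add: u_def)
    have du: "(u has_real_derivative (1 / real N * s powr (1 / real N - 1))) (at s)"
      unfolding u_def[abs_def] using s by (auto intro!: derivative_eq_intros)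
    have dv: "(v has_real_derivative (1 / real N * s powr (1 / real N - 1) / (1 + a * u s)\<^sup>2)) (at s)"
      unfolding v_def[abs_def] using pos[of s]
      by (auto intro!: derivative_eq_intros du simp: power2_eq_square algebra_simps diff_divide_distrib[symmetric])
    obtain M where M: "N = Suc (Suc M)" using N by (metis Suc_le_D numeral_2_eq_2 Suc_le_D Suc_le_mono)
    have "(P has_real_derivative (real N / real (N - 1) *
        (real (N - 1) * (1 / real N * s powr (1 / real N - 1) / (1 + a * u s)\<^sup>2) * v s ^ (N - 1 - 1)))) (at s)"
      unfolding P_def[abs_def] by (auto intro!: derivative_eq_intros dv)
    also have "real N / real (N - 1) *
        (real (N - 1) * (1 / real N * s powr (1 / real N - 1) / (1 + a * u s)\<^sup>2) * v s ^ (N - 1 - 1))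
        = (s powr (1 / real N - 1) * u s ^ M) / ((1 + a * u s)\<^sup>2 * (1 + a * u s) ^ M)"
      using M by (simp add: v_def power_divide)
    also have "(1 + a * u s)\<^sup>2 * (1 + a * u s) ^ M = (1 + a * u s) ^ N"
      by (simp add: M power2_eq_square)
    also have "u s ^ M = s powr (real M * (1 / real N))"
      using us by (simp add: u_def powr_powr flip: powr_realpow)
    also have "s powr (1 / real N - 1) * s powr (real M * (1 / real N)) = s powr (- 1 / real N)"
    proof -
      have m: "real M = real N - 2" using M by simp
      have "1 / real N - 1 + real M * (1 / real N) = - 1 / real N"
        using N unfolding m by (simp add: field_simps)
      then show ?thesis by (simp only: powr_add[symmetric])
    qed
    finally show ?thesis
      by (simp add: u_def has_real_derivative_iff_has_vector_derivative)
  qed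
  have "((\<lambda>s. s powr (- 1 / real N) / (1 + a * s powr (1 / real N)) ^ N) has_integral (P (1/2) - P 0)) {0..1/2}"
    by (rule fundamental_theorem_of_calculus_interior[OF _ cont der]) auto
  moreover have "P (1/2) - P 0 \<le> 2 / a ^ (N - 1)"
  proof -
    have P0: "P 0 = 0" using N by (simp add: P_def v_def u_def)
    have v0: "0 \<le> v (1/2)" using u0[of "1/2"] pos[of "1/2"] by (simp add: v_def)
    have "v (1/2) \<le> 1 / a"
      using pos[of "1/2"] a by (simp add: v_def field_simps)
    then have "v (1/2) ^ (N - 1) \<le> (1 / a) ^ (N - 1)"
      using v0 by (rule power_mono)
    moreover have "real N / real (N - 1) \<le> 2"
      using N by (simp add: pos_divide_le_eq of_nat_diff)
    ultimately have "P (1/2) \<le> 2 * (1 / a) ^ (N - 1)"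
      unfolding P_def using v0 by (intro mult_mono) auto
    then have "P (1/2) - P 0 \<le> 2 * (1 / a) ^ (N - 1)"
      using P0 by simp
    then show ?thesis by (simp add: power_one_over)
  qed
  ultimately show ?thesis using that by blast
qed

text \<open>Trades exponential decay for the rational expression whose primitive is elementary in
  \<open>integral_critical\<close>.\<close>

lemma exp_neg_le_inverse_power:
  assumes "y \<ge> 0" "N \<ge> 1"
  shows "exp (- y) \<le> 1 / (1 + y / real N) ^ N"
proof -
  have "(1 + y / real N) ^ N \<le> exp (y / real N) ^ N"
    using assms by (intro power_mono) (auto intro: exp_ge_add_one_self)
  also have "\<dots> = exp y" using assms by (simp add: exp_of_nat_mult[symmetric])
  finally have "1 / exp y \<le> 1 / (1 + y / real N) ^ N"
    using assms by (intro divide_left_mono mult_pos_pos zero_less_power) (auto intro: add_pos_nonneg)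
  then show ?thesis by (simp add: exp_minus field_simps)
qed

context
  fixes N :: nat
  assumes N: "N \<ge> 2"
begin

lemma diag_lens_holomorphic:
  assumes f: "f \<in> H2 N" and \<theta>: "0 < \<theta>" "\<theta> < 1"
  shows "(\<lambda>w. f (\<lambda>_. lens \<theta> w)) holomorphic_on ball 0 1"
proof -
  obtain b A where b: "\<And>w. cmod w < 1 \<Longrightarrow> (\<lambda>d. b d * w ^ d) sums f (\<lambda>_. w)"
    using diagonal_coefficients[OF _ f] N by (metis one_le_numeral order_trans)
  have "(\<lambda>w. f (\<lambda>_. w)) holomorphic_on ball 0 1"
    by (rule power_series_holomorphic[of 0 1 b]) (use b in auto)
  moreover have "lens \<theta> ` ball 0 1 \<subseteq> ball 0 1"
    using lens_in_disk[OF \<theta>] by auto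
  ultimately show ?thesis
    using holomorphic_on_compose_gen[OF lens_holomorphic[OF \<theta>], of "\<lambda>w. f (\<lambda>_. w)" "ball 0 1"]
    by (simp add: comp_def)
qed

text \<open>Cauchy-Schwarz with |w|^d split as y^d y^d, where y is the square root of |w|. The
  coefficients of a diagonal restriction need not be square-summable, so a decaying factor has to
  stay with them.\<close>

lemma power_series_sq_bound:
  fixes b :: "nat \<Rightarrow> complex"
  assumes b: "\<And>w. cmod w < 1 \<Longrightarrow> (\<lambda>d. b d * w ^ d) sums g w" and w: "cmod w < 1"
  shows "summable (\<lambda>d. (cmod (b d))\<^sup>2 * cmod w ^ d)"
    and "(cmod (g w))\<^sup>2 \<le> (\<Sum>d. (cmod (b d))\<^sup>2 * cmod w ^ d) / (1 - cmod w)"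
proof -
  define y where "y = sqrt (cmod w)"
  have y: "0 \<le> y" "y < 1" and yy: "(y ^ d)\<^sup>2 = cmod w ^ d" for d
    using w by (auto simp: y_def power_mult[symmetric] mult.commute[of d 2])
       (simp add: power_mult)
  define t where "t = (1 + y) / 2"
  have t: "y < t" "t < 1" using y by (auto simp: t_def)
  have "summable (\<lambda>d. b d * of_real t ^ d)"
    using b[of "of_real t"] t y by (auto simp: sums_iff)
  from powser_insidea[OF this, of "of_real y"] t y
  have sm: "summable (\<lambda>d. cmod (b d) * y ^ d)"
    by (simp add: norm_mult norm_power)
  \<comment> \<open>The terms are eventually below 1, so their squares are dominated by the terms
    themselves.\<close>
  have "summable (\<lambda>d. (cmod (b d) * y ^ d)\<^sup>2)"
  proof (rule summable_comparison_test_ev[OF _ sm])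
    have "\<forall>\<^sub>F d in sequentially. cmod (b d) * y ^ d < 1"
      using summable_LIMSEQ_zero[OF sm] by (rule order_tendstoD) simp
    then show "\<forall>\<^sub>F d in sequentially. norm ((cmod (b d) * y ^ d)\<^sup>2) \<le> cmod (b d) * y ^ d"
    proof (rule eventually_mono)
      fix d assume "cmod (b d) * y ^ d < 1"
      then show "norm ((cmod (b d) * y ^ d)\<^sup>2) \<le> cmod (b d) * y ^ d"
        using y mult_left_mono[of "cmod (b d) * y ^ d" 1 "cmod (b d) * y ^ d"] by (simp add: power2_eq_square)
    qed
  qed
  then have s1: "summable (\<lambda>d. (cmod (b d) * y ^ d)\<^sup>2)" .
  then show "summable (\<lambda>d. (cmod (b d))\<^sup>2 * cmod w ^ d)"
    by (simp add: power_mult_distrib yy)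
  have g2: "(\<lambda>d. (y ^ d)\<^sup>2) sums (1 / (1 - cmod w))"
    unfolding yy by (rule geometric_sums) (use w in simp)
  note cs = suminf_Cauchy_Schwarz[OF s1 sums_summable[OF g2]]
  have eq: "cmod (b d) * y ^ d * y ^ d = cmod (b d * w ^ d)" for d
    using yy[of d] by (simp add: norm_mult norm_power power2_eq_square mult.assoc)
  have s: "summable (\<lambda>d. cmod (b d * w ^ d))"
    using cs(1) y by (simp add: eq)
  have "g w = (\<Sum>d. b d * w ^ d)" using b[OF w] by (simp add: sums_iff)
  then have "(cmod (g w))\<^sup>2 \<le> (\<Sum>d. cmod (b d * w ^ d))\<^sup>2"
    using summable_norm[OF s] by (intro power_mono) auto
  also have "\<dots> \<le> (\<Sum>d. (cmod (b d) * y ^ d)\<^sup>2) * (1 / (1 - cmod w))"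
    using cs(2) y by (simp add: eq sums_unique[OF g2, symmetric])
  finally show "(cmod (g w))\<^sup>2 \<le> (\<Sum>d. (cmod (b d))\<^sup>2 * cmod w ^ d) / (1 - cmod w)"
    by (simp add: power_mult_distrib yy)
qed

lemma critical_pointwise:
  fixes z :: complex
  defines "k \<equiv> cos (pi * (1 / real N) / 2)" and "x \<equiv> cmod (lens (1 / real N) z)"
  assumes z: "cmod z < 1" and s: "0 < s" "s \<le> 1/2" "2 * s \<le> cmod (1 - z)" "2 * s \<le> cmod (1 + z)"
  shows "x ^ d / (1 - x) \<le> 6 / k * (s powr (- 1 / real N) / (1 + (k * real (d + 1) / (2 * real N)) * s powr (1 / real N)) ^ N)"
proof -
  have \<theta>: "0 < 1 / real N" "1 / real N < 1" using N by auto
  define u where "u = s powr (1 / real N)"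
  have k: "0 < k" "k \<le> 1"
    unfolding k_def using cos_half_pos[OF cayley_Re_pos[OF z] \<theta>] by auto
  have u: "0 < u" "u \<le> 1"
    using s \<theta> by (auto simp: u_def powr_le1)
  have x: "0 \<le> x" "x < 1" unfolding x_def using lens_in_disk[OF \<theta> z] by auto
  have low: "k * u \<le> 1 - x\<^sup>2"
    unfolding k_def u_def x_def by (rule lens_defect_lower[OF \<theta> z s(1,3,4)])
  have "1 - x\<^sup>2 \<le> 2 * (1 - x)"
    using x mult_right_mono[of "1 + x" 2 "1 - x"] by (simp add: power2_eq_square algebra_simps)
  then have "k * u \<le> 2 * (1 - x)" using low by linarith
  then have ku: "k * u / 2 \<le> 1 - x" by simp
  then have "x \<le> exp (- (k * u / 2))"
    using exp_ge_add_one_self[of "- (k * u / 2)"] by linarith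
  then have "x ^ d \<le> exp (- (k * u / 2)) ^ d"
    using x by (intro power_mono) auto
  \<comment> \<open>Passing from d to d + 1 keeps the rate positive at d = 0. The price exp(k u / 2)
    is at most 3, and division by k u / 2 <= 1 - x makes the constant 6 / k.\<close>
  also have "\<dots> = exp (k * u / 2) * exp (- (k * real (d + 1) * u / 2))"
    by (simp add: exp_of_nat_mult[symmetric] exp_add[symmetric]) (simp add: field_simps)
  also have "\<dots> \<le> 3 * (1 / (1 + (k * real (d + 1) * u / 2) / real N) ^ N)"
  proof (intro mult_mono exp_neg_le_inverse_power)
    have "k * u \<le> 1" using k u mult_le_one by (meson less_imp_le)
    then have "exp (k * u / 2) \<le> exp 1" by simp
    then show "exp (k * u / 2) \<le> 3" using exp_le by linarith
  qed (use k u N in auto)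
  finally have xd: "x ^ d \<le> 3 / (1 + (k * real (d + 1) / (2 * real N)) * u) ^ N"
    by (simp add: mult_ac)
  have "x ^ d / (1 - x) \<le> (3 / (1 + (k * real (d + 1) / (2 * real N)) * u) ^ N) / (k * u / 2)"
    using xd ku k u x by (intro frac_le) auto
  also have "\<dots> = 6 / k * (1 / u / (1 + (k * real (d + 1) / (2 * real N)) * u) ^ N)"
    by (simp add: field_simps)
  also have "1 / u = s powr (- 1 / real N)"
    by (simp add: u_def powr_minus_divide)
  finally show ?thesis by (simp add: u_def)
qed

text \<open>On one circle |lens| <= \<rho> < 1, so the series can be cut at D with uniform error
  \<open>\<epsilon> D\<close>. The finite part is integrated term by term, and D tends to infinity
  before r tends to 1; \<rho> and \<epsilon> depend on r, the resulting bound does not.\<close>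

lemma critical_bounded:
  obtains C where "C > 0"
    and "\<And>f. f \<in> H2 N \<Longrightarrow> summable (\<lambda>n. (cmod (taylor (\<lambda>w. f (\<lambda>_. lens (1 / real N) w)) n))\<^sup>2)"
    and "\<And>f. f \<in> H2 N \<Longrightarrow> (\<Sum>n. (cmod (taylor (\<lambda>w. f (\<lambda>_. lens (1 / real N) w)) n))\<^sup>2) \<le> C * (h2_norm N f)\<^sup>2"
proof -
  define \<theta> where "\<theta> = 1 / real N"
  have \<theta>: "0 < \<theta>" "\<theta> < 1" using N by (auto simp: \<theta>_def)
  define k where "k = cos (pi * \<theta> / 2)"
  have k: "0 < k" unfolding k_def using cos_half_pos[of 1, OF _ \<theta>] by simp
  define C where "C = 6 / k * (2 * (2 * real N / k) ^ (N - 1))"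
  have C: "C > 0" using k N by (simp add: C_def)
  have main: "(\<Sum>n<K. (cmod (taylor (\<lambda>w. f (\<lambda>_. lens \<theta> w)) n))\<^sup>2 * (r ^ n)\<^sup>2) \<le> 2 * C * (h2_norm N f)\<^sup>2"
    if f: "f \<in> H2 N" and r: "0 < r" "r < 1" for f r K
  proof -
    obtain b A where b: "\<And>w. cmod w < 1 \<Longrightarrow> (\<lambda>d. b d * w ^ d) sums f (\<lambda>_. w)"
      and bA: "\<And>d. (cmod (b d))\<^sup>2 \<le> real (d + 1) ^ (N - 1) * A d"
      and A: "A sums (h2_norm N f)\<^sup>2" "\<And>d. A d \<ge> 0"
      by (rule diagonal_coefficients[OF _ f]) (use N in auto)
    \<comment> \<open>On the whole circle |1 - z| and |1 + z| are at least 1 - r, so s = (1 - r) / 2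
      is admissible in \<open>lens_defect_lower\<close>.\<close>
    define \<kappa> where "\<kappa> = k * ((1 - r) / 2) powr \<theta>"
    have \<kappa>: "\<kappa> > 0" using k r by (simp add: \<kappa>_def)
    define \<rho> where "\<rho> = sqrt (1 - \<kappa>)"
    have x\<rho>: "cmod (lens \<theta> z) \<le> \<rho>" if z: "cmod z = r" for z
    proof -
      have "1 - r \<le> cmod (1 - z)" "1 - r \<le> cmod (1 + z)"
        using norm_triangle_ineq2[of 1 z] norm_triangle_ineq2[of 1 "- z"] z by auto
      then have "\<kappa> \<le> 1 - (cmod (lens \<theta> z))\<^sup>2"
        unfolding \<kappa>_def k_def using z r by (intro lens_defect_lower[OF \<theta>]) auto
      then show ?thesis unfolding \<rho>_def by (intro real_le_rsqrt) linarith
    qed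
    have \<rho>: "0 \<le> \<rho>" "\<rho> < 1"
    proof -
      show "0 \<le> \<rho>" using x\<rho>[of "of_real r"] r norm_ge_zero[of "lens \<theta> (of_real r)"] by (simp del: norm_ge_zero)
      show "\<rho> < 1" unfolding \<rho>_def using \<kappa> by (simp add: real_sqrt_lt_1_iff)
    qed
    define B where "B d = (cmod (b d))\<^sup>2 * \<rho> ^ d" for d
    have sB: "summable B"
      using power_series_sq_bound(1)[of b _ "of_real \<rho>", OF b] \<rho> by (simp add: B_def[abs_def])
    define \<epsilon> where "\<epsilon> D = (\<Sum>d. B (d + D)) / (1 - \<rho>)" for D
    have "\<epsilon> \<longlonglongrightarrow> 0 / (1 - \<rho>)"
      unfolding \<epsilon>_def[abs_def] using \<rho> suminf_exist_split2[OF sB]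
      by (intro tendsto_divide tendsto_const) auto
    then have \<epsilon>: "\<epsilon> \<longlonglongrightarrow> 0" by simp
    define a where "a d = k * real (d + 1) / (2 * real N)" for d
    define h where "h d s = s powr (- 1 / real N) / (1 + a d * s powr (1 / real N)) ^ N" for d s
    have "\<exists>J. (h d has_integral J) {0..1/2} \<and> J \<le> 2 / a d ^ (N - 1)" for d
    proof -
      have "a d > 0" using k N by (simp add: a_def)
      from integral_critical[OF N this] show ?thesis unfolding h_def[abs_def] by metis
    qed
    then obtain J where J: "\<And>d. (h d has_integral J d) {0..1/2}" "\<And>d. J d \<le> 2 / a d ^ (N - 1)"
      by metis
    \<comment> \<open>The weight of degree d cancels against the decay of \<open>J d\<close>; C is
      the product that remains, independent of d.\<close>
    have CJ: "real (d + 1) ^ (N - 1) * (6 / k * J d) \<le> C" for d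
    proof -
      have "real (d + 1) ^ (N - 1) * (6 / k * J d) \<le> real (d + 1) ^ (N - 1) * (6 / k * (2 / a d ^ (N - 1)))"
        using J(2)[of d] k by (intro mult_left_mono) auto
      also have "\<dots> = C"
      proof -
        have "2 * real N / k = real (d + 1) / a d"
          using k N by (simp add: a_def)
        then show ?thesis unfolding C_def by (simp add: power_divide)
      qed
      finally show ?thesis .
    qed
    have bound: "(\<Sum>n<K. (cmod (taylor (\<lambda>w. f (\<lambda>_. lens \<theta> w)) n))\<^sup>2 * (r ^ n)\<^sup>2) \<le> 2 * C * (h2_norm N f)\<^sup>2 + \<epsilon> D" for D
    proof -
      have "(\<Sum>n<K. (cmod (taylor (\<lambda>w. f (\<lambda>_. lens \<theta> w)) n))\<^sup>2 * (r ^ n)\<^sup>2)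
        \<le> 2 * ((\<Sum>d<D. (cmod (b d))\<^sup>2 * (6 / k * J d)) + \<epsilon> D * (1/2))"
      proof (rule circle_mean_bound[OF taylor_sums[OF diag_lens_holomorphic[OF f \<theta>]] r])
        show "((\<lambda>s. (\<Sum>d<D. (cmod (b d))\<^sup>2 * (6 / k * h d s)) + \<epsilon> D) has_integral
            ((\<Sum>d<D. (cmod (b d))\<^sup>2 * (6 / k * J d)) + \<epsilon> D * (1/2))) {0..1/2}"
          using has_integral_const_real[of "\<epsilon> D" 0 "1/2"]
          by (intro has_integral_add has_integral_sum has_integral_mult_right J) (auto simp: mult.commute)
        fix z s assume z: "cmod z = r" and s: "0 < s" "s \<le> 1/2" "2 * s \<le> cmod (1 - z)" "2 * s \<le> cmod (1 + z)"
        define x where "x = cmod (lens \<theta> z)"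
        have x: "0 \<le> x" "x \<le> \<rho>" "x < 1" using x\<rho>[OF z] \<rho> by (auto simp: x_def)
        have sx: "summable (\<lambda>d. (cmod (b d))\<^sup>2 * x ^ d)"
          and le: "(cmod (f (\<lambda>_. lens \<theta> z)))\<^sup>2 \<le> (\<Sum>d. (cmod (b d))\<^sup>2 * x ^ d) / (1 - x)"
          using power_series_sq_bound[of b "\<lambda>w. f (\<lambda>_. w)" "lens \<theta> z", OF b] x by (auto simp: x_def)
        have "(\<Sum>d. (cmod (b d))\<^sup>2 * x ^ d) = (\<Sum>d<D. (cmod (b d))\<^sup>2 * x ^ d) + (\<Sum>d. (cmod (b (d + D)))\<^sup>2 * x ^ (d + D))"
          using suminf_split_initial_segment[OF sx, of D] by simp
        also have "(\<Sum>d. (cmod (b (d + D)))\<^sup>2 * x ^ (d + D)) \<le> (\<Sum>d. B (d + D))"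
          unfolding B_def using x sx sB
          by (intro suminf_le mult_left_mono power_mono) (auto simp: summable_iff_shift[of "\<lambda>d. (cmod (b d))\<^sup>2 * x ^ d"] summable_iff_shift[of "\<lambda>d. (cmod (b d))\<^sup>2 * \<rho> ^ d"] B_def[abs_def])
        finally have "(cmod (f (\<lambda>_. lens \<theta> z)))\<^sup>2 \<le> ((\<Sum>d<D. (cmod (b d))\<^sup>2 * x ^ d) + (\<Sum>d. B (d + D))) / (1 - x)"
          using x by (intro order_trans[OF le divide_right_mono]) auto
        also have "\<dots> = (\<Sum>d<D. (cmod (b d))\<^sup>2 * (x ^ d / (1 - x))) + (\<Sum>d. B (d + D)) / (1 - x)"
          by (simp add: add_divide_distrib sum_divide_distrib)
        also have "\<dots> \<le> (\<Sum>d<D. (cmod (b d))\<^sup>2 * (6 / k * h d s)) + \<epsilon> D"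
        proof (intro add_mono sum_mono mult_left_mono)
          show "x ^ d / (1 - x) \<le> 6 / k * h d s" for d
            unfolding x_def h_def a_def k_def \<theta>_def using z r s by (intro critical_pointwise) auto
          have "0 \<le> (\<Sum>d. B (d + D))"
            by (rule suminf_nonneg, simp only: summable_iff_shift sB) (use \<rho> in \<open>simp add: B_def\<close>)
          then show "(\<Sum>d. B (d + D)) / (1 - x) \<le> \<epsilon> D"
            unfolding \<epsilon>_def using x \<rho> by (intro divide_left_mono mult_pos_pos) auto
        qed auto
        finally show "(cmod (f (\<lambda>_. lens \<theta> z)))\<^sup>2 \<le> (\<Sum>d<D. (cmod (b d))\<^sup>2 * (6 / k * h d s)) + \<epsilon> D" .
      qed auto
      also have "(\<Sum>d<D. (cmod (b d))\<^sup>2 * (6 / k * J d)) \<le> (\<Sum>d<D. A d * C)"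
      proof (rule sum_mono)
        fix d
        have "J d \<ge> 0"
          using J(1)[of d] by (rule has_integral_nonneg) (use k N in \<open>auto simp: h_def a_def intro!: divide_nonneg_nonneg zero_le_power add_nonneg_nonneg\<close>)
        then have "(cmod (b d))\<^sup>2 * (6 / k * J d) \<le> (real (d + 1) ^ (N - 1) * A d) * (6 / k * J d)"
          using bA[of d] k by (intro mult_right_mono) auto
        also have "\<dots> = A d * (real (d + 1) ^ (N - 1) * (6 / k * J d))" by simp
        also have "\<dots> \<le> A d * C" using CJ[of d] A(2)[of d] by (intro mult_left_mono) auto
        finally show "(cmod (b d))\<^sup>2 * (6 / k * J d) \<le> A d * C" .
      qed
      also have "(\<Sum>d<D. A d * C) \<le> (h2_norm N f)\<^sup>2 * C"
        using A C sum_le_suminf[of A "{..<D}"] by (auto simp: sum_distrib_right[symmetric] sums_iff)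
      finally show ?thesis by (simp add: algebra_simps)
    qed
    have "(\<lambda>D. 2 * C * (h2_norm N f)\<^sup>2 + \<epsilon> D) \<longlonglongrightarrow> 2 * C * (h2_norm N f)\<^sup>2 + 0"
      by (intro tendsto_intros \<epsilon>)
    from LIMSEQ_le_const[OF this] bound show ?thesis by auto
  qed
  show ?thesis
  proof
    show "2 * C > 0" using C by simp
    fix f assume f: "f \<in> H2 N"
    show "summable (\<lambda>n. (cmod (taylor (\<lambda>w. f (\<lambda>_. lens (1 / real N) w)) n))\<^sup>2)"
      "(\<Sum>n. (cmod (taylor (\<lambda>w. f (\<lambda>_. lens (1 / real N) w)) n))\<^sup>2) \<le> 2 * C * (h2_norm N f)\<^sup>2"
      using ell2_bound_from_circles[OF main[OF f]] by (auto simp: \<theta>_def)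
  qed
qed

end

subsection \<open>Lower bounds from kernel functions\<close>

lemma comp_lens_diag: "comp_op (lens_diag \<theta>) f z = f (\<lambda>_. lens \<theta> (z 0))"
  by (simp add: comp_op_def lens_diag_def)

lemma diag_kernel_diag: "diag_kernel N r (\<lambda>_. of_real x) = of_real ((1 / (1 - r * x)) ^ N)"
  by (simp add: diag_kernel_def)

lemma unbounded_supercritical:
  assumes N: "N \<ge> 2" and \<theta>: "0 < \<theta>" "\<theta> < 1" and sup: "\<theta> > 1 / real N"
  shows "\<not> bounded_on_H2 N (comp_op (lens_diag \<theta>))"
proof
  let ?T = "comp_op (lens_diag \<theta>)"
  assume "bounded_on_H2 N ?T"
  then obtain C where TH: "\<And>f. f \<in> H2 N \<Longrightarrow> ?T f \<in> H2 N"
    and TC: "\<And>f. f \<in> H2 N \<Longrightarrow> h2_norm N (?T f) \<le> C * h2_norm N f"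
    unfolding bounded_on_H2_def by blast
  define p where "p = \<theta> * real N - 1"
  have p: "p > 0" using sup N by (simp add: p_def field_simps)
  \<comment> \<open>M exceeds the constant in the inequality v <= C^2 4^N v powr (1 + p) to be
    derived, and v is the solution of v powr p = 1/M; the inequality then says M <= C^2 4^N.\<close>
  define M where "M = C\<^sup>2 * 4 ^ N + 1"
  have M: "M \<ge> 1" by (simp add: M_def)
  define v where "v = M powr (- 1 / p)"
  have v: "0 < v" "v \<le> 1" using M p powr_mono[of "- 1 / p" 0 M] by (auto simp: v_def)
  define s where "s = sqrt (1 - v)"
  have s: "0 \<le> s" "s < 1" and s2: "1 - s\<^sup>2 = v" using v by (auto simp: s_def)
  obtain r where r: "lens \<theta> (of_real s) = of_real r" "0 \<le> r" "r < 1" "1 - r\<^sup>2 \<le> 4 * v powr \<theta>"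
    using lens_of_real[OF \<theta> s] unfolding s2 by blast
  define t where "t = 1 - r\<^sup>2"
  have t: "t > 0" using r by (simp add: t_def abs_square_less_1)
  let ?K = "diag_kernel N r"
  note K = diag_kernel_h2[OF r(2,3), of N]
  have "(cmod (?T ?K (\<lambda>i. if i = 0 then of_real s else 0)))\<^sup>2 \<le> (h2_norm N (?T ?K))\<^sup>2 / (1 - (cmod (of_real s))\<^sup>2)"
    by (rule h2_eval_axis) (use N s TH K in auto)
  also have "?T ?K (\<lambda>i. if i = 0 then of_real s else 0) = of_real ((1 / t) ^ N)"
    by (simp add: comp_lens_diag r diag_kernel_diag t_def power2_eq_square del: of_real_power)
  finally have "((1 / t) ^ N)\<^sup>2 \<le> (h2_norm N (?T ?K))\<^sup>2 / v"
    using t by (simp only: norm_of_real power2_abs s2)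
  also have "\<dots> \<le> (C * h2_norm N ?K)\<^sup>2 / v"
    using TC[OF K(1)] v by (intro divide_right_mono power_mono h2_norm_nonneg) auto
  also have "\<dots> = C\<^sup>2 * (1 / t) ^ N / v"
    by (simp add: power_mult_distrib K(2) t_def)
  finally have "(1 / t) ^ N * (1 / t) ^ N \<le> (C\<^sup>2 / v) * (1 / t) ^ N"
    by (simp add: power2_eq_square)
  then have "(1 / t) ^ N \<le> C\<^sup>2 / v"
    using t by (subst (asm) mult_le_cancel_right_pos) auto
  then have "v \<le> C\<^sup>2 * t ^ N"
    using t v by (simp add: power_divide divide_simps mult.commute)
  also have "\<dots> \<le> C\<^sup>2 * (4 * v powr \<theta>) ^ N"
    using r(4) t by (intro mult_left_mono power_mono) (auto simp: t_def)
  also have "\<dots> = C\<^sup>2 * 4 ^ N * v powr (1 + p)"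
    using v N by (simp add: power_mult_distrib powr_powr p_def flip: powr_realpow)
  also have "\<dots> = C\<^sup>2 * 4 ^ N * (v * v powr p)"
    using v by (simp add: powr_add)
  also have "v powr p = 1 / M"
  proof -
    have "v powr p = M powr (- 1)"
      unfolding v_def powr_powr using p by simp
    then show ?thesis using M by (simp add: powr_minus_divide)
  qed
  finally have "M \<le> C\<^sup>2 * 4 ^ N"
    using v M by (simp add: field_simps)
  then show False by (simp add: M_def)
qed

text \<open>The scaled kernels tend to 0 at each fixed point of the diagonal, while the image of the
  m-th one stays large at the point s m. Letting n grow in a Cauchy estimate at that point leaves
  the image of \<open>u m\<close> alone against e.\<close>

lemma noncompact_critical:
  assumes N: "N \<ge> 2" and \<theta>: "\<theta> = 1 / real N"
  shows "\<not> compact_on_H2 N (comp_op (lens_diag \<theta>))"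
proof
  let ?T = "comp_op (lens_diag \<theta>)"
  assume comp: "compact_on_H2 N ?T"
  then have TH: "\<And>f. f \<in> H2 N \<Longrightarrow> ?T f \<in> H2 N"
    unfolding compact_on_H2_def by blast
  have \<theta>1: "0 < \<theta>" "\<theta> < 1" using N by (auto simp: \<theta>)
  define v where "v n = 1 / (real n + 1)" for n
  have v: "0 < v n" "v n \<le> 1" for n by (auto simp: v_def)
  define s where "s n = sqrt (1 - v n)" for n
  have s: "0 \<le> s n" "s n < 1" and s2: "1 - (s n)\<^sup>2 = v n" for n
    using v[of n] by (auto simp: s_def)
  have "\<exists>r. lens \<theta> (of_real (s n)) = of_real r \<and> 0 \<le> r \<and> r < 1 \<and> 1 - r\<^sup>2 \<le> 4 * v n powr \<theta>" for n
    using lens_of_real[OF \<theta>1 s] unfolding s2 by metis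
  then obtain r where r: "\<And>n. lens \<theta> (of_real (s n)) = of_real (r n)" "\<And>n. 0 \<le> r n" "\<And>n. r n < 1"
    "\<And>n. 1 - (r n)\<^sup>2 \<le> 4 * v n powr \<theta>" by metis
  define t where "t n = 1 - (r n)\<^sup>2" for n
  have t: "t n > 0" for n using r(2,3)[of n] by (simp add: t_def abs_square_less_1)
  \<comment> \<open>Half of the normalising factor: it absorbs the factor 2 in
    \<open>h2_linear_combination\<close>.\<close>
  define c where "c n = sqrt (t n ^ N) / 2" for n
  have c0: "c n > 0" for n using t[of n] by (simp add: c_def)
  have c2: "(c n)\<^sup>2 = t n ^ N / 4" for n using t[of n] by (simp add: c_def power_divide less_imp_le)
  have tv: "t n ^ N \<le> 4 ^ N * v n" for n
  proof -
    have "t n ^ N \<le> (4 * v n powr \<theta>) ^ N"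
      using r(4)[of n] t[of n] by (intro power_mono) (auto simp: t_def)
    also have "\<dots> = 4 ^ N * v n"
      using v[of n] N by (simp add: power_mult_distrib \<theta> powr_powr flip: powr_realpow)
    finally show ?thesis .
  qed
  have "(\<lambda>n. (c n)\<^sup>2) \<longlonglongrightarrow> 0"
  proof (rule tendsto_sandwich[OF _ _ tendsto_const])
    show "(\<lambda>n. 4 ^ N / 4 * (1 / (real n + 1))) \<longlonglongrightarrow> 0"
      by (rule tendsto_mult_right_zero) (use LIMSEQ_inverse_real_of_nat in \<open>simp add: inverse_eq_divide add.commute\<close>)
    show "\<forall>\<^sub>F n in sequentially. (c n)\<^sup>2 \<le> 4 ^ N / 4 * (1 / (real n + 1))"
    proof (intro always_eventually allI)
      show "(c n)\<^sup>2 \<le> 4 ^ N / 4 * (1 / (real n + 1))" for n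
        using tv[of n] unfolding c2 v_def by (simp add: field_simps)
    qed
  qed auto
  then have c_lim: "c \<longlonglongrightarrow> 0"
    by (simp add: tendsto_norm_zero_iff)
  define u where "u n z = of_real (c n) * diag_kernel N (r n) z" for n z
  note K = diag_kernel_h2[OF r(2,3), of N]
  have u: "u n \<in> H2 N \<and> h2_norm N (u n) \<le> 1" for n
  proof
    show "u n \<in> H2 N"
      using h2_linear_combination(1)[OF K(1) K(1), of "of_real (c n)" n 0 n] by (simp add: u_def[abs_def])
    have "(h2_norm N (u n))\<^sup>2 \<le> 2 * (c n)\<^sup>2 * (1 / t n) ^ N"
      using h2_linear_combination(2)[OF K(1) K(1), of "of_real (c n)" n 0 n] K(2)[of n] by (simp add: u_def[abs_def] t_def)
    also have "\<dots> \<le> 1\<^sup>2" using t[of n] by (simp add: c2 power_divide)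
    finally show "h2_norm N (u n) \<le> 1" by (rule power2_le_imp_le) simp
  qed
  \<comment> \<open>e^2 is half of 1 / (4 * 4^N), the lower bound forced by the value of the image
    of \<open>u m\<close> at s m.\<close>
  define e where "e = sqrt (1 / (8 * 4 ^ N))"
  have e: "e > 0" "e\<^sup>2 = 1 / (8 * 4 ^ N)" by (auto simp: e_def)
  obtain \<rho> :: "nat \<Rightarrow> nat" and M where \<rho>: "strict_mono \<rho>"
    and M: "\<And>m n. m \<ge> M \<Longrightarrow> n \<ge> M \<Longrightarrow> h2_norm N (\<lambda>z. ?T (u (\<rho> m)) z - ?T (u (\<rho> n)) z) < e"
    using comp u e(1) unfolding compact_on_H2_def by meson
  define m where "m = \<rho> M"
  let ?x = "\<lambda>i::nat. if i = 0 then complex_of_real (s m) else 0"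
  have val: "?T (u n) ?x = of_real (c n * (1 / (1 - r n * r m)) ^ N)" for n
    by (simp add: comp_lens_diag u_def r diag_kernel_diag del: of_real_power)
  have "(cmod (?T (u m) ?x - ?T (u (\<rho> n)) ?x))\<^sup>2 \<le> e\<^sup>2 / v m" if n: "n \<ge> M" for n
  proof -
    have "(cmod (?T (u m) ?x - ?T (u (\<rho> n)) ?x))\<^sup>2
        \<le> (h2_norm N (\<lambda>z. ?T (u m) z - ?T (u (\<rho> n)) z))\<^sup>2 / (1 - (cmod (of_real (s m)))\<^sup>2)"
      by (rule h2_eval_axis[of N "\<lambda>z. ?T (u m) z - ?T (u (\<rho> n)) z"])
         (use N s u TH in \<open>auto intro: h2_diff\<close>)
    also have "\<dots> \<le> e\<^sup>2 / v m"
      using M[of M n] n v[of m] s2[of m] by (auto intro!: divide_right_mono power_mono h2_norm_nonneg simp: m_def less_imp_le)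
    finally show ?thesis .
  qed
  moreover have "(\<lambda>n. (cmod (?T (u m) ?x - ?T (u (\<rho> n)) ?x))\<^sup>2) \<longlonglongrightarrow> (cmod (?T (u m) ?x - 0))\<^sup>2"
  proof (intro tendsto_intros)
    have "?T (u (\<rho> n)) ?x = of_real (c (\<rho> n) * (1 / (1 - r (\<rho> n) * r m)) ^ N)" for n by (rule val)
    moreover have "(\<lambda>n. c (\<rho> n) * (1 / (1 - r (\<rho> n) * r m)) ^ N) \<longlonglongrightarrow> 0"
    proof (rule Lim_null_comparison)
      have "c (\<rho> n) * (1 / (1 - r (\<rho> n) * r m)) ^ N \<le> c (\<rho> n) * (1 / (1 - r m)) ^ N" for n
        using r(2,3)[of m] r(2,3)[of "\<rho> n"] c0[of "\<rho> n"] mult_right_mono[of "r (\<rho> n)" 1 "r m"]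
        by (intro mult_left_mono power_mono divide_left_mono mult_pos_pos) auto
      moreover have "0 \<le> c (\<rho> n) * (1 / (1 - r (\<rho> n) * r m)) ^ N" for n
        using r(2,3)[of m] r(2,3)[of "\<rho> n"] c0[of "\<rho> n"] mult_right_mono[of "r (\<rho> n)" 1 "r m"]
        by (intro mult_nonneg_nonneg zero_le_power) auto
      ultimately show "\<forall>\<^sub>F n in sequentially. norm (c (\<rho> n) * (1 / (1 - r (\<rho> n) * r m)) ^ N) \<le> c (\<rho> n) * (1 / (1 - r m)) ^ N"
        by (intro always_eventually allI) (simp only: real_norm_def abs_of_nonneg)
      show "(\<lambda>n. c (\<rho> n) * (1 / (1 - r m)) ^ N) \<longlonglongrightarrow> 0"
        using LIMSEQ_subseq_LIMSEQ[OF c_lim \<rho>] by (intro tendsto_mult_left_zero) (simp add: comp_def)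
    qed
    ultimately show "(\<lambda>n. ?T (u (\<rho> n)) ?x) \<longlonglongrightarrow> 0"
      by (simp only: tendsto_of_real_iff[of _ 0, simplified])
  qed
  ultimately have "(cmod (?T (u m) ?x - 0))\<^sup>2 \<le> e\<^sup>2 / v m"
    by (intro LIMSEQ_le_const2) auto
  moreover have "(cmod (?T (u m) ?x - 0))\<^sup>2 = 1 / (4 * t m ^ N)"
  proof -
    have "?T (u m) ?x = of_real (c m / t m ^ N)"
      unfolding val by (simp add: t_def power_divide power2_eq_square)
    then show ?thesis
      using t[of m] by (simp add: norm_divide norm_power power_divide c2) (simp add: power2_eq_square)
  qed
  ultimately have "1 / (4 * t m ^ N) \<le> 1 / (8 * 4 ^ N) / v m"
    by (simp add: e(2))
  then have "8 * 4 ^ N * v m \<le> 4 * t m ^ N"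
    using t[of m] v[of m] by (simp add: divide_simps mult_ac)
  also have "\<dots> \<le> 4 * (4 ^ N * v m)" using tv[of m] by simp
  finally show False using v[of m] by simp
qed

subsection \<open>Takenaka-Malmquist decomposition\<close>

definition blaschke :: "real list \<Rightarrow> complex \<Rightarrow> complex" where
  "blaschke as w = (\<Prod>a\<leftarrow>as. (w - of_real a) / (1 - of_real a * w))"

primrec tm_rest :: "real list \<Rightarrow> (nat \<Rightarrow> complex) \<Rightarrow> nat \<Rightarrow> complex" where
  "tm_rest [] c = c"
| "tm_rest (a # as) c = tm_rest as (blaschke_quot a c)"

primrec tm_coeff :: "real list \<Rightarrow> (nat \<Rightarrow> complex) \<Rightarrow> nat \<Rightarrow> complex" where
  "tm_coeff [] c = (\<lambda>_. 0)"
| "tm_coeff (a # as) c = case_nat ((1 - of_real a ^ 2) * tail_sum a c 0) (tm_coeff as (blaschke_quot a c))"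

text \<open>Takenaka-Malmquist functions without normalising constants: the kernel at the k-th point
  times the Blaschke factors of the earlier ones. Points may repeat, so multiplicities need no
  derivatives; past the end of the list the value is 0.\<close>

primrec tm_fun :: "real list \<Rightarrow> nat \<Rightarrow> complex \<Rightarrow> complex" where
  "tm_fun [] k w = 0"
| "tm_fun (a # as) k w =
    (case k of 0 \<Rightarrow> 1 / (1 - of_real a * w) | Suc j \<Rightarrow> (w - of_real a) / (1 - of_real a * w) * tm_fun as j w)"

lemma tm_rest_ell2:
  assumes "\<forall>a\<in>set as. \<bar>a\<bar> < 1" "summable (\<lambda>n. (cmod (c n))\<^sup>2)"
  shows "summable (\<lambda>n. (cmod (tm_rest as c n))\<^sup>2) \<and> (\<Sum>n. (cmod (tm_rest as c n))\<^sup>2) \<le> (\<Sum>n. (cmod (c n))\<^sup>2)"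
  using assms
proof (induction as arbitrary: c)
  case (Cons a as)
  then have a: "\<bar>a\<bar> < 1" by simp
  note q = blaschke_quot_ell2[OF a Cons.prems(2)]
  from Cons.IH[OF _ q(1)] Cons.prems(1) q(2) show ?case by auto
qed simp

lemma tm_decomposition:
  assumes "\<forall>a\<in>set as. \<bar>a\<bar> < 1" "summable (\<lambda>n. (cmod (c n))\<^sup>2)" and w: "cmod w < 1"
  shows "ev c w = (\<Sum>k<length as. tm_coeff as c k * tm_fun as k w) + blaschke as w * ev (tm_rest as c) w"
  using assms(1,2)
proof (induction as arbitrary: c)
  case Nil
  then show ?case by (simp add: blaschke_def)
next
  case (Cons a as)
  then have a: "\<bar>a\<bar> < 1" by simp
  let ?q = "blaschke_quot a c" and ?b = "(w - of_real a) / (1 - of_real a * w)"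
  have "ev c w = ((1 - of_real a ^ 2) * tail_sum a c 0) / (1 - of_real a * w) + ?b * ev ?q w"
    by (rule ev_blaschke_quot[OF a Cons.prems(2) w])
  also have "ev ?q w = (\<Sum>k<length as. tm_coeff as ?q k * tm_fun as k w) + blaschke as w * ev (tm_rest as ?q) w"
    using Cons.prems(1) by (intro Cons.IH blaschke_quot_ell2[OF a Cons.prems(2)]) auto
  finally show ?case
    by (simp add: sum.lessThan_Suc_shift blaschke_def sum_distrib_left distrib_left mult_ac del: sum.lessThan_Suc)
qed

text \<open>This is what makes the finite-rank part of the decomposition a linear operator.\<close>

lemma tm_coeff_linear:
  assumes "\<forall>a\<in>set as. \<bar>a\<bar> < 1" "summable (\<lambda>n. (cmod (c n))\<^sup>2)" "summable (\<lambda>n. (cmod (d n))\<^sup>2)"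
  shows "tm_coeff as (\<lambda>n. x * c n + y * d n) k = x * tm_coeff as c k + y * tm_coeff as d k"
  using assms
proof (induction as arbitrary: c d k)
  case (Cons a as)
  then have a: "\<bar>a\<bar> < 1" by simp
  have ts: "tail_sum a (\<lambda>n. x * c n + y * d n) n = x * tail_sum a c n + y * tail_sum a d n" for n
  proof -
    have "(\<lambda>j. x * (c (n + j) * of_real a ^ j) + y * (d (n + j) * of_real a ^ j)) sums
        (x * tail_sum a c n + y * tail_sum a d n)"
      by (intro sums_add sums_mult tail_sum_sums a Cons.prems)
    then have "(\<lambda>j. (x * c (n + j) + y * d (n + j)) * of_real a ^ j) sums
        (x * tail_sum a c n + y * tail_sum a d n)"
      by (simp add: algebra_simps)
    then show ?thesis by (simp add: tail_sum_def sums_iff)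
  qed
  have "blaschke_quot a (\<lambda>n. x * c n + y * d n) = (\<lambda>n. x * blaschke_quot a c n + y * blaschke_quot a d n)"
    by (simp add: blaschke_quot_def ts fun_eq_iff algebra_simps)
  then show ?case
    using Cons.IH[of "blaschke_quot a c" "blaschke_quot a d"] Cons.prems blaschke_quot_ell2(1)[OF a]
    by (cases k) (simp_all add: ts algebra_simps)
qed simp

lemma blaschke_denom_nz:
  assumes "\<bar>a\<bar> < 1" "cmod w < 1"
  shows "1 - \<bar>a\<bar> \<le> cmod (1 - of_real a * w)" "1 - of_real a * w \<noteq> 0"
proof -
  have "cmod (of_real a * w) \<le> \<bar>a\<bar>"
    using assms mult_left_mono[of "cmod w" 1 "\<bar>a\<bar>"] by (simp add: norm_mult)
  then show "1 - \<bar>a\<bar> \<le> cmod (1 - of_real a * w)"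
    using norm_triangle_ineq2[of 1 "of_real a * w"] by simp
  with assms show "1 - of_real a * w \<noteq> 0" by auto
qed

lemma tm_fun_bounded:
  assumes "\<forall>a\<in>set as. \<bar>a\<bar> < 1"
  shows "\<exists>M. \<forall>w. cmod w < 1 \<longrightarrow> cmod (tm_fun as k w) \<le> M"
  using assms
proof (induction as arbitrary: k)
  case (Cons a as)
  then have a: "\<bar>a\<bar> < 1" by simp
  show ?case
  proof (cases k)
    case 0
    have "cmod (1 / (1 - of_real a * w)) \<le> 1 / (1 - \<bar>a\<bar>)" if "cmod w < 1" for w
      using blaschke_denom_nz[OF a that] a by (auto simp: norm_divide intro!: divide_left_mono mult_pos_pos)
    then show ?thesis using 0 by auto
  next
    case (Suc j)
    obtain M where M: "\<And>w. cmod w < 1 \<Longrightarrow> cmod (tm_fun as j w) \<le> M"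
      using Cons.IH[of j] Cons.prems by auto
    have "cmod (tm_fun (a # as) k w) \<le> 1 * M" if w: "cmod w < 1" for w
      unfolding Suc tm_fun.simps nat.case norm_mult
      by (intro mult_mono blaschke_factor_le_1 a w M) auto
    then show ?thesis by blast
  qed
qed (auto intro: exI[of _ 0])

lemma tm_fun_holomorphic:
  assumes "\<forall>a\<in>set as. \<bar>a\<bar> < 1"
  shows "tm_fun as k holomorphic_on ball 0 1"
  using assms
proof (induction as arbitrary: k)
  case (Cons a as)
  then have a: "\<bar>a\<bar> < 1" by simp
  have nz: "1 - complex_of_real a * w \<noteq> 0" if "w \<in> ball 0 1" for w
    using blaschke_denom_nz[OF a] that by auto
  show ?case
  proof (cases k)
    case 0
    then show ?thesis using nz by (auto intro!: holomorphic_intros)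
  next
    case (Suc j)
    have "tm_fun as j holomorphic_on ball 0 1" using Cons by auto
    then show ?thesis unfolding Suc using nz by (auto intro!: holomorphic_intros)
  qed
next
  case Nil
  have "tm_fun [] k = (\<lambda>_. 0)" by auto
  then show ?case by simp
qed

lemma blaschke_holomorphic:
  assumes "\<forall>a\<in>set as. \<bar>a\<bar> < 1"
  shows "blaschke as holomorphic_on ball 0 1"
  using assms
proof (induction as)
  case (Cons a as)
  then have a: "\<bar>a\<bar> < 1" by simp
  have "(\<lambda>w. (w - of_real a) / (1 - of_real a * w) * blaschke as w) holomorphic_on ball 0 1"
    using blaschke_denom_nz[OF a] Cons by (intro holomorphic_intros) auto
  then show ?case by (simp add: blaschke_def[abs_def])
qed (simp add: blaschke_def[abs_def])

lemma blaschke_le_1: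
  assumes "\<forall>a\<in>set as. \<bar>a\<bar> < 1" "cmod w < 1"
  shows "cmod (blaschke as w) \<le> 1"
  using assms
proof (induction as)
  case (Cons a as)
  have "cmod (blaschke (a # as) w) = cmod ((w - of_real a) / (1 - of_real a * w)) * cmod (blaschke as w)"
    by (simp only: blaschke_def norm_mult prod_list.Cons list.map)
  also have "\<dots> \<le> 1"
    by (intro mult_le_one) (use Cons blaschke_factor_le_1 in auto)
  finally show ?case .
qed (simp add: blaschke_def)

text \<open>The disk points whose Cayley coordinates are the powers of 2 from 2^(-p) to 2^p, each
  repeated p times.\<close>

definition dyadic_zeros :: "nat \<Rightarrow> real list" where
  "dyadic_zeros p = concat (map (\<lambda>k. replicate p ((2 ^ k / 2 ^ p - 1) / (2 ^ k / 2 ^ p + 1))) [0..<2 * p + 1])"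

lemma dyadic_zeros_length: "length (dyadic_zeros p) = (2 * p + 1) * p"
  by (simp add: dyadic_zeros_def length_concat comp_def sum_list_triv)

lemma dyadic_zeros_in_disk: "\<forall>a\<in>set (dyadic_zeros p). \<bar>a\<bar> < 1"
proof -
  have *: "\<bar>(b - 1) / (b + 1)\<bar> < 1" if "b > 0" for b :: real
    using that by (auto simp: abs_less_iff field_simps)
  have "\<bar>(2 ^ k / 2 ^ p - 1) / (2 ^ k / 2 ^ p + 1)\<bar> < (1::real)" for k
    by (rule *) simp
  then show ?thesis by (auto simp: dyadic_zeros_def simp del: abs_divide upt_Suc)
qed

lemma dyadic_scale:
  fixes x :: real
  assumes "1 \<le> x" "x \<le> 2 ^ Suc m"
  shows "\<exists>k\<le>m. 2 ^ k \<le> x \<and> x \<le> 2 * 2 ^ k"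
  using assms
proof (induction m)
  case (Suc m)
  show ?case
  proof (cases "x \<le> 2 ^ Suc m")
    case True
    with Suc show ?thesis using le_SucI by blast
  next
    case False
    with Suc.prems show ?thesis by (intro exI[of _ "Suc m"]) auto
  qed
qed auto

text \<open>Some zero has its Cayley coordinate within a factor 2 below |cayley w|. Its p equal
  factors are small by \<open>sector_blaschke_bound\<close>; all other factors are at most
  1.\<close>

lemma blaschke_dyadic_bound:
  assumes w: "cmod w < 1" and \<kappa>: "0 < \<kappa>" "\<kappa> * cmod (cayley w) \<le> Re (cayley w)"
    and W: "1 / 2 ^ p \<le> cmod (cayley w)" "cmod (cayley w) \<le> 2 ^ p"
  shows "(cmod (blaschke (dyadic_zeros p) w))\<^sup>2 \<le> (1 - 8 / 9 * \<kappa>) ^ p"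
proof -
  define b :: "nat \<Rightarrow> real" where "b k = 2 ^ k / 2 ^ p" for k
  define F where "F k = (w - of_real ((b k - 1) / (b k + 1))) / (1 - of_real ((b k - 1) / (b k + 1)) * w)" for k
  have b0: "b k > 0" for k by (simp add: b_def)
  have "\<bar>(b k - 1) / (b k + 1)\<bar> < 1" for k
    using b0[of k] by (auto simp: abs_less_iff field_simps)
  then have F1: "cmod (F k) \<le> 1" for k
    unfolding F_def by (intro blaschke_factor_le_1 w)
  have prod: "blaschke (concat (map (\<lambda>k. replicate p ((b k - 1) / (b k + 1))) [0..<m])) w = (\<Prod>k<m. F k ^ p)" for m
    by (induction m) (simp_all add: blaschke_def F_def prod_list_replicate)
  have "\<exists>k\<le>2 * p. 2 ^ k \<le> cmod (cayley w) * 2 ^ p \<and> cmod (cayley w) * 2 ^ p \<le> 2 * 2 ^ k"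
  proof (rule dyadic_scale)
    show "1 \<le> cmod (cayley w) * 2 ^ p" using W by (simp add: field_simps)
    have "cmod (cayley w) * 2 ^ p \<le> 2 ^ p * 2 ^ p" using W by simp
    also have "\<dots> = 2 ^ (2 * p)" by (simp only: mult_2 power_add)
    also have "\<dots> \<le> 2 ^ Suc (2 * p)" by simp
    finally show "cmod (cayley w) * 2 ^ p \<le> 2 ^ Suc (2 * p)" .
  qed
  then obtain k where k: "k \<le> 2 * p" "b k \<le> cmod (cayley w)" "cmod (cayley w) \<le> 2 * b k"
    by (auto simp: b_def field_simps)
  have "cmod (blaschke (dyadic_zeros p) w) = (\<Prod>j<2 * p + 1. cmod (F j) ^ p)"
    using prod[of "2 * p + 1"] unfolding dyadic_zeros_def b_def by (simp only: prod_norm[symmetric] norm_power)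
  also have "\<dots> = cmod (F k) ^ p * (\<Prod>j\<in>{..<2 * p + 1} - {k}. cmod (F j) ^ p)"
    using k by (intro prod.remove) auto
  also have "\<dots> \<le> cmod (F k) ^ p * 1"
    by (intro mult_left_mono prod_le_1) (auto intro: power_le_one F1)
  finally have "(cmod (blaschke (dyadic_zeros p) w))\<^sup>2 \<le> (cmod (F k) ^ p)\<^sup>2"
    by (intro power_mono) auto
  also have "\<dots> = ((cmod (F k))\<^sup>2) ^ p" by (simp add: power_mult[symmetric] mult.commute)
  also have "\<dots> \<le> (1 - 8 / 9 * \<kappa>) ^ p"
    unfolding F_def blaschke_factor_cayley[OF b0 w]
    by (intro power_mono sector_blaschke_bound b0 k \<kappa>) auto
  finally show ?thesis .
qed

subsection \<open>The subcritical case\<close>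

lemma zero_in_H2: "N \<ge> 1 \<Longrightarrow> (\<lambda>_. 0) \<in> H2 N" "N \<ge> 1 \<Longrightarrow> h2_norm N (\<lambda>_. 0) = 0"
proof -
  assume N: "N \<ge> 1"
  have t: "taylor (\<lambda>_. 0) = (\<lambda>_. 0)" by (rule taylor_eqI) simp
  have "summable (\<lambda>n. (cmod (taylor (\<lambda>_. 0) n))\<^sup>2)" unfolding t by simp
  from h2_one_variable[OF N _ this, of "\<lambda>_. 0"] t
  show "(\<lambda>_. 0) \<in> H2 N" "h2_norm N (\<lambda>_. 0) = 0" by simp_all
qed

lemma bounded_on_H2_diff:
  assumes N: "N \<ge> 1" and T: "bounded_on_H2 N T" and R: "bounded_on_H2 N R"
  shows "bounded_on_H2 N (\<lambda>f z. T f z - R f z)"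
proof -
  obtain C D where C: "\<And>f. f \<in> H2 N \<Longrightarrow> h2_norm N (T f) \<le> C * h2_norm N f"
    and D: "\<And>f. f \<in> H2 N \<Longrightarrow> h2_norm N (R f) \<le> D * h2_norm N f"
    using T R unfolding bounded_on_H2_def by blast
  have "h2_norm N (\<lambda>z. T f z - R f z) \<le> sqrt (2 * C\<^sup>2 + 2 * D\<^sup>2) * h2_norm N f" if f: "f \<in> H2 N" for f
  proof -
    have "T f \<in> H2 N" "R f \<in> H2 N" using f T R unfolding bounded_on_H2_def by blast+
    from h2_diff(2)[OF this] have "(h2_norm N (\<lambda>z. T f z - R f z))\<^sup>2 \<le> 2 * (h2_norm N (T f))\<^sup>2 + 2 * (h2_norm N (R f))\<^sup>2" .
    also have "\<dots> \<le> 2 * (C * h2_norm N f)\<^sup>2 + 2 * (D * h2_norm N f)\<^sup>2"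
      using C[OF f] D[OF f] by (intro add_mono mult_left_mono power_mono h2_norm_nonneg) auto
    also have "\<dots> = (sqrt (2 * C\<^sup>2 + 2 * D\<^sup>2) * h2_norm N f)\<^sup>2"
      by (simp add: power_mult_distrib algebra_simps)
    finally show ?thesis by (rule power2_le_imp_le) (simp add: h2_norm_nonneg)
  qed
  moreover have "(\<lambda>z. T f z - R f z) \<in> H2 N" if "f \<in> H2 N" for f
    using that T R unfolding bounded_on_H2_def by (intro h2_diff(1)) blast+
  ultimately show ?thesis unfolding bounded_on_H2_def by blast
qed

lemma op_norm_nonneg:
  assumes N: "N \<ge> 1" and T: "bounded_on_H2 N T"
  shows "0 \<le> op_norm N T"
proof -
  obtain C where C: "\<And>f. f \<in> H2 N \<Longrightarrow> h2_norm N (T f) \<le> C * h2_norm N f"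
    using T unfolding bounded_on_H2_def by blast
  have "bdd_above ((\<lambda>f. h2_norm N (T f)) ` {f \<in> H2 N. h2_norm N f \<le> 1})"
  proof (rule bdd_aboveI2)
    fix f assume "f \<in> {f \<in> H2 N. h2_norm N f \<le> 1}"
    then have "C * h2_norm N f \<le> \<bar>C\<bar> * 1" "h2_norm N (T f) \<le> C * h2_norm N f"
      using C h2_norm_nonneg[of N f] by (auto intro!: mult_mono simp del: mult_1_right)
    then show "h2_norm N (T f) \<le> \<bar>C\<bar>" by linarith
  qed
  then show ?thesis unfolding op_norm_def
    by (rule cSup_upper2[rotated 2]) (use zero_in_H2[OF N] h2_norm_nonneg in auto)
qed

text \<open>\<open>Inf\<close> and \<open>Sup\<close> of reals are meaningful only for suitably
  bounded nonempty sets. Boundedness of T and of every competitor R makes the operator norms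
  nonnegative, and the zero function keeps the unit ball nonempty.\<close>

lemma approx_num_le:
  assumes N: "N \<ge> 1" and T: "bounded_on_H2 N T"
    and R: "linear_on_H2 N R" "bounded_on_H2 N R" "rank_less N R n"
    and e: "\<And>f. f \<in> H2 N \<Longrightarrow> h2_norm N f \<le> 1 \<Longrightarrow> h2_norm N (\<lambda>z. T f z - R f z) \<le> e"
  shows "approx_num N T n \<le> e"
proof -
  have "approx_num N T n \<le> op_norm N (\<lambda>f z. T f z - R f z)"
    unfolding approx_num_def
  proof (rule cInf_lower)
    show "bdd_below {op_norm N (\<lambda>f z. T f z - R f z) |R. linear_on_H2 N R \<and> bounded_on_H2 N R \<and> rank_less N R n}"
      by (rule bdd_belowI[of _ 0]) (auto intro!: op_norm_nonneg bounded_on_H2_diff N T)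
  qed (use R in blast)
  also have "\<dots> \<le> e"
    unfolding op_norm_def by (rule cSup_least) (use e zero_in_H2[OF N] in auto)
  finally show ?thesis .
qed

section \<open>Factorisation through the critical lens map, with \<tau> = N \<theta>\<close>

context
  fixes N :: nat and \<theta> \<tau> :: real
  assumes N: "N \<ge> 2" and \<tau>: "0 < \<tau>" "\<tau> < 1" and \<theta>_eq: "\<theta> = \<tau> / real N"
begin

lemma N1: "N \<ge> 1" using N by simp

lemma inv_N: "0 < 1 / real N" "1 / real N < 1" using N by auto

lemma lens_factor:
  assumes "cmod z < 1"
  shows "lens \<theta> z = lens (1 / real N) (lens \<tau> z)"
  using lens_lens[OF \<tau> assms, of "1 / real N"] by (simp add: \<theta>_eq)

text \<open>The first factor of the operator; by \<open>critical_bounded\<close> it lands in the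
  unweighted Hardy space of the disk.\<close>

definition crit :: "((nat \<Rightarrow> complex) \<Rightarrow> complex) \<Rightarrow> complex \<Rightarrow> complex" where
  "crit f = (\<lambda>w. f (\<lambda>_. lens (1 / real N) w))"

lemma crit_holomorphic: "f \<in> H2 N \<Longrightarrow> crit f holomorphic_on ball 0 1"
  unfolding crit_def by (rule diag_lens_holomorphic[OF N _ inv_N])

lemma comp_via_crit:
  assumes "z \<in> polydisk N"
  shows "comp_op (lens_diag \<theta>) f z = crit f (lens \<tau> (z 0))"
proof -
  have "cmod (z 0) < 1" using assms N by (auto simp: polydisk_def)
  then show ?thesis by (simp add: comp_lens_diag crit_def lens_factor)
qed

lemma compose_lens_holomorphic:
  assumes "g holomorphic_on ball 0 1"
  shows "(\<lambda>z. g (lens \<tau> z)) holomorphic_on ball 0 1"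
proof -
  have "lens \<tau> ` ball 0 1 \<subseteq> ball 0 1"
    using lens_in_disk[OF \<tau>] by auto
  then show ?thesis
    using holomorphic_on_compose_gen[OF lens_holomorphic[OF \<tau>] assms] by (simp add: comp_def)
qed

text \<open>A pointwise bound by a multiple of \<open>s powr -\<sigma>\<close> with \<open>\<sigma> = (1 + \<tau>) / 2\<close> suffices, because \<open>\<tau> < \<sigma> < 1\<close>:
  the singularity is integrable, and the gap \<open>\<sigma> - \<tau>\<close> turns smallness of \<open>s\<close> into decay.\<close>

definition weight_mass :: real where
  "weight_mass = 2 * ((1 / 2) powr (- ((1 + \<tau>) / 2) + 1) / (- ((1 + \<tau>) / 2) + 1))"

lemma weight_mass_pos: "weight_mass > 0"
  using \<tau> by (simp add: weight_mass_def)

text \<open>\<open>weight_mass\<close> is twice the integral of the weight over {0..1/2}; the factor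
  2 is that of \<open>hardy_bound\<close>.\<close>

lemma weighted_hardy_bound:
  assumes g: "g holomorphic_on ball 0 1"
    and bd: "\<And>z s. cmod z < 1 \<Longrightarrow> 0 < s \<Longrightarrow> s \<le> 1/2 \<Longrightarrow> 2 * s \<le> cmod (1 - z) \<Longrightarrow> 2 * s \<le> cmod (1 + z) \<Longrightarrow>
        (cmod (g (lens \<tau> z)))\<^sup>2 \<le> B * s powr (- ((1 + \<tau>) / 2))"
    and F: "\<And>z. z \<in> polydisk N \<Longrightarrow> F z = g (lens \<tau> (z 0))"
  shows "F \<in> H2 N" and "(h2_norm N F)\<^sup>2 \<le> B * weight_mass"
proof -
  let ?h = "\<lambda>z. g (lens \<tau> z)"
  have h: "?h holomorphic_on ball 0 1" by (rule compose_lens_holomorphic[OF g])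
  have I: "((\<lambda>s. B * s powr (- ((1 + \<tau>) / 2))) has_integral (B * (weight_mass / 2))) {0..1/2}"
  proof -
    have "weight_mass / 2 = (1 / 2) powr (- ((1 + \<tau>) / 2) + 1) / (- ((1 + \<tau>) / 2) + 1)"
      unfolding weight_mass_def by (rule nonzero_mult_div_cancel_left) simp
    then show ?thesis
      using \<tau> by (simp only:) (intro has_integral_mult_right has_integral_powr_from_0; simp)
  qed
  have sm: "summable (\<lambda>n. (cmod (taylor ?h n))\<^sup>2)"
    by (rule hardy_bound(1)[OF h I]) (rule bd)
  have le: "(\<Sum>n. (cmod (taylor ?h n))\<^sup>2) \<le> 2 * (B * (weight_mass / 2))"
    by (rule hardy_bound(2)[OF h I]) (rule bd)
  show "F \<in> H2 N"
    by (rule h2_one_variable(1)[OF N1 h sm]) (rule F)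
  have "(h2_norm N F)\<^sup>2 = (\<Sum>n. (cmod (taylor ?h n))\<^sup>2)"
    by (rule h2_one_variable(2)[OF N1 h sm]) (rule F)
  with le show "(h2_norm N F)\<^sup>2 \<le> B * weight_mass" by simp
qed

lemma s_powr_sigma:
  assumes "0 < s" "s \<le> 1/2"
  shows "s powr (- \<tau>) \<le> s powr (- ((1 + \<tau>) / 2))"
    and "s \<le> s0 \<Longrightarrow> s powr (- \<tau>) \<le> s0 powr ((1 - \<tau>) / 2) * s powr (- ((1 + \<tau>) / 2))"
    and "1 \<le> s powr (- ((1 + \<tau>) / 2))"
proof -
  show "s powr (- \<tau>) \<le> s powr (- ((1 + \<tau>) / 2))"
    using assms \<tau> by (intro powr_mono') auto
  show "1 \<le> s powr (- ((1 + \<tau>) / 2))"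
    using assms \<tau> powr_mono'[of "- ((1 + \<tau>) / 2)" 0 s] by auto
  assume "s \<le> s0"
  have "s powr (- \<tau>) = s powr ((1 - \<tau>) / 2) * s powr (- ((1 + \<tau>) / 2))"
    by (simp add: powr_add[symmetric] field_simps)
  also have "\<dots> \<le> s0 powr ((1 - \<tau>) / 2) * s powr (- ((1 + \<tau>) / 2))"
    using assms \<tau> \<open>s \<le> s0\<close> by (intro mult_right_mono powr_mono2) auto
  finally show "s powr (- \<tau>) \<le> s0 powr ((1 - \<tau>) / 2) * s powr (- ((1 + \<tau>) / 2))" .
qed

definition sector_cos :: real where "sector_cos = cos (pi * \<tau> / 2)"

lemma sector_cos: "0 < sector_cos" "sector_cos \<le> 1"
  unfolding sector_cos_def using cos_half_pos[of 1, OF _ \<tau>] by auto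

lemma ell2_lens_bound:
  assumes c: "summable (\<lambda>n. (cmod (c n))\<^sup>2)" and z: "cmod z < 1"
    and s: "0 < s" "2 * s \<le> cmod (1 - z)" "2 * s \<le> cmod (1 + z)"
  shows "(cmod (ev c (lens \<tau> z)))\<^sup>2 \<le> (\<Sum>n. (cmod (c n))\<^sup>2) / sector_cos * s powr (- \<tau>)"
proof -
  have "(cmod (ev c (lens \<tau> z)))\<^sup>2 \<le> (\<Sum>n. (cmod (c n))\<^sup>2) / (1 - (cmod (lens \<tau> z))\<^sup>2)"
    by (rule ell2_power_series(3)[OF c lens_in_disk[OF \<tau> z]])
  also have "\<dots> \<le> (\<Sum>n. (cmod (c n))\<^sup>2) / (sector_cos * s powr \<tau>)"
  proof (rule divide_left_mono)
    show low: "sector_cos * s powr \<tau> \<le> 1 - (cmod (lens \<tau> z))\<^sup>2"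
      unfolding sector_cos_def by (rule lens_defect_lower[OF \<tau> z s])
    show "0 \<le> (\<Sum>n. (cmod (c n))\<^sup>2)" by (rule suminf_nonneg[OF c]) simp
    have "0 < sector_cos * s powr \<tau>" using sector_cos s by simp
    moreover from this low have "0 < 1 - (cmod (lens \<tau> z))\<^sup>2" by linarith
    ultimately show "0 < (1 - (cmod (lens \<tau> z))\<^sup>2) * (sector_cos * s powr \<tau>)"
      by (rule mult_pos_pos[rotated])
  qed
  finally show ?thesis by (simp add: powr_minus_divide)
qed

text \<open>Montel gives a locally uniformly convergent subsequence of the functions
  \<open>crit (u k)\<close>. For s > s0 the points \<open>lens \<tau> z\<close> stay in a fixed
  compact disk; for s <= s0 the gap between \<tau> and (1 + \<tau>) / 2 makes the contribution
  small. The limit g serves only for comparison.\<close>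

lemma subcritical_compact: "compact_on_H2 N (comp_op (lens_diag \<theta>))"
proof -
  let ?T = "comp_op (lens_diag \<theta>)"
  obtain C where C: "C > 0"
    and sm: "\<And>f. f \<in> H2 N \<Longrightarrow> summable (\<lambda>n. (cmod (taylor (crit f) n))\<^sup>2)"
    and le: "\<And>f. f \<in> H2 N \<Longrightarrow> (\<Sum>n. (cmod (taylor (crit f) n))\<^sup>2) \<le> C * (h2_norm N f)\<^sup>2"
    using critical_bounded[OF N] unfolding crit_def by blast
  let ?J = weight_mass
  note J = weight_mass_pos
  have ev_crit: "crit f w = ev (taylor (crit f)) w" if "f \<in> H2 N" "cmod w < 1" for f w
    using taylor_sums[OF crit_holomorphic[OF that(1)] that(2)] by (simp add: ev_def sums_iff)
  show ?thesis
    unfolding compact_on_H2_def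
  proof (intro conjI ballI allI impI)
    fix f assume f: "f \<in> H2 N"
    have "(cmod (crit f (lens \<tau> z)))\<^sup>2 \<le> C * (h2_norm N f)\<^sup>2 / sector_cos * s powr (- ((1 + \<tau>) / 2))"
      if z: "cmod z < 1" and s: "0 < s" "s \<le> 1/2" "2 * s \<le> cmod (1 - z)" "2 * s \<le> cmod (1 + z)" for z s
    proof -
      have "(cmod (crit f (lens \<tau> z)))\<^sup>2 \<le> (\<Sum>n. (cmod (taylor (crit f) n))\<^sup>2) / sector_cos * s powr (- \<tau>)"
        unfolding ev_crit[OF f lens_in_disk[OF \<tau> z]] by (rule ell2_lens_bound[OF sm[OF f] z s(1,3,4)])
      also have "\<dots> \<le> C * (h2_norm N f)\<^sup>2 / sector_cos * s powr (- ((1 + \<tau>) / 2))"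
        using C sector_cos by (intro mult_mono divide_right_mono le f s_powr_sigma s) auto
      finally show ?thesis .
    qed
    then show "?T f \<in> H2 N"
      by (rule weighted_hardy_bound(1)[where F = "?T f", OF crit_holomorphic[OF f] _ comp_via_crit])
  next
    fix u :: "nat \<Rightarrow> (nat \<Rightarrow> complex) \<Rightarrow> complex"
    assume u: "\<forall>k. u k \<in> H2 N \<and> h2_norm N (u k) \<le> 1"
    have uH: "u k \<in> H2 N" for k using u by blast
    have uC: "(\<Sum>n. (cmod (taylor (crit (u k)) n))\<^sup>2) \<le> C" for k
    proof -
      have "(h2_norm N (u k))\<^sup>2 \<le> 1" using u h2_norm_nonneg[of N "u k"] by (simp add: power_le_one)
      then have "C * (h2_norm N (u k))\<^sup>2 \<le> C * 1" using C by (intro mult_left_mono) auto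
      with le[OF uH, of k] show ?thesis by simp
    qed
    have bound: "(cmod (crit (u k) w))\<^sup>2 \<le> C / (1 - (cmod w)\<^sup>2)" if w: "cmod w < 1" for k w
    proof -
      have "(cmod (crit (u k) w))\<^sup>2 \<le> (\<Sum>n. (cmod (taylor (crit (u k)) n))\<^sup>2) / (1 - (cmod w)\<^sup>2)"
        unfolding ev_crit[OF uH w] by (rule ell2_power_series(3)[OF sm[OF uH] w])
      also have "\<dots> \<le> C / (1 - (cmod w)\<^sup>2)"
        using w uC by (intro divide_right_mono) (auto simp: abs_square_le_1)
      finally show ?thesis .
    qed
    obtain g r where r: "strict_mono (r :: nat \<Rightarrow> nat)"
      and unif: "\<And>K. compact K \<Longrightarrow> K \<subseteq> ball 0 1 \<Longrightarrow> uniform_limit K ((\<lambda>k. crit (u k)) \<circ> r) g sequentially"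
    proof (rule Montel[of "ball 0 1" "range (\<lambda>k. crit (u k))" "\<lambda>k. crit (u k)"])
      show "h holomorphic_on ball 0 1" if "h \<in> range (\<lambda>k. crit (u k))" for h
        using that crit_holomorphic[OF uH] by auto
      fix K :: "complex set" assume K: "compact K" "K \<subseteq> ball 0 1"
      have "continuous_on K (\<lambda>w. sqrt (C / (1 - (cmod w)\<^sup>2)))"
      proof (intro continuous_intros ballI)
        fix w assume "w \<in> K"
        then show "1 - (cmod w)\<^sup>2 \<noteq> 0"
          using K(2) abs_square_less_1[of "cmod w"] by auto
      qed
      then have "bounded ((\<lambda>w. sqrt (C / (1 - (cmod w)\<^sup>2))) ` K)"
        using K(1) compact_continuous_image compact_imp_bounded by blast
      then obtain B where B: "\<And>w. w \<in> K \<Longrightarrow> \<bar>sqrt (C / (1 - (cmod w)\<^sup>2))\<bar> \<le> B"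
        unfolding bounded_iff by auto
      have "cmod (crit (u k) w) \<le> B" if w: "w \<in> K" for k w
      proof -
        have "cmod (crit (u k) w) \<le> sqrt (C / (1 - (cmod w)\<^sup>2))"
          using bound[of w k] w K(2) by (intro real_le_rsqrt) auto
        with B[OF w] show ?thesis by linarith
      qed
      then show "\<exists>B. \<forall>h\<in>range (\<lambda>k. crit (u k)). \<forall>w\<in>K. cmod (h w) \<le> B" by auto
    qed auto
    show "\<exists>r::nat\<Rightarrow>nat. strict_mono r \<and> (\<forall>e>0. \<exists>M. \<forall>m\<ge>M. \<forall>n\<ge>M.
            h2_norm N (\<lambda>z. ?T (u (r m)) z - ?T (u (r n)) z) < e)"
    proof (intro exI[of _ r] conjI allI impI r)
      fix e :: real assume e: "e > 0"
      define \<eta> where "\<eta> = (1 - \<tau>) / 2"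
      have \<eta>: "\<eta> > 0" using \<tau> by (simp add: \<eta>_def)
      \<comment> \<open>A difference of two functions, each with squared modulus at most
        \<open>C / sector_cos * s powr (- \<tau>)\<close>, satisfies the same bound with factor
        4.\<close>
      define A where "A = 4 * C / sector_cos"
      have A: "A > 0" using C sector_cos by (simp add: A_def)
      \<comment> \<open>s0 solves A * s0 powr \<eta> = e^2 / (4 * weight_mass), capped at 1/2. Both
        regions then have the same multiple of the weight as majorant, and integration yields e^2 /
        4.\<close>
      define s0 where "s0 = min (1/2) ((e\<^sup>2 / (4 * A * ?J)) powr (1 / \<eta>))"
      have s0: "0 < s0" "s0 \<le> 1/2" using e A J by (auto simp: s0_def)
      have s0\<eta>: "A * s0 powr \<eta> \<le> e\<^sup>2 / (4 * ?J)"
      proof -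
        have "s0 powr \<eta> \<le> ((e\<^sup>2 / (4 * A * ?J)) powr (1 / \<eta>)) powr \<eta>"
          using s0 \<eta> by (intro powr_mono2) (auto simp: s0_def)
        also have "\<dots> = e\<^sup>2 / (4 * A * ?J)" using \<eta> e A J by (simp add: powr_powr)
        finally have "A * s0 powr \<eta> \<le> A * (e\<^sup>2 / (4 * A * ?J))" using A by (intro mult_left_mono) auto
        also have "\<dots> = e\<^sup>2 / (4 * ?J)" using A by simp
        finally show ?thesis .
      qed
      define \<delta> where "\<delta> = sqrt (e\<^sup>2 / (4 * ?J)) / 2"
      have \<delta>: "\<delta> > 0" "(2 * \<delta>)\<^sup>2 = e\<^sup>2 / (4 * ?J)" using e J by (auto simp: \<delta>_def)
      \<comment> \<open>The radius is what \<open>lens_defect_lower\<close> leaves for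
        \<open>lens \<tau> z\<close> when s > s0.\<close>
      define K where "K = cball (0::complex) (sqrt (1 - sector_cos * s0 powr \<tau>))"
      have "sqrt (1 - sector_cos * s0 powr \<tau>) < 1"
        using sector_cos s0 by simp
      then have "K \<subseteq> ball 0 1"
        unfolding K_def by (simp only: cball_subset_ball_iff) simp
      then have "uniform_limit K ((\<lambda>k. crit (u k)) \<circ> r) g sequentially"
        by (intro unif) (auto simp: K_def)
      then have "\<exists>M. \<forall>m\<ge>M. \<forall>w\<in>K. dist (crit (u (r m)) w) (g w) < \<delta>"
        using \<delta>(1) unfolding uniform_limit_sequentially_iff by simp
      then obtain M where M: "\<And>m w. m \<ge> M \<Longrightarrow> w \<in> K \<Longrightarrow> dist (crit (u (r m)) w) (g w) < \<delta>"
        by blast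
      show "\<exists>M. \<forall>m\<ge>M. \<forall>n\<ge>M. h2_norm N (\<lambda>z. ?T (u (r m)) z - ?T (u (r n)) z) < e"
      proof (intro exI[of _ M] allI impI)
        fix m n assume mn: "M \<le> m" "M \<le> n"
        let ?G = "\<lambda>w. crit (u (r m)) w - crit (u (r n)) w"
        have pw: "(cmod (?G (lens \<tau> z)))\<^sup>2 \<le> (e\<^sup>2 / (4 * ?J)) * s powr (- ((1 + \<tau>) / 2))"
          if z: "cmod z < 1" and s: "0 < s" "s \<le> 1/2" "2 * s \<le> cmod (1 - z)" "2 * s \<le> cmod (1 + z)" for z s
        proof (cases "s \<le> s0")
          case True
          have one: "(cmod (crit (u k) (lens \<tau> z)))\<^sup>2 \<le> C / sector_cos * s powr (- \<tau>)" for k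
          proof -
            have "(cmod (crit (u k) (lens \<tau> z)))\<^sup>2 \<le> (\<Sum>n. (cmod (taylor (crit (u k)) n))\<^sup>2) / sector_cos * s powr (- \<tau>)"
              unfolding ev_crit[OF uH lens_in_disk[OF \<tau> z]] by (rule ell2_lens_bound[OF sm[OF uH] z s(1,3,4)])
            also have "\<dots> \<le> C / sector_cos * s powr (- \<tau>)"
              using uC[of k] sector_cos by (intro mult_right_mono divide_right_mono) auto
            finally show ?thesis .
          qed
          have "(cmod (x - y))\<^sup>2 \<le> 2 * (cmod x)\<^sup>2 + 2 * (cmod y)\<^sup>2" for x y
          proof -
            have "(cmod (x - y))\<^sup>2 \<le> (cmod x + cmod y)\<^sup>2"
              by (intro power_mono norm_triangle_ineq4) auto
            also have "\<dots> \<le> 2 * (cmod x)\<^sup>2 + 2 * (cmod y)\<^sup>2"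
              using sum_squares_bound[of "cmod x" "cmod y"] by (simp add: power2_sum)
            finally show ?thesis .
          qed
          from this[of "crit (u (r m)) (lens \<tau> z)" "crit (u (r n)) (lens \<tau> z)"]
          have "(cmod (?G (lens \<tau> z)))\<^sup>2 \<le> A * s powr (- \<tau>)"
            using one[of "r m"] one[of "r n"] by (simp add: A_def)
          also have "\<dots> \<le> A * (s0 powr \<eta> * s powr (- ((1 + \<tau>) / 2)))"
            unfolding \<eta>_def using A True by (intro mult_left_mono s_powr_sigma s) auto
          also have "\<dots> \<le> (e\<^sup>2 / (4 * ?J)) * s powr (- ((1 + \<tau>) / 2))"
            using s0\<eta> unfolding mult.assoc[symmetric] by (intro mult_right_mono) auto
          finally show ?thesis .
        next
          case False
          have "sector_cos * s0 powr \<tau> \<le> sector_cos * s powr \<tau>"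
            using False sector_cos s0 \<tau> by (intro mult_left_mono powr_mono2) auto
          also have "\<dots> \<le> 1 - (cmod (lens \<tau> z))\<^sup>2"
            unfolding sector_cos_def by (rule lens_defect_lower[OF \<tau> z s(1,3,4)])
          finally have "lens \<tau> z \<in> K"
            unfolding K_def by (auto intro!: real_le_rsqrt)
          then have "dist (crit (u (r m)) (lens \<tau> z)) (g (lens \<tau> z)) < \<delta>"
            "dist (crit (u (r n)) (lens \<tau> z)) (g (lens \<tau> z)) < \<delta>"
            using M mn by auto
          then have "cmod (?G (lens \<tau> z)) \<le> 2 * \<delta>"
            using dist_triangle2[of "crit (u (r m)) (lens \<tau> z)" "crit (u (r n)) (lens \<tau> z)" "g (lens \<tau> z)"]
            by (simp add: dist_norm)
          then have "(cmod (?G (lens \<tau> z)))\<^sup>2 \<le> (2 * \<delta>)\<^sup>2"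
            by (rule power_mono) simp
          also have "\<dots> \<le> (e\<^sup>2 / (4 * ?J)) * s powr (- ((1 + \<tau>) / 2))"
            unfolding \<delta>(2) using s_powr_sigma(3)[OF s(1,2)] J
              mult_left_mono[of 1 "s powr (- ((1 + \<tau>) / 2))" "e\<^sup>2 / (4 * ?J)"] by simp
          finally show ?thesis .
        qed
        have "(h2_norm N (\<lambda>z. ?T (u (r m)) z - ?T (u (r n)) z))\<^sup>2 \<le> (e\<^sup>2 / (4 * ?J)) * ?J"
        proof (rule weighted_hardy_bound(2))
          show "?G holomorphic_on ball 0 1"
            by (intro holomorphic_intros crit_holomorphic uH)
        qed (use pw in \<open>auto simp: comp_via_crit\<close>)
        also have "\<dots> < e\<^sup>2" using e J by simp
        finally show "h2_norm N (\<lambda>z. ?T (u (r m)) z - ?T (u (r n)) z) < e"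
          by (rule power2_less_imp_less) (use e in simp)
      qed
    qed
  qed
qed

text \<open>The Takenaka-Malmquist part of \<open>crit f\<close> composed with
  \<open>lens \<tau>\<close>. The remainder carries the Blaschke product, so this part interpolates
  \<open>crit f\<close> at the dyadic zeros; f enters only through the coefficients, which makes the
  rank finite.\<close>

definition interp :: "nat \<Rightarrow> ((nat \<Rightarrow> complex) \<Rightarrow> complex) \<Rightarrow> (nat \<Rightarrow> complex) \<Rightarrow> complex" where
  "interp p f z = (\<Sum>k<length (dyadic_zeros p).
     tm_coeff (dyadic_zeros p) (taylor (crit f)) k * tm_fun (dyadic_zeros p) k (lens \<tau> (z 0)))"

text \<open>If s powr \<tau> >= 2^(-p), the Cayley coordinate of \<open>lens \<tau> z\<close> has
  modulus between 2^(-p) and 2^p, the range covered by the zeros. Otherwise s is so small that s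
  powr ((1 - \<tau>) / 2) alone decays exponentially in p. The maximum takes the worse of the two
  rates.\<close>

lemma blaschke_lens_bound:
  assumes z: "cmod z < 1" and s: "0 < s" "s \<le> 1/2" "2 * s \<le> cmod (1 - z)" "2 * s \<le> cmod (1 + z)"
  shows "(cmod (blaschke (dyadic_zeros p) (lens \<tau> z)))\<^sup>2 * s powr (- \<tau>)
    \<le> max (1 - 8 / 9 * sector_cos) (2 powr (- ((1 - \<tau>) / (2 * \<tau>)))) ^ p * s powr (- ((1 + \<tau>) / 2))"
proof -
  let ?w = "lens \<tau> z" and ?q1 = "1 - 8 / 9 * sector_cos" and ?q2 = "2 powr (- ((1 - \<tau>) / (2 * \<tau>)))"
  let ?B = "(cmod (blaschke (dyadic_zeros p) ?w))\<^sup>2"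
  have w: "cmod ?w < 1" by (rule lens_in_disk[OF \<tau> z])
  have q1: "0 \<le> ?q1" using sector_cos by simp
  show ?thesis
  proof (cases "1 / 2 ^ p \<le> s powr \<tau>")
    case True
    have nW: "cmod (cayley ?w) = cmod (cayley z) powr \<tau>"
      unfolding cayley_lens[OF \<tau> z] by (rule sector_powr_norm[OF cayley_Re_pos[OF z] \<tau>])
    note sb = cayley_norm_bounds[OF \<tau> z s(1,3,4)]
    have c0: "0 < cmod (cayley z)" using sb(1) s by linarith
    have "?B \<le> ?q1 ^ p"
    proof (rule blaschke_dyadic_bound[OF w sector_cos(1)])
      show "sector_cos * cmod (cayley ?w) \<le> Re (cayley ?w)"
        unfolding sector_cos_def nW unfolding cayley_lens[OF \<tau> z]
        by (rule sector_powr_Re[OF cayley_Re_pos[OF z] \<tau>])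
      have "s powr \<tau> \<le> cmod (cayley z) powr \<tau>"
        using sb s \<tau> by (intro powr_mono2) auto
      with True show "1 / 2 ^ p \<le> cmod (cayley ?w)" unfolding nW by linarith
      have "s powr \<tau> \<le> (1 / cmod (cayley z)) powr \<tau>"
        using sb s \<tau> by (intro powr_mono2) auto
      also have "\<dots> = 1 / cmod (cayley ?w)" unfolding nW using c0 by (simp add: powr_divide)
      finally have "1 / 2 ^ p \<le> 1 / cmod (cayley ?w)" using True by linarith
      then show "cmod (cayley ?w) \<le> 2 ^ p" using c0 nW by (simp add: field_simps)
    qed
    also have "\<dots> \<le> max ?q1 ?q2 ^ p" using q1 by (intro power_mono) auto
    finally show ?thesis
      using q1 by (intro mult_mono s_powr_sigma s) (auto intro!: zero_le_power simp: le_max_iff_disj)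
  next
    case False
    have "s powr ((1 - \<tau>) / 2) = (s powr \<tau>) powr ((1 - \<tau>) / (2 * \<tau>))"
      using \<tau> by (simp add: powr_powr)
    also have "\<dots> \<le> (1 / 2 ^ p) powr ((1 - \<tau>) / (2 * \<tau>))"
      using False \<tau> by (intro powr_mono2) auto
    also have "\<dots> = ?q2 ^ p"
    proof -
      have "1 / 2 ^ p = 2 powr (- real p)" by (simp add: powr_minus_divide powr_realpow)
      then show ?thesis by (simp add: powr_powr powr_realpow[symmetric] mult.commute)
    qed
    also have "\<dots> \<le> max ?q1 ?q2 ^ p" by (intro power_mono) auto
    finally have small: "s powr ((1 - \<tau>) / 2) \<le> max ?q1 ?q2 ^ p" .
    have "?B \<le> 1"
      using blaschke_le_1[OF dyadic_zeros_in_disk w] by (simp add: power_le_one)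
    then have "?B * s powr (- \<tau>) \<le> 1 * s powr (- \<tau>)"
      by (intro mult_right_mono) auto
    also have "\<dots> \<le> s powr ((1 - \<tau>) / 2) * s powr (- ((1 + \<tau>) / 2))"
      using s_powr_sigma(2)[OF s(1,2), of s] by simp
    also have "\<dots> \<le> max ?q1 ?q2 ^ p * s powr (- ((1 + \<tau>) / 2))"
      using small by (intro mult_right_mono) auto
    finally show ?thesis .
  qed
qed

lemma interp_error:
  obtains C q where "C > 0" "0 < q" "q < 1"
    and "\<And>p f. f \<in> H2 N \<Longrightarrow> (\<lambda>z. comp_op (lens_diag \<theta>) f z - interp p f z) \<in> H2 N \<and>
      (h2_norm N (\<lambda>z. comp_op (lens_diag \<theta>) f z - interp p f z))\<^sup>2 \<le> C * q ^ p * (h2_norm N f)\<^sup>2"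
proof -
  define q where "q = max (1 - 8 / 9 * sector_cos) (2 powr (- ((1 - \<tau>) / (2 * \<tau>))))"
  have "2 powr (- ((1 - \<tau>) / (2 * \<tau>))) < 2 powr 0"
    using \<tau> by (intro powr_less_mono) auto
  then have q: "0 < q" "q < 1" using sector_cos by (auto simp: q_def)
  obtain C where C: "C > 0"
    and sm: "\<And>f. f \<in> H2 N \<Longrightarrow> summable (\<lambda>n. (cmod (taylor (crit f) n))\<^sup>2)"
    and le: "\<And>f. f \<in> H2 N \<Longrightarrow> (\<Sum>n. (cmod (taylor (crit f) n))\<^sup>2) \<le> C * (h2_norm N f)\<^sup>2"
    using critical_bounded[OF N] unfolding crit_def by blast
  show ?thesis
  proof
    show "C / sector_cos * weight_mass > 0" using C sector_cos weight_mass_pos by simp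
    fix p f assume f: "f \<in> H2 N"
    let ?as = "dyadic_zeros p" and ?c = "taylor (crit f)"
    let ?d = "tm_rest ?as ?c"
    let ?E = "\<lambda>z. comp_op (lens_diag \<theta>) f z - interp p f z"
    let ?g = "\<lambda>w. blaschke ?as w * ev ?d w"
    let ?B = "C * (h2_norm N f)\<^sup>2 / sector_cos * q ^ p"
    note as = dyadic_zeros_in_disk[of p]
    note d = tm_rest_ell2[OF as sm[OF f]]
    have g: "?g holomorphic_on ball 0 1"
      using d by (intro holomorphic_intros blaschke_holomorphic as ev_holomorphic) auto
    have E: "?E z = ?g (lens \<tau> (z 0))" if z: "z \<in> polydisk N" for z
    proof -
      have "cmod (z 0) < 1" using z N by (auto simp: polydisk_def)
      then have w: "cmod (lens \<tau> (z 0)) < 1" by (rule lens_in_disk[OF \<tau>])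
      have "crit f (lens \<tau> (z 0)) = ev ?c (lens \<tau> (z 0))"
        using taylor_sums[OF crit_holomorphic[OF f] w] by (simp add: ev_def sums_iff)
      also have "\<dots> = interp p f z + ?g (lens \<tau> (z 0))"
        unfolding interp_def by (rule tm_decomposition[OF as sm[OF f] w])
      finally show ?thesis by (simp add: comp_via_crit[OF z])
    qed
    have bd: "(cmod (?g (lens \<tau> z)))\<^sup>2 \<le> ?B * s powr (- ((1 + \<tau>) / 2))"
      if z: "cmod z < 1" and s: "0 < s" "s \<le> 1/2" "2 * s \<le> cmod (1 - z)" "2 * s \<le> cmod (1 + z)" for z s
    proof -
      have "(cmod (ev ?d (lens \<tau> z)))\<^sup>2 \<le> (\<Sum>n. (cmod (?d n))\<^sup>2) / sector_cos * s powr (- \<tau>)"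
        using d by (intro ell2_lens_bound z s) auto
      also have "\<dots> \<le> C * (h2_norm N f)\<^sup>2 / sector_cos * s powr (- \<tau>)"
        using d le[OF f] sector_cos by (intro mult_right_mono divide_right_mono) auto
      finally have "(cmod (?g (lens \<tau> z)))\<^sup>2
          \<le> (cmod (blaschke ?as (lens \<tau> z)))\<^sup>2 * (C * (h2_norm N f)\<^sup>2 / sector_cos * s powr (- \<tau>))"
        unfolding norm_mult power_mult_distrib by (intro mult_left_mono) auto
      also have "\<dots> = C * (h2_norm N f)\<^sup>2 / sector_cos * ((cmod (blaschke ?as (lens \<tau> z)))\<^sup>2 * s powr (- \<tau>))"
        by simp
      also have "\<dots> \<le> C * (h2_norm N f)\<^sup>2 / sector_cos * (q ^ p * s powr (- ((1 + \<tau>) / 2)))"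
        unfolding q_def using C sector_cos by (intro mult_left_mono blaschke_lens_bound z s) auto
      finally show ?thesis by (simp add: mult.assoc)
    qed
    have "?E \<in> H2 N"
      by (rule weighted_hardy_bound(1)[where F = ?E, OF g bd E])
    moreover have "(h2_norm N ?E)\<^sup>2 \<le> ?B * weight_mass"
      by (rule weighted_hardy_bound(2)[where F = ?E, OF g bd E])
    ultimately show "?E \<in> H2 N \<and> (h2_norm N ?E)\<^sup>2 \<le> C / sector_cos * weight_mass * q ^ p * (h2_norm N f)\<^sup>2"
      by (simp add: mult_ac)
  qed (fact q)+
qed

text \<open>The case p = 0 of \<open>interp_error\<close>: without zeros \<open>interp 0\<close>
  vanishes, and the error is the whole operator.\<close>

lemma subcritical_bounded: "bounded_on_H2 N (comp_op (lens_diag \<theta>))"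
proof -
  obtain C q where Cq: "C > 0" "0 < q" "q < 1"
    and err: "\<And>p f. f \<in> H2 N \<Longrightarrow> (\<lambda>z. comp_op (lens_diag \<theta>) f z - interp p f z) \<in> H2 N \<and>
      (h2_norm N (\<lambda>z. comp_op (lens_diag \<theta>) f z - interp p f z))\<^sup>2 \<le> C * q ^ p * (h2_norm N f)\<^sup>2"
    using interp_error by blast
  have "interp 0 f = (\<lambda>_. 0)" for f
    by (simp add: interp_def[abs_def] dyadic_zeros_length)
  then have *: "comp_op (lens_diag \<theta>) f \<in> H2 N \<and> (h2_norm N (comp_op (lens_diag \<theta>) f))\<^sup>2 \<le> C * (h2_norm N f)\<^sup>2"
    if "f \<in> H2 N" for f
    using err[OF that, of 0] by simp
  have "h2_norm N (comp_op (lens_diag \<theta>) f) \<le> sqrt C * h2_norm N f" if "f \<in> H2 N" for f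
    by (rule power2_le_imp_le) (use *[OF that] Cq h2_norm_nonneg in \<open>auto simp: power_mult_distrib\<close>)
  with * show ?thesis unfolding bounded_on_H2_def by blast
qed

lemma interp_admissible:
  shows "bounded_on_H2 N (interp p)" and "linear_on_H2 N (interp p)"
    and "(2 * p + 1) * p < n \<Longrightarrow> rank_less N (interp p) n"
proof -
  let ?T = "comp_op (lens_diag \<theta>)" and ?as = "dyadic_zeros p"
  note as = dyadic_zeros_in_disk[of p]
  obtain C q where Cq: "C > 0" "0 < q" "q < 1"
    and err: "\<And>p f. f \<in> H2 N \<Longrightarrow> (\<lambda>z. ?T f z - interp p f z) \<in> H2 N \<and>
      (h2_norm N (\<lambda>z. ?T f z - interp p f z))\<^sup>2 \<le> C * q ^ p * (h2_norm N f)\<^sup>2"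
    using interp_error by blast
  have "h2_norm N (\<lambda>z. ?T f z - interp p f z) \<le> sqrt (C * q ^ p) * h2_norm N f" if "f \<in> H2 N" for f
    by (rule power2_le_imp_le) (use err[OF that, of p] Cq h2_norm_nonneg in \<open>auto simp: power_mult_distrib\<close>)
  then have "bounded_on_H2 N (\<lambda>f z. ?T f z - interp p f z)"
    unfolding bounded_on_H2_def using err by blast
  \<comment> \<open>Subtracting the bounded error from the bounded operator recovers
    \<open>interp p\<close>.\<close>
  from bounded_on_H2_diff[OF N1 subcritical_bounded this]
  show bdd: "bounded_on_H2 N (interp p)" by simp
  obtain D where sm: "\<And>f. f \<in> H2 N \<Longrightarrow> summable (\<lambda>n. (cmod (taylor (crit f) n))\<^sup>2)"
    using critical_bounded[OF N] unfolding crit_def by blast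
  show "linear_on_H2 N (interp p)"
    unfolding linear_on_H2_def
  proof (intro conjI ballI allI)
    show "interp p f \<in> H2 N" if "f \<in> H2 N" for f
      using bdd that unfolding bounded_on_H2_def by blast
    fix f g a b z assume f: "f \<in> H2 N" and g: "g \<in> H2 N"
    have "taylor (crit (\<lambda>w. a * f w + b * g w)) = (\<lambda>n. a * taylor (crit f) n + b * taylor (crit g) n)"
      using taylor_linear[OF crit_holomorphic[OF f] crit_holomorphic[OF g], of a b] by (simp add: crit_def)
    then have "tm_coeff ?as (taylor (crit (\<lambda>w. a * f w + b * g w))) k
        = a * tm_coeff ?as (taylor (crit f)) k + b * tm_coeff ?as (taylor (crit g)) k" for k
      using tm_coeff_linear[OF as sm[OF f] sm[OF g]] by simp
    then show "interp p (\<lambda>w. a * f w + b * g w) z = a * interp p f z + b * interp p g z"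
      by (simp add: interp_def distrib_right sum.distrib sum_distrib_left mult.assoc)
  qed
  assume n: "(2 * p + 1) * p < n"
  show "rank_less N (interp p) n"
    unfolding rank_less_def
  proof (intro exI conjI allI impI ballI)
    show "(2 * p + 1) * p < n" by (rule n)
    show "interp p f z = (\<Sum>k<(2 * p + 1) * p. tm_coeff ?as (taylor (crit f)) k * tm_fun ?as k (lens \<tau> (z 0)))" for f z
      by (simp add: interp_def dyadic_zeros_length)
    fix k
    obtain M where M: "\<And>w. cmod w < 1 \<Longrightarrow> cmod (tm_fun ?as k w) \<le> M"
      using tm_fun_bounded[OF as] by blast
    \<comment> \<open>The weight is at least 1 on {0<..1/2}, so bounded functions satisfy the
      weighted bound.\<close>
    have "(cmod (tm_fun ?as k (lens \<tau> z)))\<^sup>2 \<le> M\<^sup>2 * s powr (- ((1 + \<tau>) / 2))"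
      if "cmod z < 1" "0 < s" "s \<le> 1/2" for z s
    proof -
      have "(cmod (tm_fun ?as k (lens \<tau> z)))\<^sup>2 \<le> M\<^sup>2"
        using M[OF lens_in_disk[OF \<tau> that(1)]] by (intro power_mono) auto
      also have "\<dots> \<le> M\<^sup>2 * s powr (- ((1 + \<tau>) / 2))"
        using s_powr_sigma(3)[OF that(2,3)] mult_left_mono[of 1 _ "M\<^sup>2"] by simp
      finally show ?thesis .
    qed
    then show "(\<lambda>z. tm_fun ?as k (lens \<tau> (z 0))) \<in> H2 N"
      by (intro weighted_hardy_bound(1)[OF tm_fun_holomorphic[OF as]]) auto
  qed
qed

lemma subcritical_approx_num:
  "\<exists>d>0. \<exists>K>0. \<forall>n\<ge>1. approx_num N (comp_op (lens_diag \<theta>)) n \<le> K * exp (- d * sqrt (real n))"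
proof -
  let ?T = "comp_op (lens_diag \<theta>)"
  obtain C q where Cq: "C > 0" "0 < q" "q < 1"
    and err: "\<And>p f. f \<in> H2 N \<Longrightarrow> (\<lambda>z. ?T f z - interp p f z) \<in> H2 N \<and>
      (h2_norm N (\<lambda>z. ?T f z - interp p f z))\<^sup>2 \<le> C * q ^ p * (h2_norm N f)\<^sup>2"
    using interp_error by blast
  \<comment> \<open>exp(-l) is the square root of q: squared norms decay like q^p, norms like exp(-l
    p).\<close>
  define l where "l = - ln q / 2"
  have l: "l > 0" using Cq by (simp add: l_def)
  have bound: "approx_num N ?T n \<le> sqrt C * exp l * exp (- (l / 2) * sqrt (real n))" if n: "n \<ge> 1" for n
  proof -
    \<comment> \<open>For p >= 1 the rank bound (2p + 1) p is below 4 p^2 <= n, and for p = 0 it is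
      0 < n. Since p >= sqrt n / 2 - 1, rounding down costs only the factor exp l.\<close>
    define p where "p = nat \<lfloor>sqrt (real n) / 2\<rfloor>"
    have p: "real p \<le> sqrt (real n) / 2" "sqrt (real n) / 2 \<le> real p + 1"
      unfolding p_def by (auto simp: of_nat_nat) linarith+
    have "(2 * p + 1) * p < n"
    proof (cases "p = 0")
      case False
      have "(2 * real p)\<^sup>2 \<le> (sqrt (real n))\<^sup>2" using p by (intro power_mono) auto
      then have "real (4 * p * p) \<le> real n" by (simp add: power2_eq_square)
      then have "4 * p * p \<le> n" by (simp only: of_nat_le_iff)
      moreover have "(2 * p + 1) * p < 4 * p * p" using False by simp
      ultimately show ?thesis by linarith
    qed (use n in simp)
    then have "approx_num N ?T n \<le> sqrt (C * q ^ p)"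
    proof (intro approx_num_le[OF N1 subcritical_bounded interp_admissible(2,1,3)])
      fix f assume f: "f \<in> H2 N" "h2_norm N f \<le> 1"
      have "(h2_norm N (\<lambda>z. ?T f z - interp p f z))\<^sup>2 \<le> C * q ^ p * (h2_norm N f)\<^sup>2"
        using err f by blast
      also have "\<dots> \<le> C * q ^ p * 1"
        using Cq f h2_norm_nonneg[of N f] by (intro mult_left_mono power_le_one) auto
      finally show "h2_norm N (\<lambda>z. ?T f z - interp p f z) \<le> sqrt (C * q ^ p)"
        by (intro real_le_rsqrt) simp
    qed
    also have "\<dots> = sqrt C * exp (- l * real p)"
    proof -
      have "q = exp (- l) ^ 2" using Cq by (simp add: l_def flip: exp_of_nat_mult)
      then have "q ^ p = (exp (- l) ^ p)\<^sup>2" by (simp add: power_mult[symmetric] mult.commute)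
      then have "sqrt (C * q ^ p) = sqrt C * exp (- l) ^ p" by (simp add: real_sqrt_mult)
      also have "exp (- l) ^ p = exp (- l * real p)" by (simp add: exp_of_nat_mult[symmetric] mult.commute)
      finally show ?thesis .
    qed
    also have "\<dots> \<le> sqrt C * exp (l + - (l / 2) * sqrt (real n))"
      using Cq l p(2) mult_left_mono[of "sqrt (real n) / 2" "real p + 1" l]
      by (intro mult_left_mono) (auto simp: algebra_simps)
    finally show ?thesis by (simp only: exp_add mult.assoc)
  qed
  have "0 < l / 2" "0 < sqrt C * exp l" using l Cq by auto
  with bound show ?thesis by blast
qed

end

lemma bounded_critical:
  assumes N: "N \<ge> 2" and \<theta>: "\<theta> = 1 / real N"
  shows "bounded_on_H2 N (comp_op (lens_diag \<theta>))"
proof -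
  let ?h = "\<lambda>f w. f (\<lambda>_. lens (1 / real N) w)"
  have N1: "1 \<le> N" and inv: "0 < 1 / real N" "1 / real N < 1" using N by auto
  obtain C where C: "C > 0"
    and sm: "\<And>f. f \<in> H2 N \<Longrightarrow> summable (\<lambda>n. (cmod (taylor (?h f) n))\<^sup>2)"
    and le: "\<And>f. f \<in> H2 N \<Longrightarrow> (\<Sum>n. (cmod (taylor (?h f) n))\<^sup>2) \<le> C * (h2_norm N f)\<^sup>2"
    using critical_bounded[OF N] by blast
  have *: "comp_op (lens_diag \<theta>) f \<in> H2 N" "(h2_norm N (comp_op (lens_diag \<theta>) f))\<^sup>2 \<le> C * (h2_norm N f)\<^sup>2"
    if f: "f \<in> H2 N" for f
    using h2_one_variable[OF N1 diag_lens_holomorphic[OF N f inv] sm[OF f], of "comp_op (lens_diag \<theta>) f"] le[OF f]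
    by (simp_all add: comp_lens_diag \<theta>)
  have "h2_norm N (comp_op (lens_diag \<theta>) f) \<le> sqrt C * h2_norm N f" if "f \<in> H2 N" for f
    by (rule power2_le_imp_le) (use *[OF that] C h2_norm_nonneg in \<open>auto simp: power_mult_distrib\<close>)
  with * show ?thesis unfolding bounded_on_H2_def by blast
qed

theorem theorem2p4:
  fixes N :: nat and \<theta> :: real
  assumes "N \<ge> 2" and "0 < \<theta>" and "\<theta> < 1"
  shows "(\<theta> > 1 / real N \<longrightarrow> \<not> bounded_on_H2 N (comp_op (lens_diag \<theta>))) \<and>
         (\<theta> = 1 / real N \<longrightarrow> bounded_on_H2 N (comp_op (lens_diag \<theta>)) \<and>
                              \<not> compact_on_H2 N (comp_op (lens_diag \<theta>))) \<and>
         (\<theta> < 1 / real N \<longrightarrow> compact_on_H2 N (comp_op (lens_diag \<theta>)) \<and>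
            (\<exists>d>0. \<exists>K>0. \<forall>n\<ge>1.
               approx_num N (comp_op (lens_diag \<theta>)) n \<le> K * exp (- d * sqrt (real n))))"
proof (intro conjI impI)
  show "\<not> bounded_on_H2 N (comp_op (lens_diag \<theta>))" if "\<theta> > 1 / real N"
    using assms that by (rule unbounded_supercritical)
  show "bounded_on_H2 N (comp_op (lens_diag \<theta>))" if "\<theta> = 1 / real N"
    using assms(1) that by (rule bounded_critical)
  show "\<not> compact_on_H2 N (comp_op (lens_diag \<theta>))" if "\<theta> = 1 / real N"
    using assms(1) that by (rule noncompact_critical)
next
  assume sub: "\<theta> < 1 / real N"
  define \<tau> where "\<tau> = \<theta> * real N"
  have \<tau>: "0 < \<tau>" "\<tau> < 1" "\<theta> = \<tau> / real N"
    using assms sub by (auto simp: \<tau>_def field_simps)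
  show "compact_on_H2 N (comp_op (lens_diag \<theta>))"
    using assms(1) \<tau> by (rule subcritical_compact)
  show "\<exists>d>0. \<exists>K>0. \<forall>n\<ge>1. approx_num N (comp_op (lens_diag \<theta>)) n \<le> K * exp (- d * sqrt (real n))"
    using assms(1) \<tau> by (rule subcritical_approx_num)
qed

end
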